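(* Let $X=\{X_s:s\ge0\}$ be a one-dimensional Lévy process and $\overline{X}_s=\sup_{u\le s}X_u$, $\underline{X}_s=\inf_{u\le s}X_u$. Suppose that (A1) the Lévy measure $\Pi$ of $X$ satisfies $\int_{|x|\ge1}x^2\,\Pi(\mathrm{d}x)<\infty$; (A2) the payoff function $F:\mathbb{R}\times\mathbb{R}^+\to\mathbb{R}$ is Lipschitz with Lipschitz constant $1$; (A3) the computational time to sample from $\underline{X}_{\mathbf{e}(q)}$ and $\overline{X}_{\mathbf{e}(q)}$ is independent of the value of $q$; and that, for a fixed $t>0$, the random time horizon is $\mathbf{T}(n,t)$, the first arrival after time $t$ of a Poisson process of rate $n/t$ independent of $X$. Let $\widehat F^{n,M}_{\mathrm{MC}}$ and $\widehat F^{\mathcal{M}(n_0,L)}_{\mathrm{ML}}$ be the associated single-level and multilevel Wiener–Hopf Monte Carlo estimators of $\mathbb{E}[F(X_t,\overline{X}_t)]$ defined in the context. Then, for any $\nu\in\mathbb{N}$ and under the constraint that the expected value of the total computational cost is $\mathcal{O}(\nu)$ operations, the root mean square errors of the single-level and the multilevel method (with suitable choices of $n,M$ and of $L,\mathcal{M}(n_0,L)$) can be bounded respectively by $$e(\widehat F^{n,M}_{\mathrm{MC}})\lesssim\nu^{-\frac14}\qquad\text{and}\qquad e(\widehat F^{\mathcal{M}(n_0,L)}_{\mathrm{ML}})\lesssim\nu^{-\frac12}\log^2\nu .$$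
   Context: $\mathbf{e}(q)$ is an exponential random variable with mean $1/q$, independent of $X$. For two positive quantities $a$ and $b$, $a\lesssim b$ means that $a/b$ is uniformly bounded independently of any parameters, such as $t$, $L$, $\{n_\ell\}_{\ell=0}^L$ or $\{M_\ell\}_{\ell=0}^L$, as well as of any parameters describing the underlying Lévy process. Single-level method. Let $N$ be a Poisson process of rate $n/t$ independent of $X$, with $j$-th arrival time $T^N_j$ ($T^N_0=0$), and $\mathbf{T}(n,t)=T^N_{N_t+1}$. Let $S^j=\sup_{T^N_{j-1}\le u\le T^N_j}X_u-X_{T^N_{j-1}}$ and $I^j=X_{T^N_j}-X_{T^N_{j-1}}-S^j$; by the Wiener–Hopf factorisation, $(S^j)$ and $(I^j)$ are independent i.i.d. sequences with the laws of $\overline{X}_{\mathbf{e}(n/t)}$ and $\underline{X}_{\mathbf{e}(n/t)}$. With $V(0)=0$, $V(k)=V(k-1)+S^k+I^k$ and $J(k)=\max_{1\le j\le k}\{V(j-1)+S^j\}$, set $F^n=F(V(N_t+1),J(N_t+1))=F(X_{\mathbf{T}(n,t)},\overline{X}_{\mathbf{T}(n,t)})$. Sampling $F^n$ requires simultaneous sampling of the triple $(\overline{X}_{\mathbf{e}(q)},X_{\mathbf{e}(q)}-\overline{X}_{\mathbf{e}(q)},\mathbf{e}(q))$ with $q=n/t$, so the result is a theoretical one, the algorithm being implementable only where such sampling is possible. The estimator is $\widehat F^{n,M}_{\mathrm{MC}}=\frac1M\sum_{i=1}^MF^{n,(i)}$ with $F^{n,(i)}$ i.i.d. samples of $F^n$.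 Multilevel method. Let $n_\ell=n_0s^\ell$ with $n_0\in\mathbb{N}$ and $s>1$ an integer. For $\mathcal{M}(n_0,L)=\{M_\ell\}_{\ell=0}^L$, $$\widehat F^{\mathcal{M}(n_0,L)}_{\mathrm{ML}}=\frac1{M_0}\sum_{i=1}^{M_0}F^{n_0,(i)}+\sum_{\ell=1}^L\frac1{M_\ell}\sum_{i=1}^{M_\ell}\big(F^{n_\ell,(i)}-F^{n_{\ell-1},(i)}\big),$$ the $L+1$ averages being computed independently by standard Monte Carlo. In each difference $F^{n_\ell}-F^{n_{\ell-1}}$ the two terms come from the same draw of the path of $X$ by Poisson thinning: $F^{n_\ell}$ uses the first arrival after $t$ of a Poisson process $N^\ell$ of rate $n_\ell/t$ independent of $X$; each arrival of $N^\ell$ is independently accepted with probability $1/s$ (a fair coin if $s=2$), and $F^{n_{\ell-1}}$ uses the first accepted arrival after $t$. Equivalently, with probability $1/s$ the two times coincide and the difference is $0$; otherwise one takes one further independent draw $(S,I)$, with $S$ and $I$ independent and having the laws of $\overline{X}_{\mathbf{e}(n_{\ell-1}/t)}$ and $\underline{X}_{\mathbf{e}(n_{\ell-1}/t)}$, and the coarse maximum is $\max(\overline{X}_{\mathbf{T}(n_\ell,t)},X_{\mathbf{T}(n_\ell,t)}+S)$ and the coarse terminal value is $X_{\mathbf{T}(n_\ell,t)}+S+I$. Cost is measured in floating point operations. The root mean square error of an estimator $\widehat F$ is $e(\widehat F)=\big(\mathbb{E}[(\widehat F-\mathbb{E}[F(X_t,\overline{X}_t)])^2]\big)^{1/2}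$.
   Formalization: Constants uniform in the Lévy process and t are impossible (scale X), so both errors are bounded by a constant times the L² norm of X_t times the stated rate; the multilevel constant may depend on s; the multilevel bound is for ν ≥ 2, since log²ν = 0 at ν = 1. *)

theory Defs
  imports "HOL-Probability.Probability"
begin

definition cadlag :: "(real \<Rightarrow> real) \<Rightarrow> bool" where
  "cadlag x \<longleftrightarrow>
     (\<forall>u\<ge>0. continuous (at_right u) x) \<and> (\<forall>u>0. \<exists>l. (x \<longlongrightarrow> l) (at_left u))"

text \<open>A process is a function of time and outcome. Only its values at times \<open>u \<ge> 0\<close> are
  meaningful. As usual the exceptional null set is discarded, so that every path is cadlag
  and starts at 0; this makes running suprema over intervals measurable.\<close>

locale levy_process = prob_space M for M :: "'a measure" +
  fixes X :: "real \<Rightarrow> 'a \<Rightarrow> real"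
  assumes measurable_X: "0 \<le> u \<Longrightarrow> X u \<in> borel_measurable M"
    and start: "\<omega> \<in> space M \<Longrightarrow> X 0 \<omega> = 0"
    and cadlag_paths: "\<omega> \<in> space M \<Longrightarrow> cadlag (\<lambda>u. X u \<omega>)"
    and stationary_increments: "0 \<le> u \<Longrightarrow> 0 \<le> h \<Longrightarrow>
      distr M borel (\<lambda>\<omega>. X (u + h) \<omega> - X u \<omega>) = distr M borel (X h)"
    and independent_increments: "0 \<le> r 0 \<Longrightarrow> mono r \<Longrightarrow>
      indep_vars (\<lambda>_. borel) (\<lambda>i \<omega>. X (r (Suc i)) \<omega> - X (r i) \<omega>) {..<k::nat}"

text \<open>The Levy measure is the jump measure of the Levy-Khintchine triplet, here with the
  truncation function \<open>x \<mapsto> x 1(|x| < 1)\<close>.\<close>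

definition levy_khintchine_exponent :: "real \<Rightarrow> real \<Rightarrow> real measure \<Rightarrow> real \<Rightarrow> complex" where
  "levy_khintchine_exponent a \<sigma> \<Lambda> \<theta> =
     \<i> * of_real (a * \<theta>) - of_real (\<sigma>\<^sup>2 * \<theta>\<^sup>2 / 2) +
     (CLINT x|\<Lambda>. iexp (\<theta> * x) - 1 - \<i> * of_real (\<theta> * x * indicator {-1<..<1} x))"

definition has_levy_measure :: "'a measure \<Rightarrow> (real \<Rightarrow> 'a \<Rightarrow> real) \<Rightarrow> real measure \<Rightarrow> bool" where
  "has_levy_measure M X \<Lambda> \<longleftrightarrow>
     sets \<Lambda> = sets borel \<and> emeasure \<Lambda> {0} = 0 \<and> (\<integral>\<^sup>+x. ennreal (min 1 (x\<^sup>2)) \<partial>\<Lambda>) < \<infinity> \<and>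
     (\<exists>a \<sigma>. \<forall>u\<ge>0. \<forall>\<theta>.
        char (distr M borel (X u)) \<theta> = exp (of_real u * levy_khintchine_exponent a \<sigma> \<Lambda> \<theta>))"

text \<open>A Poisson process is represented by its gaps \<open>g\<close>: gap number \<open>j\<close> (counting from 0) lies
  between arrivals \<open>j\<close> and \<open>j + 1\<close>, and arrival 0 is the time origin. Under the law of the gaps
  the set in \<open>num_arrivals\<close> is almost surely finite.\<close>

definition arrival :: "(nat \<Rightarrow> real) \<Rightarrow> nat \<Rightarrow> real" where
  "arrival g j = (\<Sum>i<j. g i)"

definition num_arrivals :: "(nat \<Rightarrow> real) \<Rightarrow> real \<Rightarrow> nat" where
  "num_arrivals g t = card {j. 1 \<le> j \<and> arrival g j \<le> t}"

definition gap_space :: "real \<Rightarrow> (nat \<Rightarrow> real) measure" where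
  "gap_space q = (\<Pi>\<^sub>M _\<in>UNIV. density lborel (\<lambda>x. ennreal (exponential_density q x)))"

text \<open>In the following \<open>x\<close> is a path of the Levy process.\<close>

definition sup_incr :: "(real \<Rightarrow> real) \<Rightarrow> (nat \<Rightarrow> real) \<Rightarrow> nat \<Rightarrow> real" where
  "sup_incr x g j = (SUP u\<in>{arrival g (j - 1)..arrival g j}. x u) - x (arrival g (j - 1))"

definition inf_incr :: "(real \<Rightarrow> real) \<Rightarrow> (nat \<Rightarrow> real) \<Rightarrow> nat \<Rightarrow> real" where
  "inf_incr x g j = x (arrival g j) - x (arrival g (j - 1)) - sup_incr x g j"

primrec walk :: "(real \<Rightarrow> real) \<Rightarrow> (nat \<Rightarrow> real) \<Rightarrow> nat \<Rightarrow> real" where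
  "walk x g 0 = 0"
| "walk x g (Suc k) = walk x g k + sup_incr x g (Suc k) + inf_incr x g (Suc k)"

definition walk_max :: "(real \<Rightarrow> real) \<Rightarrow> (nat \<Rightarrow> real) \<Rightarrow> nat \<Rightarrow> real" where
  "walk_max x g k = Max ((\<lambda>j. walk x g (j - 1) + sup_incr x g j) ` {1..k})"

definition payoff_at ::
    "(real \<times> real \<Rightarrow> real) \<Rightarrow> (real \<Rightarrow> real) \<Rightarrow> (nat \<Rightarrow> real) \<Rightarrow> nat \<Rightarrow> real" where
  "payoff_at F x g k = F (walk x g k, walk_max x g k)"

definition target :: "'a measure \<Rightarrow> (real \<Rightarrow> 'a \<Rightarrow> real) \<Rightarrow> real \<Rightarrow> (real \<times> real \<Rightarrow> real) \<Rightarrow> real" where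
  "target M X t F = (LINT \<omega>|M. F (X t \<omega>, SUP u\<in>{0..t}. X u \<omega>))"

text \<open>The root mean square error takes the value \<open>\<top>\<close> for estimators of infinite variance,
  where a Bochner integral would return 0.\<close>

definition rmse :: "'b measure \<Rightarrow> ('b \<Rightarrow> real) \<Rightarrow> real \<Rightarrow> ennreal" where
  "rmse P Y \<theta> =
     (let m = \<integral>\<^sup>+\<omega>. ennreal ((Y \<omega> - \<theta>)\<^sup>2) \<partial>P in if m = \<top> then \<top> else ennreal (sqrt (enn2real m)))"

text \<open>\<open>costS q\<close> and \<open>costI q\<close> are the costs of one draw with the law of the supremum and of the
  infimum, respectively, at an independent exponential time of rate \<open>q\<close>. The constant \<open>cstep\<close>
  covers the remaining operations of a step of the walk (its time increment, the additions, the
  comparison, the acceptance coin) and \<open>cpay\<close> one evaluation of the payoff and its contribution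
  to the average.\<close>

definition walk_cost ::
    "(real \<Rightarrow> real) \<Rightarrow> (real \<Rightarrow> real) \<Rightarrow> real \<Rightarrow> real \<Rightarrow> nat \<Rightarrow> real" where
  "walk_cost costS costI cstep q k = (\<Sum>j=1..k. costS q + costI q + cstep)"

definition path_space :: "'a measure \<Rightarrow> real \<Rightarrow> ('a \<times> (nat \<Rightarrow> real)) measure" where
  "path_space M q = M \<Otimes>\<^sub>M gap_space q"

definition mc_space ::
    "'a measure \<Rightarrow> real \<Rightarrow> nat \<Rightarrow> nat \<Rightarrow> (nat \<Rightarrow> 'a \<times> (nat \<Rightarrow> real)) measure" where
  "mc_space M t n m = (\<Pi>\<^sub>M i\<in>{..<m}. path_space M (real n / t))"

definition mc_estimator ::
    "(real \<Rightarrow> 'a \<Rightarrow> real) \<Rightarrow> real \<Rightarrow> (real \<times> real \<Rightarrow> real) \<Rightarrow> nat \<Rightarrow>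
     (nat \<Rightarrow> 'a \<times> (nat \<Rightarrow> real)) \<Rightarrow> real" where
  "mc_estimator X t F m z =
     (\<Sum>i<m. case z i of (\<omega>, g) \<Rightarrow> payoff_at F (\<lambda>u. X u \<omega>) g (num_arrivals g t + 1)) / real m"

definition mc_cost ::
    "(real \<Rightarrow> real) \<Rightarrow> (real \<Rightarrow> real) \<Rightarrow> real \<Rightarrow> real \<Rightarrow> real \<Rightarrow> nat \<Rightarrow> nat \<Rightarrow>
     (nat \<Rightarrow> 'a \<times> (nat \<Rightarrow> real)) \<Rightarrow> real" where
  "mc_cost costS costI cstep cpay t n m z =
     (\<Sum>i<m. case z i of (\<omega>, g) \<Rightarrow>
        walk_cost costS costI cstep (real n / t) (num_arrivals g t + 1) + cpay)"

text \<open>In addition to the gaps, a sample carries one acceptance coin \<open>b j\<close> for each arrival \<open>j\<close>.\<close>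

definition coin_space :: "nat \<Rightarrow> (nat \<Rightarrow> bool) measure" where
  "coin_space s = (\<Pi>\<^sub>M _\<in>UNIV. measure_pmf (bernoulli_pmf (1 / real s)))"

definition thinned_space ::
    "'a measure \<Rightarrow> real \<Rightarrow> nat \<Rightarrow> ('a \<times> (nat \<Rightarrow> real) \<times> (nat \<Rightarrow> bool)) measure" where
  "thinned_space M q s = M \<Otimes>\<^sub>M (gap_space q \<Otimes>\<^sub>M coin_space s)"

definition first_accepted :: "(nat \<Rightarrow> real) \<Rightarrow> (nat \<Rightarrow> bool) \<Rightarrow> real \<Rightarrow> nat" where
  "first_accepted g b t = (LEAST k. num_arrivals g t < k \<and> b k)"

definition level_sample ::
    "(real \<Rightarrow> 'a \<Rightarrow> real) \<Rightarrow> real \<Rightarrow> (real \<times> real \<Rightarrow> real) \<Rightarrow> nat \<Rightarrow>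
     'a \<times> (nat \<Rightarrow> real) \<times> (nat \<Rightarrow> bool) \<Rightarrow> real" where
  "level_sample X t F l = (\<lambda>(\<omega>, g, b).
     let x = (\<lambda>u. X u \<omega>); y = payoff_at F x g (num_arrivals g t + 1)
     in if l = 0 then y else y - payoff_at F x g (first_accepted g b t))"

definition level_rate :: "real \<Rightarrow> nat \<Rightarrow> nat \<Rightarrow> nat \<Rightarrow> real" where
  "level_rate t s n0 l = real (n0 * s ^ l) / t"

definition ml_space ::
    "'a measure \<Rightarrow> real \<Rightarrow> nat \<Rightarrow> nat \<Rightarrow> nat \<Rightarrow> (nat \<Rightarrow> nat) \<Rightarrow>
     (nat \<times> nat \<Rightarrow> 'a \<times> (nat \<Rightarrow> real) \<times> (nat \<Rightarrow> bool)) measure" where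
  "ml_space M t s n0 L m =
     (\<Pi>\<^sub>M p\<in>(SIGMA l:{..L}. {..<m l}). thinned_space M (level_rate t s n0 (fst p)) s)"

definition ml_estimator ::
    "(real \<Rightarrow> 'a \<Rightarrow> real) \<Rightarrow> real \<Rightarrow> (real \<times> real \<Rightarrow> real) \<Rightarrow> nat \<Rightarrow> (nat \<Rightarrow> nat) \<Rightarrow>
     (nat \<times> nat \<Rightarrow> 'a \<times> (nat \<Rightarrow> real) \<times> (nat \<Rightarrow> bool)) \<Rightarrow> real" where
  "ml_estimator X t F L m z = (\<Sum>l\<le>L. (\<Sum>i<m l. level_sample X t F l (z (l, i))) / real (m l))"

text \<open>For \<open>l \<ge> 1\<close> the walk is charged up to the first accepted arrival after \<open>t\<close>, i.e. for every
  step that the coupled pair uses. If the steps beyond the first arrival after \<open>t\<close> are replaced by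
  a single draw at the coarser rate, the cost can only
  decrease, provided that the cost of a draw does not depend on the rate.\<close>

definition level_cost ::
    "(real \<Rightarrow> real) \<Rightarrow> (real \<Rightarrow> real) \<Rightarrow> real \<Rightarrow> real \<Rightarrow> real \<Rightarrow> nat \<Rightarrow> nat \<Rightarrow> nat \<Rightarrow>
     'a \<times> (nat \<Rightarrow> real) \<times> (nat \<Rightarrow> bool) \<Rightarrow> real" where
  "level_cost costS costI cstep cpay t s n0 l = (\<lambda>(\<omega>, g, b).
     let c = walk_cost costS costI cstep (level_rate t s n0 l)
     in if l = 0 then c (num_arrivals g t + 1) + cpay else c (first_accepted g b t) + 2 * cpay)"

definition ml_cost ::
    "(real \<Rightarrow> real) \<Rightarrow> (real \<Rightarrow> real) \<Rightarrow> real \<Rightarrow> real \<Rightarrow> real \<Rightarrow> nat \<Rightarrow> nat \<Rightarrow> nat \<Rightarrow>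
     (nat \<Rightarrow> nat) \<Rightarrow> (nat \<times> nat \<Rightarrow> 'a \<times> (nat \<Rightarrow> real) \<times> (nat \<Rightarrow> bool)) \<Rightarrow> real" where
  "ml_cost costS costI cstep cpay t s n0 L m z =
     (\<Sum>l\<le>L. \<Sum>i<m l. level_cost costS costI cstep cpay t s n0 l (z (l, i)))"

text \<open>The error constants cannot be uniform over all Levy processes and horizons in absolute
  terms: multiplying \<open>X\<close> by a factor (and rescaling the payoff) multiplies the errors by that
  factor. The errors are therefore measured in units of the \<open>L\<^sup>2\<close> norm of \<open>X t\<close>, which is finite when
  the Levy measure has a finite second moment away from the origin.\<close>

definition l2_norm :: "'a measure \<Rightarrow> (real \<Rightarrow> 'a \<Rightarrow> real) \<Rightarrow> real \<Rightarrow> real" where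
  "l2_norm M X t = sqrt (LINT \<omega>|M. (X t \<omega>)\<^sup>2)"

end

theory Submission
  imports Defs
begin

text \<open>Since \<open>F\<close> is Lipschitz and the horizon is independent of \<open>X\<close>, conditioning on the clock reduces all
  errors to increments of \<open>(X, sup X)\<close> over a deterministic interval of length \<open>h\<close>. By Doob's
  maximal inequality these have second moment at most \<open>9 V h\<close>, where \<open>V h = \<rho> h + \<mu>\<^sup>2 h\<^sup>2\<close> is the second
  moment of \<open>X h\<close>. By lack of memory the overshoot of the first arrival after \<open>t\<close> is exponential
  of rate \<open>n / t\<close>, and that of the first accepted arrival is exponential of rate \<open>n / (s t)\<close>.
  Hence the squared bias and the level variances are of order \<open>V t / n\<close>, and the coarse term of a level has
  the same mean as the fine term of the level below, so that the multilevel means telescope. The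
  rates follow with \<open>n = M \<approx> \<surd>\<nu>\<close> and with \<open>s^L \<approx> \<nu>\<close>, \<open>M\<^sub>l \<approx> \<nu> / (s^l (L + 1))\<close>.\<close>

section \<open>Cadlag paths\<close>

text \<open>The errors are to be bounded by fixed constants times \<open>l2_norm M X t\<close>. A
  moment bound in terms of the Levy triplet cannot give this, because the drift \<open>a\<close> and
  the large jumps may cancel in the mean. Therefore the characteristic function, the only place
  where \<open>\<Lambda>\<close> enters, serves to prove finiteness of the second moment, which is
  then computed exactly as \<open>V\<close>. Since both coefficients of \<open>V\<close> are
  nonnegative, shrinking the time from \<open>t\<close> to \<open>t / r\<close> with r \<ge> 1 gains
  at least the factor 1 / r relative to \<open>V t\<close>. Two technical obstacles shape the rest.
  The path is evaluated at random times, so measurability jointly in outcome and time has to be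
  extracted from right-continuity. Moreover the samples are defined for every gap and coin sequence,
  including negative gaps, clocks that never pass \<open>t\<close> and coins that never succeed;
  each sample is therefore replaced by an almost surely equal version that is measurable by
  construction.\<close>

lemma cadlag_bounded:
  assumes "cadlag x" "0 \<le> a"
  shows "\<exists>B. \<forall>u\<in>{a..b}. \<bar>x u\<bar> \<le> B"
proof (cases "a \<le> b")
  case True
  have "0 \<le> a \<longrightarrow> (\<exists>B. \<forall>u\<in>{a..b}. \<bar>x u\<bar> \<le> B)"
  \<comment> \<open>Bisection: boundedness passes to the union of adjacent intervals and holds near
    every point, by the one-sided limits. The guard \<open>0 \<le> a\<close> belongs to the property
    because nothing is known at negative times.\<close>
  proof (rule Bolzano[where P = "\<lambda>a b. 0 \<le> a \<longrightarrow> (\<exists>B. \<forall>u\<in>{a..b}. \<bar>x u\<bar> \<le> B)", OF True])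
    fix a b c :: real
    assume ab: "0 \<le> a \<longrightarrow> (\<exists>B. \<forall>u\<in>{a..b}. \<bar>x u\<bar> \<le> B)" and bc: "0 \<le> b \<longrightarrow> (\<exists>B. \<forall>u\<in>{b..c}. \<bar>x u\<bar> \<le> B)"
      and le: "a \<le> b" "b \<le> c"
    show "0 \<le> a \<longrightarrow> (\<exists>B. \<forall>u\<in>{a..c}. \<bar>x u\<bar> \<le> B)"
    proof
      assume "0 \<le> a"
      then obtain B1 B2 where "\<forall>u\<in>{a..b}. \<bar>x u\<bar> \<le> B1" "\<forall>u\<in>{b..c}. \<bar>x u\<bar> \<le> B2"
        using ab bc le by (auto simp del: atLeastAtMost_iff)
      then have "\<forall>u\<in>{a..c}. \<bar>x u\<bar> \<le> max B1 B2"
        by (metis atLeastAtMost_iff le_max_iff_disj linear)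
      then show "\<exists>B. \<forall>u\<in>{a..c}. \<bar>x u\<bar> \<le> B" by blast
    qed
  next
    fix z assume "a \<le> z" "z \<le> b"
    with \<open>0 \<le> a\<close> have z: "0 \<le> z" by simp
    have "(x \<longlongrightarrow> x z) (at_right z)"
      using assms(1) z by (auto simp: cadlag_def continuous_within)
    then have "eventually (\<lambda>u. dist (x u) (x z) < 1) (at_right z)"
      by (rule tendstoD) simp
    then obtain r where r: "z < r" "\<And>u. z < u \<Longrightarrow> u < r \<Longrightarrow> dist (x u) (x z) < 1"
      unfolding eventually_at_right_field by blast
    have "\<exists>l B. l < z \<and> (\<forall>u. 0 \<le> u \<longrightarrow> l < u \<longrightarrow> u < z \<longrightarrow> \<bar>x u\<bar> \<le> B)"
    proof (cases "z = 0")
      case True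
      \<comment> \<open>There is no left limit at 0, but also no u with 0 \<le> u < 0, so any
        negative l serves.\<close>
      then show ?thesis by (intro exI[of _ "-1"]) auto
    next
      case False
      with z obtain y where "(x \<longlongrightarrow> y) (at_left z)"
        using assms(1) unfolding cadlag_def by (metis less_eq_real_def)
      then have "eventually (\<lambda>u. dist (x u) y < 1) (at_left z)"
        by (rule tendstoD) simp
      then obtain l where l: "l < z" "\<And>u. l < u \<Longrightarrow> u < z \<Longrightarrow> dist (x u) y < 1"
        unfolding eventually_at_left_field by blast
      then have "\<bar>x u\<bar> \<le> \<bar>y\<bar> + 1" if "l < u" "u < z" for u
        using l(2)[OF that] by (auto simp: dist_real_def)
      then show ?thesis using l(1) by blast
    qed
    then obtain l B where l: "l < z" "\<And>u. 0 \<le> u \<Longrightarrow> l < u \<Longrightarrow> u < z \<Longrightarrow> \<bar>x u\<bar> \<le> B" by blast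
    show "\<exists>d>0. \<forall>a b. a \<le> z \<and> z \<le> b \<and> b - a < d \<longrightarrow> 0 \<le> a \<longrightarrow> (\<exists>B. \<forall>u\<in>{a..b}. \<bar>x u\<bar> \<le> B)"
    proof (rule exI[of _ "min (z - l) (r - z)"], intro conjI allI impI)
      show "0 < min (z - l) (r - z)" using r l by simp
      fix a b assume ab: "a \<le> z \<and> z \<le> b \<and> b - a < min (z - l) (r - z)" "0 \<le> a"
      have "\<bar>x u\<bar> \<le> max B (\<bar>x z\<bar> + 1)" if "u \<in> {a..b}" for u
      proof -
        consider "u < z" | "u = z" | "z < u" by linarith
        then show ?thesis
        proof cases
          case 1
          then show ?thesis using l(2)[of u] that ab by auto
        next
          case 2
          then show ?thesis by auto
        next
          case 3
          then show ?thesis using r(2)[of u] that ab by (auto simp: dist_real_def)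
        qed
      qed
      then show "\<exists>B. \<forall>u\<in>{a..b}. \<bar>x u\<bar> \<le> B" by blast
    qed
  qed
  with assms(2) show ?thesis by blast
qed auto

lemma cadlag_bdd_above: "cadlag x \<Longrightarrow> 0 \<le> a \<Longrightarrow> bdd_above (x ` {a..b})"
  using cadlag_bounded[of x a b] by (auto simp: bdd_above_def) (meson abs_le_D1 atLeastAtMost_iff)

lemma cadlag_le_SUP: "cadlag x \<Longrightarrow> 0 \<le> a \<Longrightarrow> a \<le> u \<Longrightarrow> u \<le> b \<Longrightarrow> x u \<le> (SUP u\<in>{a..b}. x u)"
  by (intro cSUP_upper cadlag_bdd_above) auto

lemma SUP_concat:
  assumes "cadlag x" "0 \<le> a" "a \<le> b" "b \<le> c"
  shows "(SUP u\<in>{a..c}. x u) = max (SUP u\<in>{a..b}. x u) (SUP u\<in>{b..c}. x u)"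
proof -
  have "{a..c} = {a..b} \<union> {b..c}" using assms by auto
  then show ?thesis
    using assms by (simp add: cSUP_union cadlag_bdd_above sup_max)
qed

text \<open>If the supremum grows at all, the new one is attained or approached on
  \<open>{a..b}\<close>, while the old one was already at least \<open>x a\<close>. This reduces
  increments of the running maximum to a quantity that starts afresh at time a.\<close>

lemma SUP_increment:
  assumes "cadlag x" "0 \<le> a" "a \<le> b"
  shows "\<bar>(SUP u\<in>{0..b}. x u) - (SUP u\<in>{0..a}. x u)\<bar> \<le> (SUP u\<in>{a..b}. x u) - x a"
  using SUP_concat[of x 0 a b] cadlag_le_SUP[of x 0 a a] cadlag_le_SUP[of x a a b] assms by auto

lemma walk_eq: "walk x g k = x (arrival g k) - x 0"
  by (induction k) (simp_all add: inf_incr_def arrival_def)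

lemma arrival_nonneg: "(\<And>i. 0 \<le> g i) \<Longrightarrow> 0 \<le> arrival g k"
  by (simp add: arrival_def sum_nonneg)

lemma arrival_mono: "(\<And>i. 0 \<le> g i) \<Longrightarrow> i \<le> k \<Longrightarrow> arrival g i \<le> arrival g k"
  unfolding arrival_def by (intro sum_mono2) auto

text \<open>The walk records the exact supremum between consecutive arrivals, so nothing is lost by
  looking at the path only there: the random horizon is the sole source of bias. For k = 0 the
  maximum would run over the empty set.\<close>

lemma walk_max_eq:
  assumes "cadlag x" "x 0 = 0" "\<And>i. 0 \<le> g i" "1 \<le> k"
  shows "walk_max x g k = (SUP u\<in>{0..arrival g k}. x u)"
proof -
  have *: "walk x g (j - 1) + sup_incr x g j = (SUP u\<in>{arrival g (j - 1)..arrival g j}. x u)" for j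
    using assms(2) by (simp add: walk_eq sup_incr_def)
  show ?thesis
    using assms(4)
  proof (induction k rule: dec_induct)
    case base
    show ?case using *[of 1] by (simp add: walk_max_def arrival_def)
  next
    case (step k)
    have "{1..Suc k} = insert (Suc k) {1..k}" by auto
    then have "walk_max x g (Suc k) = max (walk x g (Suc k - 1) + sup_incr x g (Suc k)) (walk_max x g k)"
      using step unfolding walk_max_def by simp
    also have "\<dots> = max (SUP u\<in>{arrival g k..arrival g (Suc k)}. x u) (SUP u\<in>{0..arrival g k}. x u)"
      using *[of "Suc k"] step by simp
    also have "\<dots> = (SUP u\<in>{0..arrival g (Suc k)}. x u)"
      using SUP_concat[of x 0 "arrival g k" "arrival g (Suc k)"] assms
        arrival_nonneg[of g k] arrival_mono[of g k "Suc k"] by (simp add: max.commute)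
    finally show ?case .
  qed
qed

section \<open>Approximation from the right and countable suprema\<close>

lemma cadlag_right_approx:
  assumes "cadlag x" "0 \<le> u" "\<And>n. u \<le> v n" "v \<longlonglongrightarrow> u"
  shows "(\<lambda>n. x (v n)) \<longlonglongrightarrow> x u"
proof -
  have "continuous (at u within {u..}) x"
    using assms by (simp add: cadlag_def at_within_Ici_at_right)
  then show ?thesis
    using assms by (auto simp: continuous_within_sequentially o_def)
qed

text \<open>Rounding up, not down: the approximating points must lie on the side on which paths are
  continuous.\<close>

lemma ceiling_approx:
  fixes y :: real
  shows "y \<le> of_int \<lceil>y * real (Suc n)\<rceil> / real (Suc n)"
    and "(\<lambda>n. of_int \<lceil>y * real (Suc n)\<rceil> / real (Suc n)) \<longlonglongrightarrow> y"
proof -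
  have lo: "y \<le> of_int \<lceil>y * real (Suc n)\<rceil> / real (Suc n)" for n
    using le_of_int_ceiling[of "y * real (Suc n)"] by (simp add: pos_le_divide_eq del: of_nat_Suc)
  have hi: "of_int \<lceil>y * real (Suc n)\<rceil> / real (Suc n) \<le> y + 1 / real (Suc n)" for n
  proof -
    have "real_of_int \<lceil>y * real (Suc n)\<rceil> \<le> y * real (Suc n) + 1" by linarith
    then show ?thesis by (simp add: pos_divide_le_eq distrib_right del: of_nat_Suc)
  qed
  have "(\<lambda>n. y + 1 / real (Suc n)) \<longlonglongrightarrow> y + 0"
    by (intro tendsto_add tendsto_const LIMSEQ_Suc lim_const_over_n)
  then show "(\<lambda>n. of_int \<lceil>y * real (Suc n)\<rceil> / real (Suc n)) \<longlonglongrightarrow> y"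
    by (intro tendsto_sandwich[OF always_eventually[OF allI[OF lo]] always_eventually[OF allI[OF hi]] tendsto_const])
      (simp only: add_0_right)
  show "y \<le> of_int \<lceil>y * real (Suc n)\<rceil> / real (Suc n)" by (rule lo)
qed

definition grid :: "real \<Rightarrow> real \<Rightarrow> nat \<Rightarrow> nat \<Rightarrow> real" where
  "grid a b n i = a + (b - a) * real i / real n"

text \<open>Guarantees that maxima over ever finer grids miss nothing of the supremum of a cadlag
  path; u = b is reached through the last grid point.\<close>

lemma grid_right_approx:
  assumes "a \<le> u" "u \<le> b"
  obtains i where "\<And>n. i n \<le> Suc n" "\<And>n. u \<le> grid a b (Suc n) (i n)"
    "(\<lambda>n. grid a b (Suc n) (i n)) \<longlonglongrightarrow> u"
proof (cases "a = b")
  case True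
  show ?thesis by (rule that[of "\<lambda>_. 0"]) (use True assms in \<open>auto simp: grid_def\<close>)
next
  case False
  define h where "h = b - a"
  have h: "0 < h" using False assms by (simp add: h_def)
  define y where "y = (u - a) / h"
  define i where "i n = nat \<lceil>y * real (Suc n)\<rceil>" for n
  have nn: "0 \<le> y * real (Suc n)" for n using assms h by (simp add: y_def)
  have i: "real (i n) = of_int \<lceil>y * real (Suc n)\<rceil>" for n
    unfolding i_def using ceiling_mono[OF nn[of n]] by (intro of_nat_nat) (simp only: ceiling_zero)
  have grid: "grid a b (Suc n) (i n) = a + h * (of_int \<lceil>y * real (Suc n)\<rceil> / real (Suc n))" for n
    by (simp add: grid_def i h_def del: of_nat_Suc)
  have u: "u = a + h * y" using h by (simp add: y_def)
  show ?thesis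
  proof (rule that[of i])
    show "i n \<le> Suc n" for n
    proof -
      have "y * real (Suc n) \<le> real (Suc n)"
        using h assms by (intro mult_left_le_one_le) (auto simp: h_def y_def)
      then show ?thesis unfolding i_def by (simp add: nat_le_iff ceiling_le_iff del: of_nat_Suc)
    qed
    show "u \<le> grid a b (Suc n) (i n)" for n
      unfolding grid u using h by (intro add_left_mono mult_left_mono ceiling_approx(1)) simp
    show "(\<lambda>n. grid a b (Suc n) (i n)) \<longlonglongrightarrow> u"
      unfolding grid u by (intro tendsto_add tendsto_mult tendsto_const ceiling_approx(2))
  qed
qed

text \<open>Capping at b instead of restricting the rationals has two effects: the endpoint b, which
  cannot be approached from the right inside the interval, is included, and the index set does not
  depend on b, so that b may later be random.\<close>

lemma SUP_as_countable_SUP: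
  assumes "cadlag x" "0 \<le> b"
  shows "(SUP u\<in>{0..b}. x u) = (SUP q\<in>\<rat> \<inter> {0..}. x (min q b))"
proof (rule antisym)
  have bdd: "bdd_above ((\<lambda>q. x (min q b)) ` (\<rat> \<inter> {0..}))"
    by (rule bdd_above_mono[OF cadlag_bdd_above[OF assms(1) order_refl, of b]]) (use assms(2) in auto)
  show "(SUP q\<in>\<rat> \<inter> {0..}. x (min q b)) \<le> (SUP u\<in>{0..b}. x u)"
  proof (rule cSUP_least)
    show "\<rat> \<inter> {0::real..} \<noteq> {}" by (auto intro!: exI[of _ 0])
    show "x (min q b) \<le> (SUP u\<in>{0..b}. x u)" if "q \<in> \<rat> \<inter> {0..}" for q
      using that assms by (intro cadlag_le_SUP) auto
  qed
  show "(SUP u\<in>{0..b}. x u) \<le> (SUP q\<in>\<rat> \<inter> {0..}. x (min q b))"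
  proof (rule cSUP_least)
    fix u assume u: "u \<in> {0..b}"
    define q where "q n = real_of_int \<lceil>u * real (Suc n)\<rceil> / real (Suc n)" for n
    have 1: "u \<le> q n" for n unfolding q_def by (rule ceiling_approx)
    have q: "q \<longlonglongrightarrow> u" unfolding q_def by (rule ceiling_approx)
    have lim: "(\<lambda>n. x (min (q n) b)) \<longlonglongrightarrow> x u"
    proof (rule cadlag_right_approx[OF assms(1)])
      show "0 \<le> u" "\<And>n. u \<le> min (q n) b" using u 1 by auto
      have "(\<lambda>n. min (q n) b) \<longlonglongrightarrow> min u b" by (intro tendsto_min q tendsto_const)
      then show "(\<lambda>n. min (q n) b) \<longlonglongrightarrow> u" using u by simp
    qed
    have "q n \<in> \<rat> \<inter> {0..}" for n
      using u 1[of n] by (auto simp: q_def simp del: of_nat_Suc intro: order_trans)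
    then have "x (min (q n) b) \<le> (SUP q\<in>\<rat> \<inter> {0..}. x (min q b))" for n
      by (intro cSUP_upper bdd)
    then show "x u \<le> (SUP q\<in>\<rat> \<inter> {0..}. x (min q b))"
      by (intro LIMSEQ_le_const2[OF lim]) auto
  qed (use assms in auto)
qed

section \<open>Moments and the characteristic function\<close>

text \<open>The deviation \<open>d\<close> from linearity is additive and vanishes at integers,
  hence has period 1 and is bounded on the half-line. But \<open>d\<close> at n u is n times
  \<open>d u\<close>, which is unbounded in n unless \<open>d u\<close> = 0.\<close>

lemma additive_bounded_linear:
  fixes f :: "real \<Rightarrow> real"
  assumes add: "\<And>u h. 0 \<le> u \<Longrightarrow> 0 \<le> h \<Longrightarrow> f (u + h) = f u + f h"
    and bound: "\<And>u. 0 \<le> u \<Longrightarrow> u \<le> 1 \<Longrightarrow> \<bar>f u\<bar> \<le> K" and "0 \<le> u"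
  shows "f u = f 1 * u"
proof -
  define d where "d u = f u - f 1 * u" for u
  have d_add: "d (u + h) = d u + d h" if "0 \<le> u" "0 \<le> h" for u h
    using add[OF that] by (simp add: d_def algebra_simps)
  have d_mult: "d (real n * u) = real n * d u" if "0 \<le> u" for n u
  proof (induction n)
    case 0
    show ?case using d_add[of 0 0] by simp
  next
    case (Suc n)
    then show ?case using d_add[of u "real n * u"] that by (simp add: algebra_simps)
  qed
  have d_nat: "d (real n) = 0" for n
    using d_mult[of 1 n] by (simp add: d_def)
  have d_bound: "\<bar>d v\<bar> \<le> K + \<bar>f 1\<bar>" if "0 \<le> v" for v
  proof -
    have fr: "0 \<le> frac v" "frac v \<le> 1" by (simp_all add: frac_lt_1 less_imp_le)
    have "v = real (nat \<lfloor>v\<rfloor>) + frac v" using that by (simp add: frac_def)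
    then have "d v = d (real (nat \<lfloor>v\<rfloor>) + frac v)" by (rule arg_cong)
    then have "d v = d (frac v)"
      using d_add[of "real (nat \<lfloor>v\<rfloor>)" "frac v"] d_nat[of "nat \<lfloor>v\<rfloor>"] fr by linarith
    also have "\<bar>\<dots>\<bar> \<le> \<bar>f (frac v)\<bar> + \<bar>f 1 * frac v\<bar>" by (simp add: d_def abs_triangle_ineq4)
    also have "\<dots> \<le> K + \<bar>f 1\<bar>"
      using bound[OF fr] fr by (intro add_mono) (auto simp: abs_mult mult_left_le)
    finally show ?thesis .
  qed
  have "d u = 0"
  proof (rule ccontr)
    assume "d u \<noteq> 0"
    then obtain n where "(K + \<bar>f 1\<bar>) < real n * \<bar>d u\<bar>"
      using ex_less_of_nat_mult[of "\<bar>d u\<bar>" "K + \<bar>f 1\<bar>"] by auto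
    with d_bound[of "real n * u"] d_mult[OF assms(3)] assms(3) show False
      by (simp add: abs_mult)
  qed
  then show ?thesis by (simp add: d_def)
qed

section \<open>From the Levy-Khintchine exponent to second moments\<close>

lemma one_minus_cos_le: "1 - cos y \<le> (y::real)\<^sup>2 / 2"
proof -
  have "1 - cos y = 2 * (sin (y / 2))\<^sup>2"
    using cos_double_sin[of "y / 2"] by simp
  also have "\<dots> \<le> 2 * (y / 2)\<^sup>2"
    using iffD1[OF abs_le_square_iff abs_sin_x_le_abs_x[of "y / 2"]] by (rule mult_left_mono) simp
  finally show ?thesis by (simp add: power_divide)
qed

lemma (in prob_space) char_distr_Re:
  assumes [measurable]: "Y \<in> borel_measurable M"
  shows "Re (char (distr M borel Y) \<theta>) = expectation (\<lambda>\<omega>. cos (\<theta> * Y \<omega>))"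
proof -
  have i: "integrable M (\<lambda>\<omega>. iexp (\<theta> * Y \<omega>))"
    by (intro integrable_const_bound[of _ 1]) (auto simp: norm_exp_i_times)
  have "char (distr M borel Y) \<theta> = (CLINT \<omega>|M. iexp (\<theta> * Y \<omega>))"
    unfolding char_def by (subst integral_distr) auto
  then have "Re (char (distr M borel Y) \<theta>) = expectation (\<lambda>\<omega>. Re (iexp (\<theta> * Y \<omega>)))"
    using integral_Re[OF i] by simp
  then show ?thesis by (simp add: Re_exp)
qed

text \<open>Fatou's lemma for \<open>2 n\<^sup>2 (1 - cos (Y / n)) \<longlonglongrightarrow> Y\<^sup>2\<close>.\<close>

lemma (in prob_space) second_moment_le_char:
  assumes [measurable]: "Y \<in> borel_measurable M"
    and char: "\<And>\<theta>. \<bar>\<theta>\<bar> \<le> 1 \<Longrightarrow> 2 * (1 - Re (char (distr M borel Y) \<theta>)) \<le> K * \<theta>\<^sup>2"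
  shows "integrable M (\<lambda>\<omega>. (Y \<omega>)\<^sup>2)" "expectation (\<lambda>\<omega>. (Y \<omega>)\<^sup>2) \<le> K"
proof -
  define f where "f n y = 2 * (real (Suc n))\<^sup>2 * (1 - cos (1 / real (Suc n) * y))" for n and y :: real
  have f_nonneg: "0 \<le> f n y" for n y by (simp add: f_def)
  \<comment> \<open>By the half-angle formula the limit becomes continuity of \<open>sinc\<close> at
    0.\<close>
  have f_eq: "f n y = y\<^sup>2 * (sinc (y / 2 * (1 / real (Suc n))))\<^sup>2" for n y
  proof (cases "y = 0")
    case False
    define N where "N = real (Suc n)"
    have N: "0 < N" by (simp add: N_def)
    define s where "s = sin (y / 2 * (1 / N))"
    have "cos (1 / N * y) = 1 - 2 * s\<^sup>2"
      using cos_double_sin[of "y / 2 * (1 / N)"] by (simp add: s_def)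
    then have "f n y = (2 * N * s)\<^sup>2"
      by (simp add: f_def N_def[symmetric] power_mult_distrib del: of_nat_Suc)
    also have "2 * N * s = y * sinc (y / 2 * (1 / N))"
    proof -
      have nz: "y / 2 * (1 / N) \<noteq> 0" using False N by simp
      show ?thesis unfolding if_not_P[OF nz] s_def using False N by simp
    qed
    finally show ?thesis by (simp only: N_def power_mult_distrib)
  qed (simp add: f_def)
  have lim: "(\<lambda>n. f n y) \<longlonglongrightarrow> y\<^sup>2" for y
  proof -
    have "(\<lambda>n. y / 2 * (1 / real (Suc n))) \<longlonglongrightarrow> y / 2 * 0"
      by (intro tendsto_mult tendsto_const LIMSEQ_Suc lim_const_over_n)
    then have "(\<lambda>n. y / 2 * (1 / real (Suc n))) \<longlonglongrightarrow> 0" by simp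
    then have "(\<lambda>n. sinc (y / 2 * (1 / real (Suc n)))) \<longlonglongrightarrow> sinc 0"
      by (rule isCont_tendsto_compose[OF isCont_sinc])
    then have "(\<lambda>n. y\<^sup>2 * (sinc (y / 2 * (1 / real (Suc n))))\<^sup>2) \<longlonglongrightarrow> y\<^sup>2 * 1\<^sup>2"
      by (intro tendsto_mult tendsto_const tendsto_power) simp
    then show ?thesis unfolding f_eq by simp
  qed
  have [measurable]: "f n \<in> borel_measurable borel" for n unfolding f_def by measurable
  have "(\<integral>\<^sup>+\<omega>. ennreal ((Y \<omega>)\<^sup>2) \<partial>M) = (\<integral>\<^sup>+\<omega>. liminf (\<lambda>n. ennreal (f n (Y \<omega>))) \<partial>M)"
    by (intro nn_integral_cong lim_imp_Liminf[symmetric] tendsto_ennrealI lim) simp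
  also have "\<dots> \<le> liminf (\<lambda>n. \<integral>\<^sup>+\<omega>. ennreal (f n (Y \<omega>)) \<partial>M)"
    by (intro nn_integral_liminf) simp
  also have "\<dots> \<le> liminf (\<lambda>n. ennreal K)"
  proof (intro Liminf_mono always_eventually allI)
    fix n
    have i: "integrable M (\<lambda>\<omega>. cos (1 / real (Suc n) * Y \<omega>))"
      by (intro integrable_const_bound[of _ 1]) auto
    have "(\<integral>\<^sup>+\<omega>. ennreal (f n (Y \<omega>)) \<partial>M) = ennreal (expectation (\<lambda>\<omega>. f n (Y \<omega>)))"
      using i f_nonneg by (intro nn_integral_eq_integral) (auto simp: f_def simp del: of_nat_Suc)
    also have "expectation (\<lambda>\<omega>. f n (Y \<omega>)) =
        2 * (real (Suc n))\<^sup>2 * (1 - Re (char (distr M borel Y) (1 / real (Suc n))))"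
      unfolding f_def char_distr_Re[OF assms(1)] using i by (simp add: prob_space del: of_nat_Suc)
    also have "\<dots> \<le> K"
      using char[of "1 / real (Suc n)"] by (simp add: field_simps power2_eq_square del: of_nat_Suc)
    finally show "(\<integral>\<^sup>+\<omega>. ennreal (f n (Y \<omega>)) \<partial>M) \<le> ennreal K"
      by (simp add: ennreal_leI)
  qed
  also have "\<dots> = ennreal K" by (simp add: Liminf_const)
  finally have le: "(\<integral>\<^sup>+\<omega>. ennreal ((Y \<omega>)\<^sup>2) \<partial>M) \<le> ennreal K" .
  then show int: "integrable M (\<lambda>\<omega>. (Y \<omega>)\<^sup>2)"
    by (intro integrableI_bounded) (auto simp: le_less_trans)
  \<comment> \<open>The inequality in \<open>ennreal\<close> says nothing about a negative bound,
    which would be truncated to 0. The hypothesis at \<theta> = 1 excludes it, since cosines are at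
    most 1.\<close>
  have "0 \<le> K"
  proof -
    have "expectation (\<lambda>\<omega>. cos (1 * Y \<omega>)) \<le> expectation (\<lambda>\<omega>. 1)"
      by (intro integral_mono integrable_const_bound[of _ 1]) auto
    then show ?thesis using char[of 1] char_distr_Re[OF assms(1), of 1] by (simp add: prob_space)
  qed
  with le show "expectation (\<lambda>\<omega>. (Y \<omega>)\<^sup>2) \<le> K"
    using nn_integral_eq_integral[OF int] by (simp add: ennreal_le_iff)
qed

text \<open>The real part comes from 1 - cos and is of second order in \<theta>, whereas the
  imaginary part is only of first order; it enters the characteristic function squared, so both
  orders suffice for a bound by \<open>\<theta>\<^sup>2\<close>.\<close>

lemma levy_khintchine_exponent_bounds:
  assumes [simp, measurable_cong]: "sets \<Lambda> = sets borel" and int: "integrable \<Lambda> (\<lambda>x. x\<^sup>2)"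
    and \<theta>: "\<bar>\<theta>\<bar> \<le> 1"
  defines "\<kappa> \<equiv> (LINT x|\<Lambda>. x\<^sup>2)"
  shows "0 \<le> - Re (levy_khintchine_exponent a \<sigma> \<Lambda> \<theta>)"
    and "- Re (levy_khintchine_exponent a \<sigma> \<Lambda> \<theta>) \<le> (\<sigma>\<^sup>2 + \<kappa>) / 2 * \<theta>\<^sup>2"
    and "\<bar>Im (levy_khintchine_exponent a \<sigma> \<Lambda> \<theta>)\<bar> \<le> (\<bar>a\<bar> + \<kappa>) * \<bar>\<theta>\<bar>"
proof -
  define f where "f x = iexp (\<theta> * x) - 1 - \<i> * of_real (\<theta> * x * indicator {-1<..<1} x)" for x :: real
  have \<psi>: "levy_khintchine_exponent a \<sigma> \<Lambda> \<theta> =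
      \<i> * of_real (a * \<theta>) - of_real (\<sigma>\<^sup>2 * \<theta>\<^sup>2 / 2) + (\<integral>x. f x \<partial>\<Lambda>)"
    by (simp only: levy_khintchine_exponent_def f_def)
  have [measurable]: "f \<in> borel_measurable borel" unfolding f_def by measurable
  \<comment> \<open>Small jumps are compensated, so the second-order Taylor bound applies, and one
    factor \<bar>\<theta>\<bar> \<le> 1 is given away. Large jumps are not, and there the
    first-order bound suffices because \<bar>x\<bar> is at most its square.\<close>
  have f_bound: "norm (f x) \<le> \<bar>\<theta>\<bar> * x\<^sup>2" for x
  proof (cases "\<bar>x\<bar> < 1")
    case True
    then have "f x = iexp (\<theta> * x) - (\<Sum>k\<le>1. (\<i> * of_real (\<theta> * x))^k / fact k)"
      by (auto simp: f_def indicator_def)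
    also have "norm \<dots> \<le> \<bar>\<theta> * x\<bar>^(Suc 1) / fact (Suc 1)" by (rule iexp_approx1)
    also have "\<dots> = (\<theta> * x)\<^sup>2 / 2" by (simp add: power2_eq_square)
    also have "\<dots> = \<bar>\<theta>\<bar> * (\<bar>\<theta>\<bar> / 2) * x\<^sup>2" by (simp add: power2_eq_square)
    also have "\<dots> \<le> \<bar>\<theta>\<bar> * 1 * x\<^sup>2"
      using \<theta> by (intro mult_right_mono mult_left_mono) auto
    finally show ?thesis by simp
  next
    case False
    then have "f x = iexp (\<theta> * x) - (\<Sum>k\<le>0. (\<i> * of_real (\<theta> * x))^k / fact k)"
      by (auto simp: f_def indicator_def)
    also have "norm \<dots> \<le> \<bar>\<theta> * x\<bar>^(Suc 0) / fact (Suc 0)" by (rule iexp_approx1)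
    also have "\<dots> = \<bar>\<theta>\<bar> * \<bar>x\<bar>" by (simp add: abs_mult)
    also have "\<dots> \<le> \<bar>\<theta>\<bar> * x\<^sup>2"
      using False self_le_power[of "\<bar>x\<bar>" 2] by (intro mult_left_mono) auto
    finally show ?thesis .
  qed
  have int': "integrable \<Lambda> (\<lambda>x. c * x\<^sup>2)" for c using int by simp
  have f_int: "integrable \<Lambda> f"
    by (rule Bochner_Integration.integrable_bound[OF int'[of "\<bar>\<theta>\<bar>"]]) (use f_bound in \<open>auto simp: abs_mult\<close>)
  have Re_f: "- Re (f x) \<le> \<theta>\<^sup>2 / 2 * x\<^sup>2" for x
    using one_minus_cos_le[of "\<theta> * x"] by (simp add: f_def Re_exp power_mult_distrib)
  have Re_int: "- Re (\<integral>x. f x \<partial>\<Lambda>) = (\<integral>x. - Re (f x) \<partial>\<Lambda>)"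
    using f_int by simp
  have "0 \<le> (\<integral>x. - Re (f x) \<partial>\<Lambda>)"
    by (rule integral_nonneg_AE) (simp add: f_def Re_exp)
  moreover have "0 \<le> \<sigma>\<^sup>2 * \<theta>\<^sup>2 / 2" by simp
  moreover have "- Re (\<i> * of_real b - of_real c + z) = c - Re z" for b c z by simp
  ultimately show "0 \<le> - Re (levy_khintchine_exponent a \<sigma> \<Lambda> \<theta>)"
    using Re_int unfolding \<psi> by (simp only:)
  have "- Re (\<integral>x. f x \<partial>\<Lambda>) \<le> (\<integral>x. \<theta>\<^sup>2 / 2 * x\<^sup>2 \<partial>\<Lambda>)"
    unfolding Re_int using f_int int Re_f by (intro integral_mono) auto
  also have "\<dots> = \<theta>\<^sup>2 / 2 * \<kappa>" by (simp add: \<kappa>_def)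
  finally show "- Re (levy_khintchine_exponent a \<sigma> \<Lambda> \<theta>) \<le> (\<sigma>\<^sup>2 + \<kappa>) / 2 * \<theta>\<^sup>2"
    by (simp add: \<psi> algebra_simps)
  have "\<bar>Im (\<integral>x. f x \<partial>\<Lambda>)\<bar> \<le> (\<integral>x. norm (f x) \<partial>\<Lambda>)"
    by (rule order_trans[OF abs_Im_le_cmod integral_norm_bound])
  also have "\<dots> \<le> (\<integral>x. \<bar>\<theta>\<bar> * x\<^sup>2 \<partial>\<Lambda>)"
    using f_int int f_bound by (intro integral_mono) auto
  also have "\<dots> = \<bar>\<theta>\<bar> * \<kappa>" by (simp add: \<kappa>_def)
  finally have "\<bar>Im (\<integral>x. f x \<partial>\<Lambda>)\<bar> \<le> \<bar>\<theta>\<bar> * \<kappa>" .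
  moreover have "\<bar>a * \<theta> + Im (\<integral>x. f x \<partial>\<Lambda>)\<bar> \<le> \<bar>a\<bar> * \<bar>\<theta>\<bar> + \<bar>Im (\<integral>x. f x \<partial>\<Lambda>)\<bar>"
    by (metis abs_mult abs_triangle_ineq)
  ultimately show "\<bar>Im (levy_khintchine_exponent a \<sigma> \<Lambda> \<theta>)\<bar> \<le> (\<bar>a\<bar> + \<kappa>) * \<bar>\<theta>\<bar>"
    by (simp add: \<psi> algebra_simps)
qed

text \<open>Damping and rotation are separated: 1 - r cos b = (1 - r) + r (1 - cos b) with r = exp
  (Re z) \<le> 1.\<close>

lemma one_minus_Re_exp_le:
  "Re z \<le> 0 \<Longrightarrow> 1 - Re (exp z) \<le> - Re z + (Im z)\<^sup>2 / 2"
proof -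
  assume "Re z \<le> 0"
  note c = one_minus_cos_le[of "Im z"]
  have "1 - exp (Re z) * cos (Im z) = (1 - exp (Re z)) + exp (Re z) * (1 - cos (Im z))"
    by (simp add: algebra_simps)
  also have "\<dots> \<le> - Re z + 1 * (1 - cos (Im z))"
    using \<open>Re z \<le> 0\<close> exp_ge_add_one_self[of "Re z"]
    by (intro add_mono mult_right_mono) (linarith, auto)
  finally show ?thesis using c by (simp add: Re_exp)
qed

text \<open>The tail condition and the integrability of \<open>min 1 (x\<^sup>2)\<close> combine to
  a full second moment of \<open>\<Lambda>\<close>. The part linear in u stems from the real part of
  the exponent, the quadratic one from the squared imaginary part.\<close>

lemma has_levy_measure_char_bound:
  assumes levy: "has_levy_measure M X \<Lambda>"
    and tail: "(\<integral>\<^sup>+x. ennreal (x\<^sup>2) * indicator {x. 1 \<le> \<bar>x\<bar>} x \<partial>\<Lambda>) < \<infinity>"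
  obtains A B where "0 \<le> A" "0 \<le> B"
    "\<And>u \<theta>. 0 \<le> u \<Longrightarrow> \<bar>\<theta>\<bar> \<le> 1 \<Longrightarrow>
      2 * (1 - Re (char (distr M borel (X u)) \<theta>)) \<le> (A * u + B * u\<^sup>2) * \<theta>\<^sup>2"
proof -
  from levy have [simp, measurable_cong]: "sets \<Lambda> = sets borel"
    and small: "(\<integral>\<^sup>+x. ennreal (min 1 (x\<^sup>2)) \<partial>\<Lambda>) < \<infinity>"
    by (auto simp: has_levy_measure_def)
  from levy obtain a \<sigma> where char: "\<And>u \<theta>. 0 \<le> u \<Longrightarrow>
        char (distr M borel (X u)) \<theta> = exp (of_real u * levy_khintchine_exponent a \<sigma> \<Lambda> \<theta>)"
    unfolding has_levy_measure_def by blast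
  have "(\<integral>\<^sup>+x. ennreal (x\<^sup>2) \<partial>\<Lambda>) \<le>
      (\<integral>\<^sup>+x. ennreal (min 1 (x\<^sup>2)) + ennreal (x\<^sup>2) * indicator {x. 1 \<le> \<bar>x\<bar>} x \<partial>\<Lambda>)"
  proof (intro nn_integral_mono)
    fix x :: real
    show "ennreal (x\<^sup>2) \<le> ennreal (min 1 (x\<^sup>2)) + ennreal (x\<^sup>2) * indicator {x. 1 \<le> \<bar>x\<bar>} x"
      by (cases "1 \<le> \<bar>x\<bar>") (auto simp: min_absorb2 abs_square_le_1)
  qed
  also have "\<dots> < \<infinity>"
    using small tail by (subst nn_integral_add) auto
  finally have int: "integrable \<Lambda> (\<lambda>x. x\<^sup>2)"
    by (intro integrableI_bounded) auto
  define \<kappa> where "\<kappa> = (LINT x|\<Lambda>. x\<^sup>2)"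
  have "0 \<le> \<kappa>" unfolding \<kappa>_def by simp
  show ?thesis
  \<comment> \<open>The first constant is the variance rate. In the second, jumps of size at least 1
    shift the mean rate away from \<open>a\<close> by at most \<kappa>.\<close>
  proof (rule that[of "\<sigma>\<^sup>2 + \<kappa>" "(\<bar>a\<bar> + \<kappa>)\<^sup>2"])
    fix u \<theta> :: real assume u: "0 \<le> u" and \<theta>: "\<bar>\<theta>\<bar> \<le> 1"
    let ?z = "levy_khintchine_exponent a \<sigma> \<Lambda> \<theta>"
    note b = levy_khintchine_exponent_bounds[OF \<open>sets \<Lambda> = sets borel\<close> int \<theta>, of a \<sigma>, folded \<kappa>_def]
    have "2 * (1 - Re (char (distr M borel (X u)) \<theta>)) \<le> 2 * (u * (- Re ?z) + (u * Im ?z)\<^sup>2 / 2)"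
      using one_minus_Re_exp_le[of "of_real u * ?z"] u b(1)
      by (simp add: char mult_nonneg_nonpos)
    also have "(u * Im ?z)\<^sup>2 = u\<^sup>2 * \<bar>Im ?z\<bar>\<^sup>2" by (simp add: power_mult_distrib)
    also have "2 * (u * (- Re ?z) + (u\<^sup>2 * \<bar>Im ?z\<bar>\<^sup>2) / 2) \<le>
        2 * (u * ((\<sigma>\<^sup>2 + \<kappa>) / 2 * \<theta>\<^sup>2) + (u\<^sup>2 * ((\<bar>a\<bar> + \<kappa>) * \<bar>\<theta>\<bar>)\<^sup>2) / 2)"
      using b u by (intro mult_left_mono add_mono divide_right_mono power_mono) auto
    also have "\<dots> = ((\<sigma>\<^sup>2 + \<kappa>) * u + (\<bar>a\<bar> + \<kappa>)\<^sup>2 * u\<^sup>2) * \<theta>\<^sup>2"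
      unfolding power_mult_distrib[of "\<bar>a\<bar> + \<kappa>"] power2_abs by (simp only: add_divide_distrib) (simp add: algebra_simps)
    finally show "2 * (1 - Re (char (distr M borel (X u)) \<theta>)) \<le>
        ((\<sigma>\<^sup>2 + \<kappa>) * u + (\<bar>a\<bar> + \<kappa>)\<^sup>2 * u\<^sup>2) * \<theta>\<^sup>2" .
  qed (use \<open>0 \<le> \<kappa>\<close> in auto)
qed

section \<open>Maximal inequality and second moments of the process\<close>

primrec running_max :: "(nat \<Rightarrow> real) \<Rightarrow> nat \<Rightarrow> real" where
  "running_max d 0 = 0"
| "running_max d (Suc n) = max (running_max d n) (\<Sum>j<Suc n. d j)"

lemma sum_le_running_max: "k \<le> n \<Longrightarrow> (\<Sum>j<k. d j) \<le> running_max d n"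
proof (induction n)
  case (Suc n)
  then show ?case by (cases "k = Suc n") auto
qed simp

lemma running_max_nonneg: "0 \<le> running_max d n"
  using sum_le_running_max[of 0 n d] by simp

lemma running_max_cong: "(\<And>j. j < n \<Longrightarrow> d j = e j) \<Longrightarrow> running_max d n = running_max e n"
proof (induction n)
  case (Suc n)
  then have "running_max d n = running_max e n" "(\<Sum>j<Suc n. d j) = (\<Sum>j<Suc n. e j)"
    by (auto intro!: sum.cong)
  then show ?case by simp
qed simp

lemma measurable_running_max:
  "i \<le> n \<Longrightarrow> (\<lambda>f. running_max f i) \<in> borel_measurable (PiM {..<n} (\<lambda>_. borel))"
proof (induction i)
  case (Suc i)
  then have "(\<lambda>f. \<Sum>j<Suc i. f j) \<in> borel_measurable (PiM {..<n} (\<lambda>_. borel :: real measure))"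
    by (intro borel_measurable_sum measurable_component_singleton) auto
  with Suc show ?case by simp
qed simp

text \<open>The pathwise form of Doob's \<open>L\<^sup>2\<close> maximal inequality: the subtracted sum is a martingale
  transform.\<close>

lemma running_max_pathwise:
  "(running_max d n)\<^sup>2 \<le> 4 * (\<Sum>j<n. d j)\<^sup>2 - 4 * (\<Sum>i<n. running_max d i * d i)"
proof -
  have *: "(running_max d n)\<^sup>2 \<le> 2 * running_max d n * (\<Sum>j<n. d j) - 2 * (\<Sum>i<n. running_max d i * d i)"
  proof (induction n)
    case (Suc n)
    define R where "R = running_max d n"
    define R' where "R' = running_max d (Suc n)"
    define S where "S = (\<Sum>j<n. d j)"
    define D where "D = (\<Sum>i<n. running_max d i * d i)"
    have IH: "R\<^sup>2 \<le> 2 * R * S - 2 * D" using Suc by (simp add: R_def S_def D_def)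
    have "R'\<^sup>2 \<le> R\<^sup>2 + 2 * (R' - R) * (S + d n)"
    \<comment> \<open>When the maximum moves, it moves to the current sum, and the claim becomes
      nonnegativity of the square of R' - R.\<close>
    proof (cases "R' = R")
      case False
      then have "R' = S + d n" by (auto simp: R'_def R_def S_def max_def split: if_splits)
      moreover have "0 \<le> (R' - R)\<^sup>2" by simp
      ultimately show ?thesis by (simp add: power2_eq_square algebra_simps)
    qed simp
    with IH have "R'\<^sup>2 \<le> 2 * R' * (S + d n) - 2 * (D + R * d n)"
      by (simp add: algebra_simps)
    then show ?case by (simp add: R_def R'_def S_def D_def)
  qed simp
  define R where "R = running_max d n"
  define S where "S = (\<Sum>j<n. d j)"
  \<comment> \<open>Half of the squared maximum is absorbed on the left-hand side, which produces
    Doob's constant 4.\<close>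
  have "0 \<le> (R - 2 * S)\<^sup>2" by simp
  then have "2 * R * S \<le> R\<^sup>2 / 2 + 2 * S\<^sup>2" by (simp add: power2_eq_square algebra_simps)
  with * show ?thesis by (simp add: R_def S_def)
qed

text \<open>The hypothesis \<open>cong\<close> says that G looks only at coordinates below i, so G
  and \<open>d i\<close> are functions of disjoint blocks of an independent family. Serves both the
  martingale transform and the mixed moment of two successive increments.\<close>

lemma (in prob_space) indep_prefix_expectation:
  fixes d :: "nat \<Rightarrow> 'a \<Rightarrow> real"
  assumes ind: "indep_vars (\<lambda>_. borel) d {..<n}" and "i < n"
    and G[measurable]: "G \<in> borel_measurable (PiM {..<i} (\<lambda>_. borel))"
    and cong: "\<And>f. G (restrict f {..<i}) = G f"
    and int: "integrable M (\<lambda>\<omega>. G (\<lambda>j. d j \<omega>))" "integrable M (d i)"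
  shows "integrable M (\<lambda>\<omega>. G (\<lambda>j. d j \<omega>) * d i \<omega>)"
    and "expectation (\<lambda>\<omega>. G (\<lambda>j. d j \<omega>) * d i \<omega>) = expectation (\<lambda>\<omega>. G (\<lambda>j. d j \<omega>)) * expectation (d i)"
proof -
  have "indep_var borel (G \<circ> (\<lambda>\<omega>. restrict (\<lambda>j. d j \<omega>) {..<i}))
      borel ((\<lambda>f. f i) \<circ> (\<lambda>\<omega>. restrict (\<lambda>j. d j \<omega>) {i}))"
    using assms(2) by (intro indep_var_compose[OF indep_var_restrict[OF ind]]) auto
  also have "G \<circ> (\<lambda>\<omega>. restrict (\<lambda>j. d j \<omega>) {..<i}) = (\<lambda>\<omega>. G (\<lambda>j. d j \<omega>))"
    by (auto simp: cong)
  also have "(\<lambda>f. f i) \<circ> (\<lambda>\<omega>. restrict (\<lambda>j. d j \<omega>) {i}) = d i" by auto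
  finally have iv: "indep_var borel (\<lambda>\<omega>. G (\<lambda>j. d j \<omega>)) borel (d i)" .
  show "integrable M (\<lambda>\<omega>. G (\<lambda>j. d j \<omega>) * d i \<omega>)"
    by (rule indep_var_integrable[OF iv int])
  show "expectation (\<lambda>\<omega>. G (\<lambda>j. d j \<omega>) * d i \<omega>) = expectation (\<lambda>\<omega>. G (\<lambda>j. d j \<omega>)) * expectation (d i)"
    by (rule indep_var_lebesgue_integral[OF iv int])
qed

text \<open>In the pathwise inequality each increment is multiplied by a maximum of earlier sums, so
  independence and centering annihilate the transform in expectation.\<close>

lemma (in prob_space) doob_L2:
  assumes ind: "indep_vars (\<lambda>_. borel) d {..<n}"
    and int: "\<And>i. i < n \<Longrightarrow> integrable M (d i)" and mean: "\<And>i. i < n \<Longrightarrow> expectation (d i) = 0"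
    and sq: "integrable M (\<lambda>\<omega>. (\<Sum>j<n. d j \<omega>)\<^sup>2)"
  shows "(\<integral>\<^sup>+\<omega>. ennreal ((running_max (\<lambda>j. d j \<omega>) n)\<^sup>2) \<partial>M)
    \<le> ennreal (4 * expectation (\<lambda>\<omega>. (\<Sum>j<n. d j \<omega>)\<^sup>2))"
proof -
  have R: "integrable M (\<lambda>\<omega>. running_max (\<lambda>j. d j \<omega>) i)" if "i \<le> n" for i
    using that
  proof (induction i)
    case (Suc i)
    then have "integrable M (\<lambda>\<omega>. \<Sum>j<Suc i. d j \<omega>)"
      by (intro Bochner_Integration.integrable_sum int) auto
    with Suc show ?case by simp
  qed simp
  have cong: "running_max (restrict f {..<i}) i = running_max f i" for f i
    by (rule running_max_cong) simp
  note prefix = indep_prefix_expectation[OF ind _ measurable_running_max cong R int]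
  have i: "integrable M (\<lambda>\<omega>. running_max (\<lambda>j. d j \<omega>) i * d i \<omega>)" if "i < n" for i
    using that by (intro prefix) auto
  have e: "expectation (\<lambda>\<omega>. running_max (\<lambda>j. d j \<omega>) i * d i \<omega>) = 0" if "i < n" for i
    using that by (subst prefix) (auto simp: mean)
  let ?Y = "\<lambda>\<omega>. 4 * (\<Sum>j<n. d j \<omega>)\<^sup>2 - 4 * (\<Sum>i<n. running_max (\<lambda>j. d j \<omega>) i * d i \<omega>)"
  have "(\<integral>\<^sup>+\<omega>. ennreal ((running_max (\<lambda>j. d j \<omega>) n)\<^sup>2) \<partial>M) \<le> (\<integral>\<^sup>+\<omega>. ennreal (?Y \<omega>) \<partial>M)"
    by (intro nn_integral_mono ennreal_leI running_max_pathwise)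
  also have "\<dots> = ennreal (expectation ?Y)"
  proof (intro nn_integral_eq_integral AE_I2)
    show "integrable M ?Y"
      using i sq by (intro Bochner_Integration.integrable_diff integrable_mult_right
          Bochner_Integration.integrable_sum) auto
    show "0 \<le> ?Y \<omega>" for \<omega>
      by (rule order_trans[OF zero_le_power2 running_max_pathwise])
  qed
  also have "expectation ?Y = 4 * expectation (\<lambda>\<omega>. (\<Sum>j<n. d j \<omega>)\<^sup>2)"
  proof -
    have "expectation ?Y = expectation (\<lambda>\<omega>. 4 * (\<Sum>j<n. d j \<omega>)\<^sup>2) -
        expectation (\<lambda>\<omega>. 4 * (\<Sum>i<n. running_max (\<lambda>j. d j \<omega>) i * d i \<omega>))"
      using i sq by (intro Bochner_Integration.integral_diff integrable_mult_right
          Bochner_Integration.integrable_sum) auto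
    also have "expectation (\<lambda>\<omega>. 4 * (\<Sum>i<n. running_max (\<lambda>j. d j \<omega>) i * d i \<omega>)) =
        4 * (\<Sum>i<n. expectation (\<lambda>\<omega>. running_max (\<lambda>j. d j \<omega>) i * d i \<omega>))"
      unfolding integral_mult_right_zero using i by (subst Bochner_Integration.integral_sum) auto
    finally show ?thesis by (simp add: e)
  qed
  finally show ?thesis .
qed

text \<open>The bound on the second moment only serves to exclude nonlinear solutions of Cauchy's
  functional equation for mean and variance.\<close>

locale l2_levy_process = levy_process +
  fixes A B :: real
  assumes A_nonneg: "0 \<le> A" and B_nonneg: "0 \<le> B"
    and X_square_integrable: "\<And>u. 0 \<le> u \<Longrightarrow> integrable M (\<lambda>\<omega>. (X u \<omega>)\<^sup>2)"
    and X_square_le: "\<And>u. 0 \<le> u \<Longrightarrow> expectation (\<lambda>\<omega>. (X u \<omega>)\<^sup>2) \<le> A * u + B * u\<^sup>2"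
begin

definition \<mu> :: real where "\<mu> = expectation (X 1)"

definition \<rho> :: real where "\<rho> = expectation (\<lambda>\<omega>. (X 1 \<omega>)\<^sup>2) - \<mu>\<^sup>2"

definition V :: "real \<Rightarrow> real" where "V h = \<rho> * h + \<mu>\<^sup>2 * h\<^sup>2"

lemma X_integrable: "0 \<le> u \<Longrightarrow> integrable M (X u)"
  by (rule square_integrable_imp_integrable[OF measurable_X X_square_integrable])

lemma X_mean_square_le: "0 \<le> u \<Longrightarrow> (expectation (X u))\<^sup>2 \<le> expectation (\<lambda>\<omega>. (X u \<omega>)\<^sup>2)"
  using variance_eq[OF X_integrable X_square_integrable, of u] variance_positive[of "X u"] by simp

lemma increment_integrable:
  assumes "0 \<le> u" "0 \<le> h"
  shows "integrable M (\<lambda>\<omega>. X (u + h) \<omega> - X u \<omega>)"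
    and "integrable M (\<lambda>\<omega>. (X (u + h) \<omega> - X u \<omega>)\<^sup>2)"
    and "expectation (\<lambda>\<omega>. X (u + h) \<omega> - X u \<omega>) = expectation (X h)"
    and "expectation (\<lambda>\<omega>. (X (u + h) \<omega> - X u \<omega>)\<^sup>2) = expectation (\<lambda>\<omega>. (X h \<omega>)\<^sup>2)"
proof -
  have m[measurable]: "X (u + h) \<in> borel_measurable M" "X u \<in> borel_measurable M" "X h \<in> borel_measurable M"
    using assms by (auto intro: measurable_X)
  note d = stationary_increments[OF assms]
  show 1: "integrable M (\<lambda>\<omega>. X (u + h) \<omega> - X u \<omega>)"
    using X_integrable[of "u + h"] X_integrable[of u] assms by auto
  have i: "integrable (distr M borel (X h)) (\<lambda>x. x\<^sup>2)"
    using X_square_integrable[OF assms(2)] by (subst integrable_distr_eq) auto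
  then show 2: "integrable M (\<lambda>\<omega>. (X (u + h) \<omega> - X u \<omega>)\<^sup>2)"
    unfolding d[symmetric] by (subst (asm) integrable_distr_eq) auto
  have "(\<integral>x. x \<partial>distr M borel (\<lambda>\<omega>. X (u + h) \<omega> - X u \<omega>)) = (\<integral>x. x \<partial>distr M borel (X h))"
    by (simp only: d)
  then show "expectation (\<lambda>\<omega>. X (u + h) \<omega> - X u \<omega>) = expectation (X h)"
    by (subst (asm) (1 2) integral_distr) auto
  have "(\<integral>x. x\<^sup>2 \<partial>distr M borel (\<lambda>\<omega>. X (u + h) \<omega> - X u \<omega>)) = (\<integral>x. x\<^sup>2 \<partial>distr M borel (X h))"
    by (simp only: d)
  then show "expectation (\<lambda>\<omega>. (X (u + h) \<omega> - X u \<omega>)\<^sup>2) = expectation (\<lambda>\<omega>. (X h \<omega>)\<^sup>2)"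
    by (subst (asm) (1 2) integral_distr) auto
qed

lemma X_mean: "0 \<le> u \<Longrightarrow> expectation (X u) = \<mu> * u"
  unfolding \<mu>_def
proof (rule additive_bounded_linear[where K = "1 + A + B"])
  fix u h :: real assume "0 \<le> u" "0 \<le> h"
  then show "expectation (X (u + h)) = expectation (X u) + expectation (X h)"
    using increment_integrable(3)[of u h] X_integrable[of u] X_integrable[of "u + h"] by simp
next
  fix u :: real assume u: "0 \<le> u" "u \<le> 1"
  then have "\<bar>expectation (X u)\<bar> \<le> 1 + (expectation (X u))\<^sup>2"
  proof -
    have "0 \<le> (\<bar>expectation (X u)\<bar> - 1)\<^sup>2" by simp
    then show ?thesis unfolding power2_diff power2_abs by simp
  qed
  also have "\<dots> \<le> 1 + (A * u + B * u\<^sup>2)"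
    using X_mean_square_le[of u] X_square_le[of u] u by simp
  also have "\<dots> \<le> 1 + (A * 1 + B * 1)"
    using u A_nonneg B_nonneg by (intro add_mono mult_left_mono order_refl) (auto simp: power_le_one)
  finally show "\<bar>expectation (X u)\<bar> \<le> 1 + A + B" by simp
qed

lemma X_product_mean:
  assumes "0 \<le> u" "0 \<le> h"
  shows "integrable M (\<lambda>\<omega>. X u \<omega> * (X (u + h) \<omega> - X u \<omega>))"
    and "expectation (\<lambda>\<omega>. X u \<omega> * (X (u + h) \<omega> - X u \<omega>)) = \<mu> * u * (\<mu> * h)"
proof -
  \<comment> \<open>The times 0, u, u + h, continued constantly because a monotone sequence on all
    naturals is required.\<close>
  define r where "r = (\<lambda>i::nat. if i = 0 then 0 else if i = 1 then u else u + h)"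
  have "mono r" using assms by (auto simp: r_def mono_def)
  then have ind: "indep_vars (\<lambda>_. borel) (\<lambda>i \<omega>. X (r (Suc i)) \<omega> - X (r i) \<omega>) {..<2::nat}"
    by (intro independent_increments) (auto simp: r_def)
  have [simp]: "r 0 = 0" "r (Suc 0) = u" "r (Suc (Suc 0)) = u + h" by (auto simp: r_def)
  have 0: "X u \<omega> - X 0 \<omega> = X u \<omega>" if "\<omega> \<in> space M" for \<omega> using start[OF that] by simp
  have i0: "integrable M (\<lambda>\<omega>. X u \<omega> - X 0 \<omega>)"
    using X_integrable[of u] X_integrable[of 0] assms by auto
  have "(\<lambda>f. f 0) \<in> borel_measurable (PiM {..<1::nat} (\<lambda>_. borel :: real measure))"
    by (intro measurable_component_singleton) auto
  note P = indep_prefix_expectation[OF ind _ this, simplified, OF i0 increment_integrable(1)[OF assms]]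
  show "integrable M (\<lambda>\<omega>. X u \<omega> * (X (u + h) \<omega> - X u \<omega>))"
    using P(1) by (rule iffD1[OF Bochner_Integration.integrable_cong[OF refl], rotated]) (simp add: 0)
  have "expectation (\<lambda>\<omega>. X u \<omega> * (X (u + h) \<omega> - X u \<omega>)) =
      expectation (\<lambda>\<omega>. (X u \<omega> - X 0 \<omega>) * (X (u + h) \<omega> - X u \<omega>))"
    by (intro Bochner_Integration.integral_cong) (auto simp: 0)
  also have "\<dots> = expectation (\<lambda>\<omega>. X u \<omega> - X 0 \<omega>) * expectation (X h)"
    using P(2) increment_integrable(3)[OF assms] by simp
  also have "expectation (\<lambda>\<omega>. X u \<omega> - X 0 \<omega>) = expectation (X u)"
    by (intro Bochner_Integration.integral_cong) (auto simp: 0)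
  finally show "expectation (\<lambda>\<omega>. X u \<omega> * (X (u + h) \<omega> - X u \<omega>)) = \<mu> * u * (\<mu> * h)"
    using assms by (simp add: X_mean)
qed

text \<open>After subtraction of the squared mean, independence makes the remainder additive in u,
  and A and B bound it on the unit interval, so it is linear. The exact value matters: the bound
  through A and B may be far from sharp and is not comparable with \<open>l2_norm\<close>.\<close>

lemma X_second_moment:
  assumes "0 \<le> u"
  shows "expectation (\<lambda>\<omega>. (X u \<omega>)\<^sup>2) = V u"
proof -
  define v where "v u = expectation (\<lambda>\<omega>. (X u \<omega>)\<^sup>2) - \<mu>\<^sup>2 * u\<^sup>2" for u
  have "v u = v 1 * u"
  proof (rule additive_bounded_linear[where K = "A + B + \<mu>\<^sup>2", OF _ _ assms])
    fix u h :: real assume uh: "0 \<le> u" "0 \<le> h"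
    have "expectation (\<lambda>\<omega>. (X (u + h) \<omega>)\<^sup>2) =
        expectation (\<lambda>\<omega>. (X u \<omega>)\<^sup>2 + (2 * (X u \<omega> * (X (u + h) \<omega> - X u \<omega>)) + (X (u + h) \<omega> - X u \<omega>)\<^sup>2))"
      by (intro Bochner_Integration.integral_cong) (auto simp: power2_eq_square algebra_simps)
    also have "\<dots> = expectation (\<lambda>\<omega>. (X u \<omega>)\<^sup>2) + (2 * (\<mu> * u * (\<mu> * h)) + expectation (\<lambda>\<omega>. (X h \<omega>)\<^sup>2))"
      using X_product_mean[OF uh] increment_integrable[OF uh] X_square_integrable[OF uh(1)]
      by (simp del: mult_minus_right)
    finally show "v (u + h) = v u + v h"
      by (simp add: v_def power2_eq_square algebra_simps)
  next
    fix u :: real assume u: "0 \<le> u" "u \<le> 1"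
    have "expectation (\<lambda>\<omega>. (X u \<omega>)\<^sup>2) \<le> A * u + B * u\<^sup>2"
      using X_square_le u by simp
    also have "\<dots> \<le> A * 1 + B * 1"
      using u A_nonneg B_nonneg by (intro add_mono mult_left_mono) (auto simp: power_le_one)
    finally have "expectation (\<lambda>\<omega>. (X u \<omega>)\<^sup>2) \<le> A + B" by simp
    moreover have "0 \<le> expectation (\<lambda>\<omega>. (X u \<omega>)\<^sup>2)" by simp
    moreover have "\<mu>\<^sup>2 * u\<^sup>2 \<le> \<mu>\<^sup>2 * 1"
      using u by (intro mult_left_mono) (auto simp: power_le_one)
    moreover have "0 \<le> \<mu>\<^sup>2 * u\<^sup>2" by simp
    ultimately show "\<bar>v u\<bar> \<le> A + B + \<mu>\<^sup>2"
      using A_nonneg B_nonneg unfolding v_def by linarith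
  qed
  then show ?thesis by (simp add: v_def V_def \<rho>_def)
qed

lemma \<rho>_nonneg: "0 \<le> \<rho>"
  using variance_eq[OF X_integrable X_square_integrable, of 1] variance_positive[of "X 1"]
  by (simp add: \<rho>_def \<mu>_def)

lemma V_nonneg: "0 \<le> h \<Longrightarrow> 0 \<le> V h"
  by (simp add: V_def \<rho>_nonneg)

lemma V_mono: "0 \<le> g \<Longrightarrow> g \<le> h \<Longrightarrow> V g \<le> V h"
  unfolding V_def by (intro add_mono mult_left_mono power_mono \<rho>_nonneg) auto

lemma l2_norm_eq: "0 \<le> t \<Longrightarrow> l2_norm M X t = sqrt (V t)"
  by (simp add: l2_norm_def X_second_moment)

lemma increment_moments:
  assumes "0 \<le> a" "a \<le> b"
  shows "integrable M (\<lambda>\<omega>. X b \<omega> - X a \<omega>)" "integrable M (\<lambda>\<omega>. (X b \<omega> - X a \<omega>)\<^sup>2)"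
    "expectation (\<lambda>\<omega>. X b \<omega> - X a \<omega>) = \<mu> * (b - a)"
    "expectation (\<lambda>\<omega>. (X b \<omega> - X a \<omega>)\<^sup>2) = V (b - a)"
  using increment_integrable[of a "b - a"] assms by (simp_all add: X_mean X_second_moment)

lemma increment_centered:
  assumes "0 \<le> a" "a \<le> b"
  shows "integrable M (\<lambda>\<omega>. (X b \<omega> - X a \<omega> - \<mu> * (b - a))\<^sup>2)"
    "expectation (\<lambda>\<omega>. (X b \<omega> - X a \<omega> - \<mu> * (b - a))\<^sup>2) = \<rho> * (b - a)"
proof -
  note m = increment_moments[OF assms]
  define Y where "Y = (\<lambda>\<omega>. X b \<omega> - X a \<omega>)"
  define c where "c = \<mu> * (b - a)"
  have Y: "integrable M Y" "integrable M (\<lambda>\<omega>. (Y \<omega>)\<^sup>2)" "expectation Y = c"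
    "expectation (\<lambda>\<omega>. (Y \<omega>)\<^sup>2) = V (b - a)"
    using m by (simp_all add: Y_def c_def)
  have eq: "(X b \<omega> - X a \<omega> - \<mu> * (b - a))\<^sup>2 = (Y \<omega>)\<^sup>2 - 2 * c * Y \<omega> + c\<^sup>2" for \<omega>
    by (simp add: Y_def c_def power2_eq_square algebra_simps)
  show "integrable M (\<lambda>\<omega>. (X b \<omega> - X a \<omega> - \<mu> * (b - a))\<^sup>2)"
    unfolding eq using Y by simp
  show "expectation (\<lambda>\<omega>. (X b \<omega> - X a \<omega> - \<mu> * (b - a))\<^sup>2) = \<rho> * (b - a)"
    unfolding eq using Y by (simp add: prob_space V_def) (simp add: c_def power2_eq_square algebra_simps)
qed

text \<open>Removing the drift makes the increments over a grid centered and independent, so Doob's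
  inequality applies; the drift is added back as at most \<bar>\<mu>\<bar> h, and the grid is
  refined to reach the supremum over the whole interval.\<close>

lemma sup_increment_moment:
  assumes "0 \<le> a" "a \<le> b"
  shows "(\<integral>\<^sup>+\<omega>. ennreal (((SUP u\<in>{a..b}. X u \<omega>) - X a \<omega>)\<^sup>2) \<partial>M) \<le> ennreal (8 * V (b - a))"
proof -
  define h where "h = b - a"
  have h: "0 \<le> h" using assms by (simp add: h_def)
  define r where "r n i = grid a b (Suc n) i" for n i
  have r_nonneg: "0 \<le> r n i" for n i using assms by (simp add: r_def grid_def)
  have r_mono: "r n i \<le> r n j" if "i \<le> j" for n i j
    using assms that by (auto simp: r_def grid_def intro!: divide_right_mono mult_left_mono)
  have r_ends: "r n 0 = a" "r n (Suc n) = b" for n by (simp_all add: r_def grid_def)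
  have r_le: "r n i \<le> b" if "i \<le> Suc n" for n i using r_mono[OF that, of n] by (simp add: r_ends)
  define d where "d n i \<omega> = X (r n (Suc i)) \<omega> - X (r n i) \<omega> - \<mu> * (r n (Suc i) - r n i)" for n i \<omega>
  have d_sum: "(\<Sum>j<i. d n j \<omega>) = X (r n i) \<omega> - X a \<omega> - \<mu> * (r n i - a)" for n i \<omega>
    by (induction i) (simp_all add: r_ends d_def algebra_simps)
  have d_ind: "indep_vars (\<lambda>_. borel) (d n) {..<Suc n}" for n
  proof -
    have "indep_vars (\<lambda>_. borel) (\<lambda>i \<omega>. X (r n (Suc i)) \<omega> - X (r n i) \<omega>) {..<Suc n}"
      using r_mono r_nonneg by (intro independent_increments) (auto intro!: monoI)
    from indep_vars_compose2[OF this, of "\<lambda>i x. x - \<mu> * (r n (Suc i) - r n i)" "\<lambda>_. borel"]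
    show ?thesis unfolding d_def[abs_def] by simp
  qed
  have d_mean: "integrable M (d n i)" "expectation (d n i) = 0" for n i
    using increment_moments[OF r_nonneg[of n i] r_mono[of i "Suc i" n]]
    unfolding d_def[abs_def] by (auto simp: prob_space)
  have d_sq: "integrable M (\<lambda>\<omega>. (\<Sum>j<Suc n. d n j \<omega>)\<^sup>2)"
    "expectation (\<lambda>\<omega>. (\<Sum>j<Suc n. d n j \<omega>)\<^sup>2) = \<rho> * h" for n
    unfolding d_sum r_ends using increment_centered[OF assms] by (simp_all add: h_def)
  define R where "R n \<omega> = running_max (\<lambda>j. d n j \<omega>) (Suc n)" for n \<omega>
  have [measurable]: "X (r n i) \<in> borel_measurable M" for n i by (intro measurable_X r_nonneg)
  have [measurable]: "d n i \<in> borel_measurable M" for n i unfolding d_def by measurable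
  have [measurable]: "(\<lambda>\<omega>. running_max (\<lambda>j. d n j \<omega>) i) \<in> borel_measurable M" for n i
    by (induction i) simp_all
  have [measurable]: "R n \<in> borel_measurable M" for n unfolding R_def by measurable
  have R_bound: "(\<integral>\<^sup>+\<omega>. ennreal ((R n \<omega>)\<^sup>2) \<partial>M) \<le> ennreal (4 * (\<rho> * h))" for n
    using doob_L2[OF d_ind d_mean d_sq(1)] unfolding R_def d_sq .
  have R_nonneg: "0 \<le> R n \<omega>" for n \<omega> unfolding R_def by (rule running_max_nonneg)
  have X_le: "X (r n i) \<omega> - X a \<omega> \<le> R n \<omega> + \<bar>\<mu>\<bar> * h" if "i \<le> Suc n" for n i \<omega>
  proof -
    have "X (r n i) \<omega> - X a \<omega> = (\<Sum>j<i. d n j \<omega>) + \<mu> * (r n i - a)" by (simp add: d_sum)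
    also have "\<dots> \<le> R n \<omega> + \<bar>\<mu>\<bar> * h"
    proof (rule add_mono)
      show "(\<Sum>j<i. d n j \<omega>) \<le> R n \<omega>" unfolding R_def by (rule sum_le_running_max[OF that])
      have "a \<le> r n i" using r_mono[of 0 i n] by (simp add: r_ends)
      then have "\<mu> * (r n i - a) \<le> \<bar>\<mu>\<bar> * (r n i - a)" by (intro mult_right_mono) auto
      also have "\<dots> \<le> \<bar>\<mu>\<bar> * h" using r_le[OF that] by (intro mult_left_mono) (auto simp: h_def)
      finally show "\<mu> * (r n i - a) \<le> \<bar>\<mu>\<bar> * h" .
    qed
    finally show ?thesis .
  qed
  define Z where "Z n \<omega> = R n \<omega> + \<bar>\<mu>\<bar> * h" for n \<omega>
  have [measurable]: "Z n \<in> borel_measurable M" for n unfolding Z_def by measurable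
  have Z_nonneg: "0 \<le> Z n \<omega>" for n \<omega> using R_nonneg h by (simp add: Z_def)
  have fatou: "ennreal (((SUP u\<in>{a..b}. X u \<omega>) - X a \<omega>)\<^sup>2) \<le> liminf (\<lambda>n. ennreal ((Z n \<omega>)\<^sup>2))"
    if \<omega>: "\<omega> \<in> space M" for \<omega>
    unfolding le_Liminf_iff
  proof (intro allI impI)
    fix y assume y: "y < ennreal (((SUP u\<in>{a..b}. X u \<omega>) - X a \<omega>)\<^sup>2)"
    note cad = cadlag_paths[OF \<omega>]
    obtain y' where y': "y = ennreal y'" "0 \<le> y'"
      using y by (cases y) auto
    have s_nonneg: "0 \<le> (SUP u\<in>{a..b}. X u \<omega>) - X a \<omega>"
      using cadlag_le_SUP[OF cad assms(1) order_refl assms(2)] by simp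
    from y y' have "y' < ((SUP u\<in>{a..b}. X u \<omega>) - X a \<omega>)\<^sup>2"
      by (simp add: ennreal_less_iff)
    then have "sqrt y' < (SUP u\<in>{a..b}. X u \<omega>) - X a \<omega>"
      by (rule real_less_lsqrt[OF s_nonneg])
    then have "X a \<omega> + sqrt y' < (SUP u\<in>{a..b}. X u \<omega>)" by simp
    then obtain u where u: "u \<in> {a..b}" "X a \<omega> + sqrt y' < X u \<omega>"
      using assms by (subst (asm) less_cSUP_iff) (auto intro: cadlag_bdd_above[OF cad])
    from grid_right_approx[of a u b] u obtain i where i: "\<And>n. i n \<le> Suc n"
      "\<And>n. u \<le> r n (i n)" "(\<lambda>n. r n (i n)) \<longlonglongrightarrow> u"
      unfolding r_def by auto
    have "(\<lambda>n. X (r n (i n)) \<omega>) \<longlonglongrightarrow> X u \<omega>"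
      using u assms by (intro cadlag_right_approx[OF cad _ i(2,3)]) auto
    from order_tendstoD(1)[OF this u(2)]
    show "\<forall>\<^sub>F n in sequentially. y < ennreal ((Z n \<omega>)\<^sup>2)"
    proof (rule eventually_mono)
      fix n assume "X a \<omega> + sqrt y' < X (r n (i n)) \<omega>"
      then have "sqrt y' < Z n \<omega>"
        using X_le[OF i(1), of n \<omega>] by (simp add: Z_def)
      then have "(sqrt y')\<^sup>2 < (Z n \<omega>)\<^sup>2"
        using y' by (intro power_strict_mono) auto
      then show "y < ennreal ((Z n \<omega>)\<^sup>2)"
        using y' by (simp add: ennreal_less_iff)
    qed
  qed
  have "(\<integral>\<^sup>+\<omega>. ennreal (((SUP u\<in>{a..b}. X u \<omega>) - X a \<omega>)\<^sup>2) \<partial>M) \<le>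
      (\<integral>\<^sup>+\<omega>. liminf (\<lambda>n. ennreal ((Z n \<omega>)\<^sup>2)) \<partial>M)"
    by (intro nn_integral_mono fatou)
  also have "\<dots> \<le> liminf (\<lambda>n. \<integral>\<^sup>+\<omega>. ennreal ((Z n \<omega>)\<^sup>2) \<partial>M)"
    by (intro nn_integral_liminf) simp
  \<comment> \<open>The factor 8 is Doob's 4 doubled by squaring the sum of maximum and drift; the
    drift itself contributes only 2.\<close>
  also have "\<dots> \<le> liminf (\<lambda>n. ennreal (8 * V h))"
  proof (intro Liminf_mono always_eventually allI)
    fix n
    have "(\<integral>\<^sup>+\<omega>. ennreal ((Z n \<omega>)\<^sup>2) \<partial>M) \<le>
        (\<integral>\<^sup>+\<omega>. ennreal 2 * ennreal ((R n \<omega>)\<^sup>2) + ennreal (2 * (\<mu>\<^sup>2 * h\<^sup>2)) \<partial>M)"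
    proof (intro nn_integral_mono)
      fix \<omega>
      have "0 \<le> (R n \<omega> - \<bar>\<mu>\<bar> * h)\<^sup>2" by simp
      moreover have "(\<bar>\<mu>\<bar> * h)\<^sup>2 = \<mu>\<^sup>2 * h\<^sup>2" by (simp add: power_mult_distrib)
      ultimately have "(Z n \<omega>)\<^sup>2 \<le> 2 * (R n \<omega>)\<^sup>2 + 2 * (\<mu>\<^sup>2 * h\<^sup>2)"
        unfolding Z_def power2_sum power2_diff by linarith
      then have "ennreal ((Z n \<omega>)\<^sup>2) \<le> ennreal (2 * (R n \<omega>)\<^sup>2 + 2 * (\<mu>\<^sup>2 * h\<^sup>2))" by (rule ennreal_leI)
      then show "ennreal ((Z n \<omega>)\<^sup>2) \<le> ennreal 2 * ennreal ((R n \<omega>)\<^sup>2) + ennreal (2 * (\<mu>\<^sup>2 * h\<^sup>2))"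
        by (subst (asm) ennreal_plus) (simp_all only: ennreal_mult'[of 2] zero_le_numeral zero_le_power2 mult_nonneg_nonneg)
    qed
    also have "\<dots> = ennreal 2 * (\<integral>\<^sup>+\<omega>. ennreal ((R n \<omega>)\<^sup>2) \<partial>M) + ennreal (2 * (\<mu>\<^sup>2 * h\<^sup>2))"
      by (simp add: nn_integral_add nn_integral_cmult emeasure_space_1)
    also have "\<dots> \<le> ennreal 2 * ennreal (4 * (\<rho> * h)) + ennreal (2 * (\<mu>\<^sup>2 * h\<^sup>2))"
      by (intro add_mono mult_left_mono R_bound) auto
    also have "\<dots> = ennreal (8 * (\<rho> * h) + 2 * (\<mu>\<^sup>2 * h\<^sup>2))"
      using \<rho>_nonneg h by (subst ennreal_mult'[symmetric], simp, subst ennreal_plus[symmetric]) auto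
    also have "\<dots> \<le> ennreal (8 * V h)"
      unfolding V_def by (intro ennreal_leI) simp
    finally show "(\<integral>\<^sup>+\<omega>. ennreal ((Z n \<omega>)\<^sup>2) \<partial>M) \<le> ennreal (8 * V h)" .
  qed
  also have "\<dots> = ennreal (8 * V h)" by (simp add: Liminf_const)
  finally show ?thesis by (simp add: h_def)
qed

end

section \<open>Arrivals of a Poisson process\<close>

abbreviation exp_measure :: "real \<Rightarrow> real measure" where
  "exp_measure q \<equiv> density lborel (\<lambda>x. ennreal (exponential_density q x))"

lemma exp_measure_moment:
  "0 < q \<Longrightarrow> (\<integral>\<^sup>+y. ennreal (y ^ i) \<partial>exp_measure q) = ennreal (fact i / q ^ i)"
  by (subst nn_integral_density)
    (simp_all add: ennreal_mult'[symmetric] nn_integral_erlang_ith_moment del: One_nat_def)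

lemma AE_exp_measure_nonneg: "AE y in exp_measure q. 0 \<le> y"
  by (subst AE_density) (auto simp: erlang_density_def intro!: AE_I2)

text \<open>Lack of memory in integrated form: after translation by c the density splits off the
  factor exp (- (q c)), the probability of outlasting c.\<close>

lemma exp_measure_memoryless:
  assumes "0 < q" "0 \<le> c" and [measurable]: "H \<in> borel_measurable borel"
  shows "(\<integral>\<^sup>+x. indicator {c<..} x * H (x - c) \<partial>exp_measure q) =
    ennreal (exp (- (q * c))) * (\<integral>\<^sup>+x. H x \<partial>exp_measure q)"
proof -
  have "(\<integral>\<^sup>+x. indicator {c<..} x * H (x - c) \<partial>exp_measure q) =
      (\<integral>\<^sup>+x. ennreal (exponential_density q x) * (indicator {c<..} x * H (x - c)) \<partial>lborel)"
    by (subst nn_integral_density) auto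
  also have "\<dots> = (\<integral>\<^sup>+x. ennreal (exponential_density q (c + x)) * (indicator {c<..} (c + x) * H x) \<partial>lborel)"
    by (subst nn_integral_real_affine[where c = 1 and t = c]) auto
  also have "\<dots> = (\<integral>\<^sup>+x. ennreal (exp (- (q * c))) * (ennreal (exponential_density q x) * H x) \<partial>lborel)"
  proof (rule nn_integral_cong_AE)
    \<comment> \<open>At x = 0 the density is positive but the strict indicator vanishes, so the two
      integrands differ at this single point.\<close>
    have "AE x in lborel. x \<noteq> (0::real)" by (rule AE_lborel_singleton)
    then show "AE x in lborel. ennreal (exponential_density q (c + x)) * (indicator {c<..} (c + x) * H x) =
        ennreal (exp (- (q * c))) * (ennreal (exponential_density q x) * H x)"
    proof eventually_elim
      case (elim x)
      show ?case
      proof (cases "0 < x")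
        case True
        have "exponential_density q (c + x) = exp (- (q * c)) * exponential_density q x"
          using True assms by (simp add: exponential_density_def exp_add[symmetric] algebra_simps)
        then have "ennreal (exponential_density q (c + x)) =
            ennreal (exp (- (q * c))) * ennreal (exponential_density q x)"
          by (simp add: ennreal_mult')
        then show ?thesis using True by (simp add: ac_simps)
      next
        case False
        with elim have "x < 0" by simp
        then show ?thesis by (simp add: exponential_density_def)
      qed
    qed
  qed
  also have "\<dots> = ennreal (exp (- (q * c))) * (\<integral>\<^sup>+x. H x \<partial>exp_measure q)"
    by (subst nn_integral_cmult) (auto simp: nn_integral_density)
  finally show ?thesis .
qed

text \<open>An exponential series with two uses. At c = 1 it says that the arrivals have constant
  intensity q. At c = 1 - p, after multiplication by p, it is the density of a geometric number of
  exponential gaps, again exponential but with rate p q.\<close>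

lemma suminf_erlang_density:
  assumes "0 < q" "0 \<le> c"
  shows "(\<Sum>k. ennreal (c ^ k * erlang_density k q x)) =
    (if x < 0 then 0 else ennreal (q * exp (- (q * (1 - c) * x))))"
proof (cases "x < 0")
  case False
  have "(\<lambda>k. (q * exp (- (q * x))) * ((c * q * x) ^ k /\<^sub>R fact k)) sums (q * exp (- (q * x)) * exp (c * q * x))"
    by (intro sums_mult exp_converges)
  also have "(\<lambda>k. (q * exp (- (q * x))) * ((c * q * x) ^ k /\<^sub>R fact k)) = (\<lambda>k. c ^ k * erlang_density k q x)"
    using False by (simp add: fun_eq_iff erlang_density_def power_mult_distrib field_simps)
  also have "q * exp (- (q * x)) * exp (c * q * x) = q * exp (- (q * (1 - c) * x))"
    by (simp add: exp_add[symmetric] algebra_simps)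
  finally have "(\<lambda>k. c ^ k * erlang_density k q x) sums (q * exp (- (q * (1 - c) * x)))" .
  then show ?thesis
    using False assms by (subst suminf_ennreal_eq) (auto simp: erlang_density_nonneg dest: sums_unique)
qed (simp add: erlang_density_def)

locale exponential_gaps =
  fixes q :: real
  assumes q_pos: "0 < q"
begin

sublocale sequence_space "exp_measure q"
proof -
  have p: "prob_space (exp_measure q)" by (rule prob_space_exponential_density[OF q_pos])
  interpret prob_space "exp_measure q" by (rule p)
  show "sequence_space (exp_measure q)"
    unfolding sequence_space_def
    by (intro product_prob_space.intro product_sigma_finite.intro product_prob_space_axioms.intro)
      (rule sigma_finite_measure_axioms, rule p)
qed

lemma gap_space_eq: "gap_space q = S"
  by (simp add: gap_space_def)

lemma measurable_gap[measurable]: "(\<lambda>g. g i) \<in> borel_measurable S"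
proof -
  have "(\<lambda>g. g i) \<in> measurable S (exp_measure q)" by (rule measurable_component_singleton) simp
  then show ?thesis by simp
qed

lemma measurable_arrival[measurable]: "(\<lambda>g. arrival g k) \<in> borel_measurable S"
  unfolding arrival_def by measurable

text \<open>\<open>erlang_density k\<close> belongs to the sum of k + 1 independent exponential
  variables, whence the shift of the index.\<close>

lemma nn_integral_arrival:
  assumes [measurable]: "f \<in> borel_measurable borel"
  shows "(\<integral>\<^sup>+g. f (arrival g (Suc k)) \<partial>S) = (\<integral>\<^sup>+x. ennreal (erlang_density k q x) * f x \<partial>lborel)"
proof -
  let ?I = "{..<Suc k}"
  have c: "distr S (exp_measure q) (\<lambda>g. g i) = exp_measure q" for i
    by (rule distr_PiM_component) (auto intro: prob_space_exponential_density[OF q_pos])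
  have d: "distr S borel (\<lambda>g. g i) = exp_measure q" for i
    using c[of i] by (metis distr_cong sets_density sets_lborel)
  have "distr S (\<Pi>\<^sub>M i\<in>?I. borel) (\<lambda>g. \<lambda>i\<in>?I. g i) = (\<Pi>\<^sub>M i\<in>?I. distr S borel (\<lambda>g. g i))"
    unfolding d
  proof -
    have "distr S (PiM ?I (\<lambda>_. exp_measure q)) (\<lambda>g. restrict g ?I) = PiM ?I (\<lambda>_. exp_measure q)"
      using distr_PiM_reindex[of UNIV "\<lambda>_. exp_measure q" "\<lambda>i. i" ?I] prob_space_exponential_density[OF q_pos]
      by simp
    moreover have "sets (PiM ?I (\<lambda>_. exp_measure q)) = sets (PiM ?I (\<lambda>_. borel))"
      by (intro sets_PiM_cong) auto
    ultimately show "distr S (PiM ?I (\<lambda>_. borel)) (\<lambda>g. restrict g ?I) = PiM ?I (\<lambda>_. exp_measure q)"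
      by (metis distr_cong)
  qed
  then have "P.indep_vars (\<lambda>_. borel) (\<lambda>i g. g i) ?I"
    by (subst P.indep_vars_iff_distr_eq_PiM') auto
  moreover have "distributed S lborel (\<lambda>g. g i) (exponential_density q)" for i
    using d[of i] by (auto simp: distributed_def distr_cong[OF refl sets_lborel])
  ultimately have "distributed S lborel (\<lambda>g. \<Sum>i\<in>?I. g i) (erlang_density (card ?I - 1) q)"
    using q_pos by (intro P.exponential_distributed_sum) auto
  then show ?thesis
    using distributed_nn_integral[of S lborel _ _ f] by (simp add: arrival_def)
qed


end

text \<open>A least index with a measurable property is plainly measurable, which makes it easier to
  handle than the cardinality in \<open>num_arrivals\<close>; on regular gaps the two differ by
  1.\<close>

definition next_arrival :: "(nat \<Rightarrow> real) \<Rightarrow> real \<Rightarrow> nat" where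
  "next_arrival g t = (LEAST k. t < arrival g k)"

text \<open>The gap space contains all real sequences. This is the almost sure event on which
  arrivals are ordered and eventually pass t, so that the least index above exists.\<close>

definition regular_gaps :: "(nat \<Rightarrow> real) \<Rightarrow> real \<Rightarrow> bool" where
  "regular_gaps g t \<longleftrightarrow> (\<forall>i. 0 \<le> g i) \<and> (\<exists>k. t < arrival g k)"

lemma less_arrival_iff:
  assumes "regular_gaps g t" "0 \<le> t"
  shows "t < arrival g k \<longleftrightarrow> next_arrival g t \<le> k"
proof
  assume "next_arrival g t \<le> k"
  moreover have "t < arrival g (next_arrival g t)"
    unfolding next_arrival_def using assms(1) by (intro LeastI_ex[of "\<lambda>k. t < arrival g k"]) (auto simp: regular_gaps_def)
  moreover have "0 \<le> g i" for i using assms(1) by (simp add: regular_gaps_def)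
  ultimately show "t < arrival g k"
    by (intro less_le_trans[OF _ arrival_mono[of g "next_arrival g t" k]])
next
  assume "t < arrival g k"
  then show "next_arrival g t \<le> k" unfolding next_arrival_def by (rule Least_le)
qed

lemma next_arrival_pos: "regular_gaps g t \<Longrightarrow> 0 \<le> t \<Longrightarrow> 1 \<le> next_arrival g t"
  using less_arrival_iff[of g t 0] by (simp add: arrival_def)

lemma num_arrivals_eq:
  assumes "regular_gaps g t" "0 \<le> t"
  shows "num_arrivals g t + 1 = next_arrival g t"
proof -
  have "{j. 1 \<le> j \<and> arrival g j \<le> t} = {1..<next_arrival g t}"
    unfolding not_less[symmetric] less_arrival_iff[OF assms] by auto
  then show ?thesis using next_arrival_pos[OF assms] by (simp add: num_arrivals_def)
qed

lemma crossing_iff: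
  assumes "regular_gaps g t" "0 \<le> t"
  shows "arrival g k \<le> t \<and> t < arrival g (Suc k) \<longleftrightarrow> next_arrival g t = Suc k"
  unfolding less_arrival_iff[OF assms] not_less[symmetric] by auto

section \<open>Expected number of arrivals and decomposition at the gap that straddles t\<close>

context exponential_gaps
begin

lemma measurable_next_arrival[measurable]: "(\<lambda>g. next_arrival g t) \<in> measurable S (count_space UNIV)"
  unfolding next_arrival_def by measurable

text \<open>The sum is the expected number of arrivals up to t; the Erlang densities add up to the
  constant q on the half-line.\<close>

lemma arrivals_before:
  assumes "0 \<le> t"
  shows "(\<Sum>k. emeasure S {g \<in> space S. arrival g (Suc k) \<le> t}) = ennreal (q * t)"
proof -
  have "emeasure S {g \<in> space S. arrival g (Suc k) \<le> t} =
      (\<integral>\<^sup>+x. ennreal (erlang_density k q x) * indicator {..t} x \<partial>lborel)" for k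
  proof -
    have "(\<integral>\<^sup>+g. indicator {..t} (arrival g (Suc k)) \<partial>S) =
        (\<integral>\<^sup>+g. indicator {g \<in> space S. arrival g (Suc k) \<le> t} g \<partial>S)"
      by (intro nn_integral_cong) (auto simp: indicator_def)
    also have "\<dots> = emeasure S {g \<in> space S. arrival g (Suc k) \<le> t}"
      by (intro nn_integral_indicator) measurable
    finally have "emeasure S {g \<in> space S. arrival g (Suc k) \<le> t} = (\<integral>\<^sup>+g. indicator {..t} (arrival g (Suc k)) \<partial>S)" ..
    then show ?thesis by (simp add: nn_integral_arrival)
  qed
  then have "(\<Sum>k. emeasure S {g \<in> space S. arrival g (Suc k) \<le> t}) =
      (\<Sum>k. \<integral>\<^sup>+x. ennreal (erlang_density k q x) * indicator {..t} x \<partial>lborel)"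
    by (simp only:)
  also have "\<dots> = (\<integral>\<^sup>+x. (\<Sum>k. ennreal (erlang_density k q x) * indicator {..t} x) \<partial>lborel)"
    by (rule nn_integral_suminf[symmetric]) auto
  also have "\<dots> = (\<integral>\<^sup>+x. ennreal q * indicator {0..t} x \<partial>lborel)"
    using suminf_erlang_density[OF q_pos, of 1]
    by (intro nn_integral_cong) (auto simp: ennreal_suminf_multc indicator_def)
  also have "\<dots> = ennreal q * ennreal t"
    using assms by (simp add: nn_integral_cmult_indicator)
  finally show ?thesis using q_pos assms by (simp add: ennreal_mult)
qed

text \<open>As in the Borel-Cantelli lemma: the number of arrivals up to t has finite expectation,
  so it is almost surely finite and some arrival lies beyond t.\<close>

lemma AE_regular_gaps:
  assumes "0 \<le> t"
  shows "AE g in S. regular_gaps g t"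
proof -
  have "AE g in S. \<forall>i. 0 \<le> g i"
    unfolding AE_all_countable
    by (intro allI AE_PiM_component prob_space_exponential_density[OF q_pos] AE_exp_measure_nonneg UNIV_I)
  moreover have "AE g in S. (\<Sum>k. indicator {g \<in> space S. arrival g (Suc k) \<le> t} g) \<noteq> (\<infinity>::ennreal)"
    using arrivals_before[OF assms]
    by (intro nn_integral_noteq_infinite) (auto simp: nn_integral_suminf)
  moreover have "AE g in S. g \<in> space S" by (rule AE_space)
  ultimately show ?thesis
  proof eventually_elim
    case (elim g)
    show ?case
    proof (rule ccontr)
      assume "\<not> regular_gaps g t"
      then have "arrival g k \<le> t" for k using elim(1) by (auto simp: regular_gaps_def not_less)
      then have "(\<Sum>k. indicator {g \<in> space S. arrival g (Suc k) \<le> t} g) = (\<Sum>k::nat. 1::ennreal)"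
        using elim(3) by (intro suminf_cong) (auto simp: indicator_def)
      also have "\<dots> = \<infinity>" by (subst suminf_eq_SUP) (simp add: ennreal_SUP_of_nat_eq_top)
      finally show False using elim(2) by simp
    qed
  qed
qed

lemma expected_next_arrival:
  assumes "0 \<le> t"
  shows "(\<integral>\<^sup>+g. of_nat (next_arrival g t) \<partial>S) = ennreal (q * t + 1)"
proof -
  have "(\<integral>\<^sup>+g. of_nat (next_arrival g t) \<partial>S) =
      (\<integral>\<^sup>+g. 1 + (\<Sum>k. indicator {g \<in> space S. arrival g (Suc k) \<le> t} g) \<partial>S)"
  proof (rule nn_integral_cong_AE)
    from AE_regular_gaps[OF assms] AE_space
    show "AE g in S. of_nat (next_arrival g t) =
        1 + (\<Sum>k. indicator {g \<in> space S. arrival g (Suc k) \<le> t} g :: ennreal)"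
    proof eventually_elim
      case (elim g)
      have "arrival g (Suc k) \<le> t \<longleftrightarrow> k < next_arrival g t - 1" for k
        using less_arrival_iff[OF elim(1) assms, of "Suc k"] by auto
      then have "(\<Sum>k. indicator {g \<in> space S. arrival g (Suc k) \<le> t} g :: ennreal) =
          (\<Sum>k. if k < next_arrival g t - 1 then 1 else 0)"
        using elim(2) by (intro suminf_cong) (auto simp: indicator_def)
      also have "\<dots> = (\<Sum>k<next_arrival g t - 1. 1)"
        by (subst suminf_finite[of "{..<next_arrival g t - 1}"]) auto
      finally have "(\<Sum>k. indicator {g \<in> space S. arrival g (Suc k) \<le> t} g :: ennreal) =
          of_nat (next_arrival g t - 1)" by simp
      then show ?case using next_arrival_pos[OF elim(1) assms]
        by (simp flip: of_nat_Suc add: of_nat_diff)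
    qed
  qed
  also have "\<dots> = 1 + ennreal (q * t)"
    using arrivals_before[OF assms] by (subst nn_integral_add) (auto simp: nn_integral_suminf P.emeasure_space_1)
  finally show ?thesis using q_pos assms by (simp add: ac_simps)
qed


definition crossing :: "real \<Rightarrow> nat \<Rightarrow> (nat \<Rightarrow> real) set" where
  "crossing t k = {g \<in> space S. arrival g k \<le> t \<and> t < arrival g (Suc k)}"

lemma sets_crossing[measurable]: "crossing t k \<in> sets S"
  unfolding crossing_def by measurable

lemma crossing_iff_next_arrival:
  "regular_gaps g t \<Longrightarrow> 0 \<le> t \<Longrightarrow> g \<in> space S \<Longrightarrow> g \<in> crossing t k \<longleftrightarrow> next_arrival g t = Suc k"
  using crossing_iff[of g t k] by (auto simp: crossing_def)

text \<open>The crossing events partition the regular samples, which turns a random index into a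
  countable sum over fixed ones, where independence can be used.\<close>

lemma AE_suminf_crossing:
  assumes "0 \<le> t"
  shows "AE g in S. (\<Sum>k. indicator (crossing t k) g * \<Phi> k g) = (\<Phi> (next_arrival g t - 1) g :: ennreal)"
  using AE_regular_gaps[OF assms] AE_space
proof eventually_elim
  case (elim g)
  have "indicator (crossing t k) g * \<Phi> k g = (if k = next_arrival g t - 1 then \<Phi> (next_arrival g t - 1) g else 0)" for k
    using crossing_iff_next_arrival[OF elim(1) assms elim(2)] next_arrival_pos[OF elim(1) assms]
    by (auto simp: indicator_def)
  then show ?case
    by (simp only:) (subst suminf_finite[of "{next_arrival g t - 1}"], auto)
qed

lemma suminf_emeasure_crossing:
  assumes "0 \<le> t"
  shows "(\<Sum>k. emeasure S (crossing t k)) = 1"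
proof -
  have "(\<Sum>k. emeasure S (crossing t k)) = (\<integral>\<^sup>+g. (\<Sum>k. indicator (crossing t k) g) \<partial>S)"
    by (subst nn_integral_suminf) auto
  also have "\<dots> = (\<integral>\<^sup>+g. 1 \<partial>S)"
    using AE_suminf_crossing[OF assms, of "\<lambda>_ _. 1"] by (intro nn_integral_cong_AE) simp
  finally show ?thesis by (simp add: P.emeasure_space_1)
qed

lemma nn_integral_gaps_Cons:
  assumes [measurable]: "f \<in> borel_measurable S"
  shows "(\<integral>\<^sup>+g. f g \<partial>S) = (\<integral>\<^sup>+x. (\<integral>\<^sup>+g. f (case_nat x g) \<partial>S) \<partial>exp_measure q)"
proof -
  have "(\<integral>\<^sup>+g. f g \<partial>S) = (\<integral>\<^sup>+p. f (case_nat (fst p) (snd p)) \<partial>(exp_measure q \<Otimes>\<^sub>M S))"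
    by (subst PiM_iter[symmetric], subst nn_integral_distr) (auto simp: split_beta')
  then show ?thesis
    by (simp add: P.nn_integral_fst[symmetric])
qed

text \<open>Regeneration: k gaps followed by a fresh independent sequence are again distributed as
  the gaps.\<close>

lemma nn_integral_gaps_append:
  assumes [measurable]: "f \<in> borel_measurable S"
  shows "(\<integral>\<^sup>+g. f g \<partial>S) = (\<integral>\<^sup>+g. (\<integral>\<^sup>+g'. f (comb_seq k g g') \<partial>S) \<partial>S)"
proof -
  have "(\<integral>\<^sup>+g. f g \<partial>S) = (\<integral>\<^sup>+p. f (comb_seq k (fst p) (snd p)) \<partial>(S \<Otimes>\<^sub>M S))"
    by (subst PiM_comb_seq[symmetric, of k], subst nn_integral_distr) (auto simp: split_beta')
  then show ?thesis
    by (simp add: P.nn_integral_fst[symmetric])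
qed

lemma arrival_case_nat: "arrival (case_nat x g) (Suc j) = x + arrival g j"
  unfolding arrival_def by (subst sum.lessThan_Suc_shift) simp

lemma arrival_comb_seq: "arrival (comb_seq k g g') (k + j) = arrival g k + arrival g' j"
proof -
  have "arrival (comb_seq k g g') (k + j) = (\<Sum>i<k. comb_seq k g g' i) + (\<Sum>i\<in>{k..<k + j}. comb_seq k g g' i)"
    unfolding arrival_def by (subst sum.union_disjoint[symmetric]) (auto intro!: sum.cong)
  also have "(\<Sum>i\<in>{k..<k + j}. comb_seq k g g' i) = (\<Sum>i<j. comb_seq k g g' (k + i))"
    by (rule sum.reindex_bij_witness[of _ "\<lambda>i. k + i" "\<lambda>i. i - k"]) auto
  also have "\<dots> = arrival g' j"
    unfolding arrival_def by (intro sum.cong) (simp_all add: comb_seq_def)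
  also have "(\<Sum>i<k. comb_seq k g g' i) = arrival g k"
    unfolding arrival_def by (intro sum.cong) (simp_all add: comb_seq_def)
  finally show ?thesis .
qed

text \<open>The gaps after arrival \<open>k\<close> are independent of the earlier ones, and the gap that straddles \<open>t\<close> has
  no memory.\<close>

lemma nn_integral_crossing:
  assumes [measurable]: "f \<in> borel_measurable borel" and "0 \<le> t"
  shows "(\<integral>\<^sup>+g. indicator (crossing t k) g * f (arrival g (Suc k + j) - t) \<partial>S) =
    emeasure S (crossing t k) * (\<integral>\<^sup>+g. f (arrival g (Suc j)) \<partial>S)"
proof -
  \<comment> \<open>The probability that a gap beginning at time a \<le> t outlasts t.\<close>
  define W where "W a = indicator {..t} a * ennreal (exp (- (q * (t - a))))" for a
  have [measurable]: "W \<in> borel_measurable borel" unfolding W_def by measurable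
  have *: "(\<integral>\<^sup>+g. indicator (crossing t k) g * f (arrival g (Suc k + j) - t) \<partial>S) =
      (\<integral>\<^sup>+g. W (arrival g k) \<partial>S) * (\<integral>\<^sup>+g. f (arrival g (Suc j)) \<partial>S)"
    if [measurable]: "f \<in> borel_measurable borel" for f
  proof -
    define H where "H y = (\<integral>\<^sup>+g. f (y + arrival g j) \<partial>S)" for y
    have [measurable]: "H \<in> borel_measurable borel" unfolding H_def by measurable
    have f_H: "(\<integral>\<^sup>+g. f (arrival g (Suc j)) \<partial>S) = (\<integral>\<^sup>+x. H x \<partial>exp_measure q)"
      by (subst nn_integral_gaps_Cons) (simp_all add: arrival_case_nat H_def[abs_def])
    have "(\<integral>\<^sup>+g. indicator (crossing t k) g * f (arrival g (Suc k + j) - t) \<partial>S) =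
        (\<integral>\<^sup>+g. (\<integral>\<^sup>+g'. indicator {..t} (arrival g k) *
          (indicator {t - arrival g k<..} (arrival g' 1) * f (arrival g k + arrival g' (Suc j) - t)) \<partial>S) \<partial>S)"
    proof (subst nn_integral_gaps_append[of _ k], measurable, intro nn_integral_cong)
      fix g g' assume "g \<in> space S" "g' \<in> space S"
      then have "comb_seq k g g' \<in> space S" by (auto simp: space_PiM)
      then show "indicator (crossing t k) (comb_seq k g g') * f (arrival (comb_seq k g g') (Suc k + j) - t) =
          indicator {..t} (arrival g k) *
          (indicator {t - arrival g k<..} (arrival g' 1) * f (arrival g k + arrival g' (Suc j) - t))"
        using arrival_comb_seq[of k g g' 0] arrival_comb_seq[of k g g' 1] arrival_comb_seq[of k g g' "Suc j"]
        by (auto simp: crossing_def indicator_def arrival_def[of _ 0])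
    qed
    also have "\<dots> = (\<integral>\<^sup>+g. W (arrival g k) * (\<integral>\<^sup>+x. H x \<partial>exp_measure q) \<partial>S)"
    proof (intro nn_integral_cong)
      fix g
      show "(\<integral>\<^sup>+g'. indicator {..t} (arrival g k) *
          (indicator {t - arrival g k<..} (arrival g' 1) * f (arrival g k + arrival g' (Suc j) - t)) \<partial>S) =
          W (arrival g k) * (\<integral>\<^sup>+x. H x \<partial>exp_measure q)"
      proof (cases "arrival g k \<le> t")
        case True
        define c where "c = t - arrival g k"
        have "(\<integral>\<^sup>+g'. indicator {c<..} (arrival g' 1) * f (arrival g' (Suc j) - c) \<partial>S) =
            (\<integral>\<^sup>+x. indicator {c<..} x * H (x - c) \<partial>exp_measure q)"
          by (subst nn_integral_gaps_Cons)
            (auto simp: arrival_case_nat H_def arrival_case_nat[of _ _ 0, simplified] arrival_def[of _ 0]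
               nn_integral_cmult algebra_simps intro!: nn_integral_cong)
        also have "\<dots> = ennreal (exp (- (q * c))) * (\<integral>\<^sup>+x. H x \<partial>exp_measure q)"
          using q_pos True by (intro exp_measure_memoryless) (auto simp: c_def)
        finally show ?thesis using True by (simp add: c_def W_def algebra_simps)
      next
        case False
        then show ?thesis by (simp add: W_def)
      qed
    qed
    also have "\<dots> = (\<integral>\<^sup>+g. W (arrival g k) \<partial>S) * (\<integral>\<^sup>+x. H x \<partial>exp_measure q)"
      by (rule nn_integral_multc) measurable
    finally show ?thesis by (simp add: f_H)
  qed
  \<comment> \<open>The case f = 1 identifies the first factor as the probability of crossing,
    without any computation.\<close>
  have "emeasure S (crossing t k) = (\<integral>\<^sup>+g. W (arrival g k) \<partial>S)"
    using *[of "\<lambda>_. 1"] by (simp add: P.emeasure_space_1)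
  then show ?thesis using *[OF assms(1)] by simp
qed

end

section \<open>Thinning\<close>

lemma AE_pair_fst:
  assumes "prob_space N" "prob_space M" "AE x in N. P x"
  shows "AE z in N \<Otimes>\<^sub>M M. P (fst z)"
proof -
  interpret M: prob_space M by fact
  have "distr (N \<Otimes>\<^sub>M M) N fst = N" by (rule M.distr_pair_fst)
  with assms(3) have "AE x in distr (N \<Otimes>\<^sub>M M) N fst. P x" by (simp only:)
  then show ?thesis by (rule AE_distrD[OF measurable_fst])
qed

lemma AE_pair_snd:
  assumes "prob_space N" "prob_space M" "AE x in M. P x"
  shows "AE z in N \<Otimes>\<^sub>M M. P (snd z)"
proof -
  interpret N: prob_space N by fact
  interpret M: prob_space M by fact
  interpret pair_prob_space N M ..
  have "distr (N \<Otimes>\<^sub>M M) M snd = M"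
  proof (intro measure_eqI)
    fix A assume "A \<in> sets (distr (N \<Otimes>\<^sub>M M) M snd)"
    then have A[measurable]: "A \<in> sets M" by simp
    then have "emeasure (distr (N \<Otimes>\<^sub>M M) M snd) A = emeasure (N \<Otimes>\<^sub>M M) (space N \<times> A)"
      using sets.sets_into_space[OF A]
      by (auto simp: emeasure_distr space_pair_measure intro!: arg_cong2[where f=emeasure])
    then show "emeasure (distr (N \<Otimes>\<^sub>M M) M snd) A = emeasure M A"
      by (simp add: M.emeasure_pair_measure_Times N.emeasure_space_1)
  qed simp
  with assms(3) have "AE x in distr (N \<Otimes>\<^sub>M M) M snd. P x" by (simp only:)
  then show ?thesis by (rule AE_distrD[OF measurable_snd])
qed

lemma suminf_suminf_mult:
  fixes a b c :: "nat \<Rightarrow> ennreal"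
  shows "(\<Sum>k. \<Sum>j. a j * (b k * c j)) = (\<Sum>k. b k) * (\<Sum>j. a j * c j)"
proof -
  have "(\<Sum>j. a j * (b k * c j)) = b k * (\<Sum>j. a j * c j)" for k
    unfolding ennreal_suminf_cmult[symmetric] by (intro suminf_cong) (simp add: ac_simps)
  then show ?thesis by (simp add: ennreal_suminf_multc)
qed

lemma first_accepted_eq:
  assumes "regular_gaps g t" "0 \<le> t" "next_arrival g t = m" "\<And>i. i < j \<Longrightarrow> \<not> b (m + i)" "b (m + j)"
  shows "first_accepted g b t = m + j"
  unfolding first_accepted_def
proof (rule Least_equality)
  show "num_arrivals g t < m + j \<and> b (m + j)"
    using num_arrivals_eq[OF assms(1,2)] assms(3,5) by simp
  fix k assume "num_arrivals g t < k \<and> b k"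
  with num_arrivals_eq[OF assms(1,2)] assms(3) have "m \<le> k" "b k" by auto
  then obtain i where "k = m + i" "b (m + i)" by (auto simp: le_iff_add)
  then show "m + j \<le> k" using assms(4)[of i] by (intro leI notI) auto
qed

locale thinned_gaps = exponential_gaps +
  fixes s :: nat
  assumes s_gt_1: "1 < s"
begin

definition p :: real where "p = 1 / real s"

lemma p: "0 < p" "p < 1" using s_gt_1 by (simp_all add: p_def)

abbreviation coins :: "(nat \<Rightarrow> bool) measure" where
  "coins \<equiv> (\<Pi>\<^sub>M i\<in>(UNIV::nat set). measure_pmf (bernoulli_pmf p))"

lemma coin_space_eq: "coin_space s = coins"
  by (simp add: coin_space_def p_def)

sublocale C: sequence_space "measure_pmf (bernoulli_pmf p)"
  unfolding sequence_space_def
  by (intro product_prob_space.intro product_sigma_finite.intro product_prob_space_axioms.intro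
      measure_pmf.sigma_finite_measure_axioms measure_pmf.prob_space_axioms)

lemma prob_space_coins: "prob_space coins"
  by (rule C.P.prob_space_axioms)

lemma measurable_coin[measurable]: "(\<lambda>b. b i) \<in> measurable coins (count_space UNIV)"
proof -
  have "(\<lambda>b. b i) \<in> measurable coins (measure_pmf (bernoulli_pmf p))"
    by (rule measurable_component_singleton) simp
  then show ?thesis by simp
qed

definition waits :: "nat \<Rightarrow> nat \<Rightarrow> (nat \<Rightarrow> bool) set" where
  "waits m j = {b \<in> space coins. (\<forall>i<j. \<not> b (m + i)) \<and> b (m + j)}"

lemma sets_waits[measurable]: "waits m j \<in> sets coins"
  unfolding waits_def by measurable

lemma emeasure_waits: "emeasure coins (waits m j) = ennreal (p * (1 - p) ^ j)"
proof -
  define Y where "Y i = (if i = m + j then {True} else {False})" for i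
  have "waits m j = {b \<in> space coins. \<forall>i\<in>{m..m + j}. b i \<in> Y i}"
  proof -
    have "(\<forall>i<j. \<not> b (m + i)) \<longleftrightarrow> (\<forall>i\<in>{m..<m + j}. \<not> b i)" for b :: "nat \<Rightarrow> bool"
      by (metis add_diff_inverse_nat atLeastLessThan_iff le_add1 nat_add_left_cancel_less not_less)
    then show ?thesis unfolding waits_def Y_def by (auto simp: le_less)
  qed
  then have "emeasure coins (waits m j) =
      (\<Prod>i\<in>{m..m + j}. emeasure (measure_pmf (bernoulli_pmf p)) (Y i))"
    using C.emeasure_PiM_Collect[of "{m..m + j}" Y] by simp
  also have "\<dots> = (\<Prod>i\<in>insert (m + j) {m..<m + j}. ennreal (if i = m + j then p else 1 - p))"
    using p by (intro prod.cong) (auto simp: Y_def emeasure_pmf_single)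
  also have "\<dots> = ennreal p * (\<Prod>i\<in>{m..<m + j}. ennreal (1 - p))"
    by (subst prod.insert) (auto intro!: arg_cong2[where f="(*)"] prod.cong)
  also have "\<dots> = ennreal (p * (1 - p) ^ j)"
    using p by (simp add: ennreal_mult ennreal_power)
  finally show ?thesis .
qed

lemma suminf_waits: "(\<Sum>j. emeasure coins (waits m j)) = 1"
proof -
  have "(\<lambda>j. p * (1 - p) ^ j) sums (p * (1 / (1 - (1 - p))))"
    using p by (intro sums_mult geometric_sums) auto
  then have "(\<lambda>j. p * (1 - p) ^ j) sums 1" using p by simp
  then show ?thesis
    unfolding emeasure_waits using p by (subst suminf_ennreal_eq[where x = 1]) auto
qed

lemma waits_unique: "b \<in> waits m i \<Longrightarrow> b \<in> waits m j \<Longrightarrow> i = j"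
  unfolding waits_def by (metis (mono_tags, lifting) linorder_neqE_nat mem_Collect_eq)

text \<open>The geometric weights sum to 1 for each m, and there are only countably many m. This
  ensures that the least index in \<open>first_accepted\<close> exists; otherwise its value would be
  arbitrary.\<close>

lemma AE_waits: "AE b in coins. \<forall>m. \<exists>j. b \<in> waits m j"
  unfolding AE_all_countable
proof
  fix m
  have "disjoint_family (waits m)"
    by (auto simp: disjoint_family_on_def dest: waits_unique)
  then have "emeasure coins (\<Union>j. waits m j) = 1"
    using suminf_waits[of m] by (subst suminf_emeasure[symmetric]) auto
  then have "C.P.prob (\<Union>j. waits m j) = 1" by (simp add: measure_def)
  then show "AE b in coins. \<exists>j. b \<in> waits m j"
    using C.P.AE_in_set_eq_1[of "\<Union>j. waits m j"] by auto
qed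

text \<open>The outcome is split by the gap that straddles t and by the number j of rejections after
  it. Given the gap, j depends only on the coins, which are independent of the gaps, and its weight
  does not depend on k.\<close>

lemma nn_integral_first_accepted:
  assumes [measurable]: "\<And>n. \<Phi> n \<in> borel_measurable S" and "0 \<le> t"
  shows "(\<integral>\<^sup>+z. \<Phi> (first_accepted (fst z) (snd z) t) (fst z) \<partial>(S \<Otimes>\<^sub>M coins)) =
    (\<Sum>k. \<Sum>j. ennreal (p * (1 - p) ^ j) * (\<integral>\<^sup>+g. indicator (crossing t k) g * \<Phi> (Suc k + j) g \<partial>S))"
proof -
  let ?T = "\<lambda>k j z. indicator (waits (Suc k) j) (snd z) * (indicator (crossing t k) (fst z) * \<Phi> (Suc k + j) (fst z))"
  have "(\<integral>\<^sup>+z. \<Phi> (first_accepted (fst z) (snd z) t) (fst z) \<partial>(S \<Otimes>\<^sub>M coins)) =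
      (\<integral>\<^sup>+z. (\<Sum>k. \<Sum>j. ?T k j z) \<partial>(S \<Otimes>\<^sub>M coins))"
  proof (rule nn_integral_cong_AE)
    have "AE z in S \<Otimes>\<^sub>M coins. regular_gaps (fst z) t"
      by (intro AE_pair_fst P.prob_space_axioms prob_space_coins AE_regular_gaps assms)
    moreover have "AE z in S \<Otimes>\<^sub>M coins. \<forall>m. \<exists>j. snd z \<in> waits m j"
      by (intro AE_pair_snd P.prob_space_axioms prob_space_coins AE_waits)
    ultimately show "AE z in S \<Otimes>\<^sub>M coins. \<Phi> (first_accepted (fst z) (snd z) t) (fst z) = (\<Sum>k. \<Sum>j. ?T k j z)"
      using AE_space
    proof eventually_elim
      case (elim z)
      obtain g b where z: "z = (g, b)" by force
      have g: "regular_gaps g t" "g \<in> space S" using elim by (auto simp: z space_pair_measure)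
      define k where "k = next_arrival g t - 1"
      have k: "next_arrival g t = Suc k" using next_arrival_pos[OF g(1) assms(2)] by (simp add: k_def)
      obtain j where j: "b \<in> waits (Suc k) j" using elim by (auto simp: z)
      have fa: "first_accepted g b t = Suc k + j"
        using j by (intro first_accepted_eq[OF g(1) assms(2) k]) (auto simp: waits_def)
      have c: "g \<in> crossing t i \<longleftrightarrow> i = k" for i
        using crossing_iff_next_arrival[OF g(1) assms(2) g(2)] k by auto
      have w: "b \<in> waits (Suc k) i \<longleftrightarrow> i = j" for i using j waits_unique by blast
      have "(\<Sum>k. \<Sum>j. ?T k j z) = (\<Sum>i. if i = k then (\<Sum>l. ?T k l z) else 0)"
        by (intro suminf_cong) (simp add: z c indicator_def)
      also have "\<dots> = (\<Sum>l. ?T k l z)" by (subst suminf_finite[of "{k}"]) auto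
      also have "\<dots> = (\<Sum>l. if l = j then \<Phi> (Suc k + j) g else 0)"
        by (intro suminf_cong) (simp add: z c w indicator_def)
      also have "\<dots> = \<Phi> (Suc k + j) g" by (subst suminf_finite[of "{j}"]) auto
      finally show ?case using fa by (simp add: z)
    qed
  qed
  also have "\<dots> = (\<Sum>k. \<Sum>j. \<integral>\<^sup>+z. ?T k j z \<partial>(S \<Otimes>\<^sub>M coins))"
    by (simp add: nn_integral_suminf)
  also have "\<dots> = (\<Sum>k. \<Sum>j. ennreal (p * (1 - p) ^ j) * (\<integral>\<^sup>+g. indicator (crossing t k) g * \<Phi> (Suc k + j) g \<partial>S))"
  proof (intro suminf_cong)
    fix k j
    have "(\<integral>\<^sup>+z. ?T k j z \<partial>(S \<Otimes>\<^sub>M coins)) =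
        (\<integral>\<^sup>+g. (\<integral>\<^sup>+b. indicator (waits (Suc k) j) b * (indicator (crossing t k) g * \<Phi> (Suc k + j) g) \<partial>coins) \<partial>S)"
      by (subst C.P.nn_integral_fst[symmetric]) auto
    then show "(\<integral>\<^sup>+z. ?T k j z \<partial>(S \<Otimes>\<^sub>M coins)) =
        ennreal (p * (1 - p) ^ j) * (\<integral>\<^sup>+g. indicator (crossing t k) g * \<Phi> (Suc k + j) g \<partial>S)"
      by (simp add: nn_integral_multc nn_integral_cmult emeasure_waits)
  qed
  finally show ?thesis .
qed

text \<open>The overshoot is the memoryless remainder of one gap plus j further gaps, hence a sum of
  j + 1 exponentials with j geometric. The geometric mixture of Erlang densities collapses to an
  exponential one of rate p q = q / s.\<close>

lemma nn_integral_overshoot_thinned: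
  assumes [measurable]: "f \<in> borel_measurable borel" and "0 \<le> t"
  shows "(\<integral>\<^sup>+z. f (arrival (fst z) (first_accepted (fst z) (snd z) t) - t) \<partial>(S \<Otimes>\<^sub>M coins)) =
    (\<integral>\<^sup>+x. f x \<partial>exp_measure (q / real s))"
proof -
  have "(\<integral>\<^sup>+z. f (arrival (fst z) (first_accepted (fst z) (snd z) t) - t) \<partial>(S \<Otimes>\<^sub>M coins)) =
      (\<Sum>k. \<Sum>j. ennreal (p * (1 - p) ^ j) * (emeasure S (crossing t k) * (\<integral>\<^sup>+g. f (arrival g (Suc j)) \<partial>S)))"
    using nn_integral_first_accepted[of "\<lambda>n g. f (arrival g n - t)", OF _ assms(2)]
    by (simp add: nn_integral_crossing[OF assms] del: add_Suc)
  also have "\<dots> = (\<Sum>k. emeasure S (crossing t k)) *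
      (\<Sum>j. ennreal (p * (1 - p) ^ j) * (\<integral>\<^sup>+g. f (arrival g (Suc j)) \<partial>S))"
    by (rule suminf_suminf_mult)
  also have "\<dots> = (\<Sum>j. \<integral>\<^sup>+x. ennreal (p * (1 - p) ^ j) * (ennreal (erlang_density j q x) * f x) \<partial>lborel)"
    using assms(2) by (simp add: suminf_emeasure_crossing nn_integral_arrival nn_integral_cmult)
  also have "\<dots> = (\<integral>\<^sup>+x. (\<Sum>j. ennreal (p * (1 - p) ^ j) * (ennreal (erlang_density j q x) * f x)) \<partial>lborel)"
    by (rule nn_integral_suminf[symmetric]) auto
  also have "\<dots> = (\<integral>\<^sup>+x. ennreal (exponential_density (q / real s) x) * f x \<partial>lborel)"
  proof (intro nn_integral_cong)
    fix x
    have "(\<Sum>j. ennreal (p * (1 - p) ^ j) * (ennreal (erlang_density j q x) * f x)) =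
        (\<Sum>j. ennreal p * ennreal ((1 - p) ^ j * erlang_density j q x) * f x)"
      using p q_pos by (intro suminf_cong) (simp add: ennreal_mult erlang_density_nonneg ac_simps)
    also have "\<dots> = ennreal p * (\<Sum>j. ennreal ((1 - p) ^ j * erlang_density j q x)) * f x"
      by (simp add: ennreal_suminf_multc ennreal_suminf_cmult)
    also have "\<dots> = ennreal (exponential_density (q / real s) x) * f x"
    proof -
      have "exponential_density (q / real s) x = (if x < 0 then 0 else p * (q * exp (- (q * (1 - (1 - p)) * x))))"
        by (simp add: exponential_density_def p_def mult.commute)
      then have "ennreal (exponential_density (q / real s) x) =
          ennreal p * (\<Sum>j. ennreal ((1 - p) ^ j * erlang_density j q x))"
        using p q_pos suminf_erlang_density[OF q_pos, of "1 - p" x] by (simp only:) (simp add: ennreal_mult)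
      then show ?thesis by (simp only:)
    qed
    finally show "(\<Sum>j. ennreal (p * (1 - p) ^ j) * (ennreal (erlang_density j q x) * f x)) =
        ennreal (exponential_density (q / real s) x) * f x" .
  qed
  finally show ?thesis by (simp add: nn_integral_density)
qed

text \<open>The next arrival has mean index q t + 1, and the expected number of rejections is (1 -
  p) / p = s - 1.\<close>

lemma expected_first_accepted:
  assumes "0 \<le> t"
  shows "(\<integral>\<^sup>+z. of_nat (first_accepted (fst z) (snd z) t) \<partial>(S \<Otimes>\<^sub>M coins)) = ennreal (q * t + real s)"
proof -
  have A: "(\<Sum>k. of_nat (Suc k) * emeasure S (crossing t k)) = ennreal (q * t + 1)"
  proof -
    have "(\<Sum>k. of_nat (Suc k) * emeasure S (crossing t k)) =
        (\<integral>\<^sup>+g. (\<Sum>k. of_nat (Suc k) * indicator (crossing t k) g) \<partial>S)"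
      by (simp add: nn_integral_suminf nn_integral_cmult)
    also have "\<dots> = (\<integral>\<^sup>+g. of_nat (next_arrival g t) \<partial>S)"
    proof (rule nn_integral_cong_AE)
      show "AE g in S. (\<Sum>k. of_nat (Suc k) * indicator (crossing t k) g) = (of_nat (next_arrival g t) :: ennreal)"
        using AE_suminf_crossing[OF assms, of "\<lambda>k _. of_nat (Suc k)"] AE_regular_gaps[OF assms]
      proof eventually_elim
        case (elim g)
        have "Suc (next_arrival g t - 1) = next_arrival g t"
          using next_arrival_pos[OF elim(2) assms] by simp
        then show ?case using elim(1) by (simp only: mult.commute)
      qed
    qed
    finally show ?thesis using expected_next_arrival[OF assms] by simp
  qed
  have B: "(\<Sum>j. ennreal (p * (1 - p) ^ j) * of_nat j) = ennreal (real s - 1)"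
  proof -
    have "(\<lambda>j. p * ((1 - p) ^ j * of_nat j)) sums (p * ((1 - p) / (1 - (1 - p))\<^sup>2))"
      using p by (intro sums_mult geometric_sums_times_n) auto
    also have "p * ((1 - p) / (1 - (1 - p))\<^sup>2) = real s - 1"
      using s_gt_1 by (simp add: p_def field_simps power2_eq_square)
    finally have "(\<Sum>j. ennreal (p * ((1 - p) ^ j * of_nat j))) = ennreal (real s - 1)"
      using p by (subst suminf_ennreal_eq) auto
    moreover have "ennreal (p * ((1 - p) ^ j * of_nat j)) = ennreal (p * (1 - p) ^ j) * of_nat j" for j
      using p by (simp add: ennreal_mult' ennreal_of_nat_eq_real_of_nat mult.assoc)
    ultimately show ?thesis by simp
  qed
  have "(\<integral>\<^sup>+z. of_nat (first_accepted (fst z) (snd z) t) \<partial>(S \<Otimes>\<^sub>M coins)) =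
      (\<Sum>k. \<Sum>j. ennreal (p * (1 - p) ^ j) * (emeasure S (crossing t k) * of_nat (Suc k + j)))"
    using nn_integral_first_accepted[of "\<lambda>n g. of_nat n", OF _ assms]
    by (simp add: nn_integral_multc del: add_Suc of_nat_Suc of_nat_add)
  also have "\<dots> = (\<Sum>k. \<Sum>j. ennreal (p * (1 - p) ^ j) * (of_nat (Suc k) * emeasure S (crossing t k) * 1) +
      ennreal (p * (1 - p) ^ j) * (emeasure S (crossing t k) * of_nat j))"
    by (intro suminf_cong) (simp only: of_nat_add distrib_left distrib_right ac_simps mult_1_left mult_1_right)
  also have "\<dots> = (\<Sum>k. of_nat (Suc k) * emeasure S (crossing t k)) * (\<Sum>j. ennreal (p * (1 - p) ^ j) * 1) +
      (\<Sum>k. emeasure S (crossing t k)) * (\<Sum>j. ennreal (p * (1 - p) ^ j) * of_nat j)"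
    unfolding suminf_suminf_mult[symmetric] by (simp only: suminf_add[OF summableI summableI])
  also have "\<dots> = ennreal (q * t + 1) + ennreal (real s - 1)"
    using suminf_waits[of 0] assms by (simp add: A B suminf_emeasure_crossing emeasure_waits del: of_nat_Suc)
  also have "\<dots> = ennreal (q * t + real s)"
    using q_pos assms s_gt_1 by (subst ennreal_plus[symmetric]) auto
  finally show ?thesis .
qed

end

context exponential_gaps
begin

lemma nn_integral_overshoot:
  assumes [measurable]: "f \<in> borel_measurable borel" and "0 \<le> t"
  shows "(\<integral>\<^sup>+g. f (arrival g (next_arrival g t) - t) \<partial>S) = (\<integral>\<^sup>+x. f x \<partial>exp_measure q)"
proof -
  have "(\<integral>\<^sup>+g. f (arrival g (next_arrival g t) - t) \<partial>S) =
      (\<integral>\<^sup>+g. (\<Sum>k. indicator (crossing t k) g * f (arrival g (Suc k + 0) - t)) \<partial>S)"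
  proof (rule nn_integral_cong_AE)
    show "AE g in S. f (arrival g (next_arrival g t) - t) =
        (\<Sum>k. indicator (crossing t k) g * f (arrival g (Suc k + 0) - t))"
      using AE_suminf_crossing[OF assms(2), of "\<lambda>k g. f (arrival g (Suc k + 0) - t)"] AE_regular_gaps[OF assms(2)]
    proof eventually_elim
      case (elim g)
      have "Suc (next_arrival g t - 1) + 0 = next_arrival g t"
        using next_arrival_pos[OF elim(2) assms(2)] by simp
      then show ?case using elim(1) by (simp only:)
    qed
  qed
  also have "\<dots> = (\<Sum>k. emeasure S (crossing t k) * (\<integral>\<^sup>+g. f (arrival g (Suc 0)) \<partial>S))"
    by (subst nn_integral_suminf) (auto simp only: nn_integral_crossing[OF assms], measurable)
  also have "\<dots> = (\<integral>\<^sup>+x. f x \<partial>exp_measure q)"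
    using assms(2) nn_integral_arrival[OF assms(1), of 0]
    by (simp add: ennreal_suminf_multc suminf_emeasure_crossing nn_integral_density)
  finally show ?thesis .
qed

end

section \<open>Payoffs along a path\<close>

lemma (in prob_space) second_moment_shift:
  fixes Y :: "'a \<Rightarrow> real"
  assumes "integrable M Y" "integrable M (\<lambda>\<omega>. (Y \<omega>)\<^sup>2)"
  shows "integrable M (\<lambda>\<omega>. (Y \<omega> + k)\<^sup>2)" "expectation (\<lambda>\<omega>. (Y \<omega> + k)\<^sup>2) = variance Y + (expectation Y + k)\<^sup>2"
proof -
  have eq: "(Y \<omega> + k)\<^sup>2 = (Y \<omega>)\<^sup>2 + (2 * k * Y \<omega> + k\<^sup>2)" for \<omega>
    by (simp add: power2_sum)
  show "integrable M (\<lambda>\<omega>. (Y \<omega> + k)\<^sup>2)" unfolding eq using assms by simp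
  show "expectation (\<lambda>\<omega>. (Y \<omega> + k)\<^sup>2) = variance Y + (expectation Y + k)\<^sup>2"
    unfolding eq variance_eq[OF assms] using assms by (simp add: prob_space power2_sum)
qed

text \<open>The mean square distance from k is variance plus squared bias, so one bound controls
  both. As the hypothesis is a nonnegative integral, integrability is a conclusion. Applied with k =
  \<open>F (0, 0)\<close> to payoffs and with k = 0 to differences.\<close>

lemma (in prob_space) variance_le_second_moment:
  fixes Y :: "'a \<Rightarrow> real"
  assumes [measurable]: "Y \<in> borel_measurable M"
    and le: "(\<integral>\<^sup>+\<omega>. ennreal ((Y \<omega> - k)\<^sup>2) \<partial>M) \<le> ennreal B" and "0 \<le> B"
  shows "integrable M Y" "integrable M (\<lambda>\<omega>. (Y \<omega>)\<^sup>2)" "variance Y \<le> B" "(expectation Y - k)\<^sup>2 \<le> B"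
proof -
  define Z where "Z \<omega> = Y \<omega> - k" for \<omega>
  have [measurable]: "Z \<in> borel_measurable M" unfolding Z_def by measurable
  have Z2: "integrable M (\<lambda>\<omega>. (Z \<omega>)\<^sup>2)"
    using le by (intro integrableI_bounded) (auto simp: Z_def le_less_trans)
  have Z: "integrable M Z" by (rule square_integrable_imp_integrable[OF _ Z2]) simp
  have Y_eq: "Y = (\<lambda>\<omega>. Z \<omega> + k)" by (simp add: Z_def)
  show Y: "integrable M Y" unfolding Y_eq using Z by simp
  show Y2: "integrable M (\<lambda>\<omega>. (Y \<omega>)\<^sup>2)"
    unfolding Y_eq by (rule second_moment_shift[OF Z Z2])
  have "ennreal (expectation (\<lambda>\<omega>. (Z \<omega>)\<^sup>2)) \<le> ennreal B"
    using le nn_integral_eq_integral[OF Z2] by (simp add: Z_def)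
  then have "expectation (\<lambda>\<omega>. (Z \<omega>)\<^sup>2) \<le> B" using \<open>0 \<le> B\<close> by (simp add: ennreal_le_iff)
  moreover have "expectation (\<lambda>\<omega>. (Z \<omega>)\<^sup>2) = variance Y + (expectation Y - k)\<^sup>2"
    using second_moment_shift(2)[OF Y Y2, of "- k"] by (simp add: Z_def)
  ultimately show "variance Y \<le> B" "(expectation Y - k)\<^sup>2 \<le> B"
    using variance_positive[of Y] zero_le_power2[of "expectation Y - k"] by linarith+
qed

text \<open>The exact bias-variance decomposition for independent summands. The constant c is
  arbitrary in the induction because the value of the coordinate integrated last is absorbed into
  it.\<close>

lemma second_moment_sum_PiM:
  fixes h :: "'i \<Rightarrow> 'b \<Rightarrow> real"
  assumes "finite I" and prob: "\<And>i. prob_space (N i)"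
    and h: "\<And>i. i \<in> I \<Longrightarrow> integrable (N i) (h i)" "\<And>i. i \<in> I \<Longrightarrow> integrable (N i) (\<lambda>x. (h i x)\<^sup>2)"
  shows "(\<integral>\<^sup>+z. ennreal (((\<Sum>i\<in>I. h i (z i)) + c)\<^sup>2) \<partial>PiM I N) =
    ennreal ((\<Sum>i\<in>I. prob_space.variance (N i) (h i)) + ((\<Sum>i\<in>I. integral\<^sup>L (N i) (h i)) + c)\<^sup>2)"
  using assms(1) h
proof (induction I arbitrary: c)
  case empty
  interpret product_prob_space N "{}"
    by (intro product_prob_space.intro product_sigma_finite.intro product_prob_space_axioms.intro
        prob prob_space_imp_sigma_finite)
  show ?case by (simp add: PiM_empty nn_integral_count_space_finite)
next
  case (insert a I)
  interpret product_sigma_finite N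
    by (intro product_sigma_finite.intro prob_space_imp_sigma_finite prob)
  interpret Na: prob_space "N a" by (rule prob)
  define v where "v = (\<Sum>i\<in>I. prob_space.variance (N i) (h i))"
  define e where "e = (\<Sum>i\<in>I. integral\<^sup>L (N i) (h i))"
  have v: "0 \<le> v" unfolding v_def by (intro sum_nonneg prob_space.variance_positive prob)
  have hm: "(\<lambda>z. h i (z i)) \<in> borel_measurable (PiM (insert a I) N)" if "i \<in> insert a I" for i
    using insert.prems(1)[OF that] that
    by (intro measurable_compose[OF measurable_component_singleton]) auto
  have ha: "integrable (N a) (h a)" "integrable (N a) (\<lambda>x. (h a x)\<^sup>2)" using insert.prems by auto
  have "(\<integral>\<^sup>+z. ennreal (((\<Sum>i\<in>insert a I. h i (z i)) + c)\<^sup>2) \<partial>PiM (insert a I) N) =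
      (\<integral>\<^sup>+y. (\<integral>\<^sup>+x. ennreal (((\<Sum>i\<in>insert a I. h i ((x(a := y)) i)) + c)\<^sup>2) \<partial>PiM I N) \<partial>N a)"
    using hm by (intro product_nn_integral_insert_rev insert.hyps measurable_compose[OF _ measurable_ennreal]
      borel_measurable_power borel_measurable_add borel_measurable_sum) auto
  also have "\<dots> = (\<integral>\<^sup>+y. (\<integral>\<^sup>+x. ennreal (((\<Sum>i\<in>I. h i (x i)) + (h a y + c))\<^sup>2) \<partial>PiM I N) \<partial>N a)"
  proof (intro nn_integral_cong)
    fix x y
    have "(\<Sum>i\<in>insert a I. h i ((x(a := y)) i)) = h a y + (\<Sum>i\<in>I. h i (x i))"
      using insert.hyps by (auto intro!: sum.cong)
    then show "ennreal (((\<Sum>i\<in>insert a I. h i ((x(a := y)) i)) + c)\<^sup>2) =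
        ennreal (((\<Sum>i\<in>I. h i (x i)) + (h a y + c))\<^sup>2)" by (simp add: ac_simps)
  qed
  also have "\<dots> = (\<integral>\<^sup>+y. ennreal (v + (h a y + (e + c))\<^sup>2) \<partial>N a)"
  proof (intro nn_integral_cong)
    fix y
    show "(\<integral>\<^sup>+x. ennreal (((\<Sum>i\<in>I. h i (x i)) + (h a y + c))\<^sup>2) \<partial>PiM I N) = ennreal (v + (h a y + (e + c))\<^sup>2)"
      using insert.IH[of "h a y + c"] insert.prems by (simp add: v_def e_def add.left_commute)
  qed
  also have "\<dots> = ennreal (integral\<^sup>L (N a) (\<lambda>y. v + (h a y + (e + c))\<^sup>2))"
    using v Na.second_moment_shift(1)[OF ha] by (intro nn_integral_eq_integral) auto
  also have "integral\<^sup>L (N a) (\<lambda>y. v + (h a y + (e + c))\<^sup>2) =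
      v + (Na.variance (h a) + (Na.expectation (h a) + (e + c))\<^sup>2)"
    using Na.second_moment_shift[OF ha] by (simp add: Na.prob_space)
  finally show ?case
    using insert.hyps by (simp add: v_def e_def ac_simps)
qed

section \<open>Joint measurability of path, running maximum and payoff\<close>

context levy_process
begin

text \<open>Rounded up to a multiple of 1 / (n + 1), the time takes countably many values, and the
  path at the rounded time is measurable; right-continuity lets n tend to infinity. The truncation
  at 0 removes the meaningless negative times.\<close>

lemma measurable_X_pair: "(\<lambda>z. X (max 0 (snd z)) (fst z)) \<in> borel_measurable (M \<Otimes>\<^sub>M borel)"
proof -
  define u where "u n y = real (nat \<lceil>max 0 y * real (Suc n)\<rceil>) / real (Suc n)" for n and y :: real
  have u_eq: "u n y = of_int \<lceil>max 0 y * real (Suc n)\<rceil> / real (Suc n)" for n y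
  proof -
    have "0 \<le> max 0 y * real (Suc n)" by simp
    from ceiling_mono[OF this] have "0 \<le> \<lceil>max 0 y * real (Suc n)\<rceil>" by (simp only: ceiling_zero)
    then show ?thesis unfolding u_def by (simp only: of_nat_nat)
  qed
  have 1: "max 0 y \<le> u n y" for n y unfolding u_eq by (rule ceiling_approx)
  have u: "(\<lambda>n. u n y) \<longlonglongrightarrow> max 0 y" for y unfolding u_eq by (rule ceiling_approx)
  have m: "(\<lambda>z. X (u n (snd z)) (fst z)) \<in> borel_measurable (M \<Otimes>\<^sub>M borel)" for n
  proof -
    have "(\<lambda>z. X (real k / real (Suc n)) (fst z)) \<in> borel_measurable (M \<Otimes>\<^sub>M borel)" for k :: nat
      by (intro measurable_compose[OF measurable_fst measurable_X]) simp
    moreover have "(\<lambda>z. nat \<lceil>max 0 (snd z) * real (Suc n)\<rceil>) \<in> measurable (M \<Otimes>\<^sub>M (borel :: real measure)) (count_space UNIV)"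
      by measurable
    ultimately show ?thesis unfolding u_def
      by (rule measurable_compose_countable[where f = "\<lambda>k z. X (real k / real (Suc n)) (fst z)"])
  qed
  show ?thesis
  proof (rule borel_measurable_LIMSEQ_real[OF _ m])
    fix z assume "z \<in> space (M \<Otimes>\<^sub>M (borel :: real measure))"
    then have "fst z \<in> space M" by (auto simp: space_pair_measure)
    then show "(\<lambda>n. X (u n (snd z)) (fst z)) \<longlonglongrightarrow> X (max 0 (snd z)) (fst z)"
      by (intro cadlag_right_approx[OF cadlag_paths _ 1 u]) auto
  qed
qed

definition path_max :: "real \<Rightarrow> 'a \<Rightarrow> real" where
  "path_max u \<omega> = (SUP v\<in>{0..u}. X v \<omega>)"

lemma measurable_path_max_pair: "(\<lambda>z. path_max (max 0 (snd z)) (fst z)) \<in> borel_measurable (M \<Otimes>\<^sub>M borel)"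
proof -
  \<comment> \<open>For r \<ge> 0 the outer \<open>max 0\<close> changes nothing; it brings each
    term into the form for which joint measurability is known.\<close>
  have "(\<lambda>z. SUP r\<in>\<rat> \<inter> {0..}. X (max 0 (min r (max 0 (snd z)))) (fst z)) \<in> borel_measurable (M \<Otimes>\<^sub>M borel)"
  proof (rule borel_measurable_cSUP)
    show "countable (\<rat> \<inter> {0::real..})" by (simp add: countable_rat)
    fix r :: real
    have "(\<lambda>z. (fst z, min r (max 0 (snd z)))) \<in> measurable (M \<Otimes>\<^sub>M borel) (M \<Otimes>\<^sub>M borel)" by measurable
    from measurable_compose[OF this measurable_X_pair]
    show "(\<lambda>z. X (max 0 (min r (max 0 (snd z)))) (fst z)) \<in> borel_measurable (M \<Otimes>\<^sub>M borel)" by simp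
  next
    fix z assume "z \<in> space (M \<Otimes>\<^sub>M (borel :: real measure))"
    then have "cadlag (\<lambda>u. X u (fst z))" by (auto simp: space_pair_measure intro: cadlag_paths)
    from cadlag_bdd_above[OF this order_refl, of "max 0 (snd z)"]
    show "bdd_above ((\<lambda>r. X (max 0 (min r (max 0 (snd z)))) (fst z)) ` (\<rat> \<inter> {0..}))"
      by (rule bdd_above_mono) auto
  qed
  then show ?thesis
  proof (rule iffD1[OF measurable_cong, rotated])
    fix z assume "z \<in> space (M \<Otimes>\<^sub>M (borel :: real measure))"
    then have "cadlag (\<lambda>u. X u (fst z))" by (auto simp: space_pair_measure intro: cadlag_paths)
    then show "(SUP r\<in>\<rat> \<inter> {0..}. X (max 0 (min r (max 0 (snd z)))) (fst z)) = path_max (max 0 (snd z)) (fst z)"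
      unfolding path_max_def by (subst SUP_as_countable_SUP) (auto intro!: SUP_cong simp: max_absorb2)
  qed
qed

lemma path_max_nonneg: "\<omega> \<in> space M \<Longrightarrow> 0 \<le> u \<Longrightarrow> 0 \<le> path_max u \<omega>"
  using cadlag_le_SUP[OF cadlag_paths order_refl order_refl, of \<omega> u] start[of \<omega>] by (simp add: path_max_def)

definition payoff :: "(real \<times> real \<Rightarrow> real) \<Rightarrow> real \<Rightarrow> 'a \<Rightarrow> real" where
  "payoff F u \<omega> = F (X u \<omega>, path_max u \<omega>)"

text \<open>The truncation keeps the sample meaningful and measurable at every outcome, also on the
  null set where the random time may be negative.\<close>

abbreviation sampled :: "(real \<times> real \<Rightarrow> real) \<Rightarrow> ('b \<Rightarrow> real) \<Rightarrow> 'a \<times> 'b \<Rightarrow> real" where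
  "sampled F T z \<equiv> payoff F (max 0 (T (snd z))) (fst z)"

lemma measurable_payoff_pair:
  assumes F: "1-lipschitz_on (UNIV \<times> {0..}) F"
  shows "(\<lambda>z. payoff F (max 0 (snd z)) (fst z)) \<in> borel_measurable (M \<Otimes>\<^sub>M borel)"
proof -
  \<comment> \<open>Off the half-plane nothing is assumed about F, so it is replaced by a continuous
    extension, constant in the second argument below 0; as running maxima are nonnegative, the
    payoff does not change.\<close>
  have "continuous_on UNIV (\<lambda>p :: real \<times> real. F (fst p, max 0 (snd p)))"
    by (rule continuous_on_compose2[OF lipschitz_on_continuous_on[OF F]]) (auto intro!: continuous_intros)
  then have [measurable]: "(\<lambda>p. F (fst p, max 0 (snd p))) \<in> borel_measurable borel"
    by (rule borel_measurable_continuous_onI)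
  have "(\<lambda>z. F (X (max 0 (snd z)) (fst z), max 0 (path_max (max 0 (snd z)) (fst z)))) \<in> borel_measurable (M \<Otimes>\<^sub>M borel)"
    using measurable_compose[OF borel_measurable_Pair[OF measurable_X_pair measurable_path_max_pair], of "\<lambda>p. F (fst p, max 0 (snd p))" borel]
    by simp
  then show ?thesis
  proof (rule iffD1[OF measurable_cong, rotated])
    fix z assume "z \<in> space (M \<Otimes>\<^sub>M (borel :: real measure))"
    then have "0 \<le> path_max (max 0 (snd z)) (fst z)"
      by (intro path_max_nonneg) (auto simp: space_pair_measure)
    then show "F (X (max 0 (snd z)) (fst z), max 0 (path_max (max 0 (snd z)) (fst z))) = payoff F (max 0 (snd z)) (fst z)"
      by (simp add: payoff_def max_absorb2)
  qed
qed

lemma measurable_at_time: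
  assumes f: "(\<lambda>z. f (max 0 (snd z)) (fst z)) \<in> borel_measurable (M \<Otimes>\<^sub>M borel)" and "0 \<le> u"
  shows "f u \<in> borel_measurable M"
proof -
  have "(\<lambda>\<omega>. (\<omega>, u)) \<in> measurable M (M \<Otimes>\<^sub>M borel)" by measurable
  from measurable_compose[OF this f] show ?thesis using \<open>0 \<le> u\<close> by (simp add: max_absorb2)
qed

lemma payoff_0: "\<omega> \<in> space M \<Longrightarrow> payoff F 0 \<omega> = F (0, 0)"
  by (simp add: payoff_def path_max_def start)

lemma target_eq: "target M X t F = (LINT \<omega>|M. payoff F t \<omega>)"
  by (simp add: target_def payoff_def path_max_def)

lemma payoff_at_eq:
  assumes "\<omega> \<in> space M" "\<And>i. 0 \<le> g i" "1 \<le> k"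
  shows "payoff_at F (\<lambda>u. X u \<omega>) g k = payoff F (arrival g k) \<omega>"
  using walk_max_eq[OF cadlag_paths[OF assms(1)] start[OF assms(1)] assms(2,3)]
  by (simp add: payoff_at_def payoff_def path_max_def walk_eq start[OF assms(1)])

end

context l2_levy_process
begin

text \<open>The distance on pairs is Euclidean, so the squares add: 1 from the terminal value and 8
  from the running maximum.\<close>

lemma payoff_increment:
  assumes F: "1-lipschitz_on (UNIV \<times> {0..}) F" and ab: "0 \<le> a" "a \<le> b"
  shows "(\<integral>\<^sup>+\<omega>. ennreal ((payoff F b \<omega> - payoff F a \<omega>)\<^sup>2) \<partial>M) \<le> ennreal (9 * V (b - a))"
proof -
  have [measurable]: "path_max a \<in> borel_measurable M" "path_max b \<in> borel_measurable M"
    "X a \<in> borel_measurable M" "X b \<in> borel_measurable M"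
    using ab by (auto intro!: measurable_X measurable_at_time[OF measurable_path_max_pair])
  have "(\<integral>\<^sup>+\<omega>. ennreal ((payoff F b \<omega> - payoff F a \<omega>)\<^sup>2) \<partial>M) \<le>
      (\<integral>\<^sup>+\<omega>. ennreal ((X b \<omega> - X a \<omega>)\<^sup>2) + ennreal ((path_max b \<omega> - path_max a \<omega>)\<^sup>2) \<partial>M)"
  proof (intro nn_integral_mono)
    fix \<omega> assume \<omega>: "\<omega> \<in> space M"
    have "dist (payoff F b \<omega>) (payoff F a \<omega>) \<le> 1 * dist (X b \<omega>, path_max b \<omega>) (X a \<omega>, path_max a \<omega>)"
      unfolding payoff_def using ab \<omega>
      by (intro lipschitz_onD[OF F]) (auto intro!: path_max_nonneg)
    then have "\<bar>payoff F b \<omega> - payoff F a \<omega>\<bar> \<le> sqrt ((X b \<omega> - X a \<omega>)\<^sup>2 + (path_max b \<omega> - path_max a \<omega>)\<^sup>2)"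
      by (simp add: dist_Pair_Pair dist_real_def)
    then have "(payoff F b \<omega> - payoff F a \<omega>)\<^sup>2 \<le> (X b \<omega> - X a \<omega>)\<^sup>2 + (path_max b \<omega> - path_max a \<omega>)\<^sup>2"
      using power_mono[of "\<bar>payoff F b \<omega> - payoff F a \<omega>\<bar>" _ 2] by fastforce
    then show "ennreal ((payoff F b \<omega> - payoff F a \<omega>)\<^sup>2) \<le>
        ennreal ((X b \<omega> - X a \<omega>)\<^sup>2) + ennreal ((path_max b \<omega> - path_max a \<omega>)\<^sup>2)"
      by (simp flip: ennreal_plus)
  qed
  also have "\<dots> = (\<integral>\<^sup>+\<omega>. ennreal ((X b \<omega> - X a \<omega>)\<^sup>2) \<partial>M) +
      (\<integral>\<^sup>+\<omega>. ennreal ((path_max b \<omega> - path_max a \<omega>)\<^sup>2) \<partial>M)"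
    by (intro nn_integral_add) auto
  also have "(\<integral>\<^sup>+\<omega>. ennreal ((X b \<omega> - X a \<omega>)\<^sup>2) \<partial>M) = ennreal (V (b - a))"
    using increment_moments[OF ab] by (simp add: nn_integral_eq_integral)
  also have "(\<integral>\<^sup>+\<omega>. ennreal ((path_max b \<omega> - path_max a \<omega>)\<^sup>2) \<partial>M) \<le> ennreal (8 * V (b - a))"
  proof (rule order_trans[OF nn_integral_mono sup_increment_moment[OF ab]])
    fix \<omega> assume "\<omega> \<in> space M"
    then have "\<bar>path_max b \<omega> - path_max a \<omega>\<bar> \<le> (SUP u\<in>{a..b}. X u \<omega>) - X a \<omega>"
      unfolding path_max_def by (intro SUP_increment cadlag_paths ab)
    then show "ennreal ((path_max b \<omega> - path_max a \<omega>)\<^sup>2) \<le> ennreal (((SUP u\<in>{a..b}. X u \<omega>) - X a \<omega>)\<^sup>2)"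
      by (intro ennreal_leI) (simp add: abs_le_square_iff[symmetric])
  qed
  finally show ?thesis
    using V_nonneg[of "b - a"] ab by (simp flip: ennreal_plus add: add_left_mono)
qed

end

context l2_levy_process
begin

text \<open>A random time \<open>T\<close> on an auxiliary probability space \<open>Q\<close>, independent of the process.\<close>

lemma measurable_payoff_random_time:
  assumes "1-lipschitz_on (UNIV \<times> {0..}) F" and [measurable]: "T \<in> borel_measurable Q"
  shows "(\<lambda>z. sampled F T z) \<in> borel_measurable (M \<Otimes>\<^sub>M Q)"
proof -
  have "(\<lambda>z. (fst z, T (snd z))) \<in> measurable (M \<Otimes>\<^sub>M Q) (M \<Otimes>\<^sub>M borel)" by measurable
  from measurable_compose[OF this measurable_payoff_pair[OF assms(1)]] show ?thesis by simp
qed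

text \<open>Integrating over the path first freezes the two times and leaves a deterministic
  increment. By monotonicity of V the lag may be replaced by any upper bound D whose law is known,
  for instance an overshoot.\<close>

lemma payoff_random_increment:
  assumes F: "1-lipschitz_on (UNIV \<times> {0..}) F" and "prob_space Q"
    and [measurable]: "T \<in> borel_measurable Q" "T' \<in> borel_measurable Q"
    and T: "AE x in Q. 0 \<le> T x \<and> T x \<le> T' x \<and> T' x - T x \<le> D x"
  shows "(\<integral>\<^sup>+z. ennreal ((sampled F T' z - sampled F T z)\<^sup>2) \<partial>(M \<Otimes>\<^sub>M Q))
    \<le> (\<integral>\<^sup>+x. ennreal (9 * V (D x)) \<partial>Q)"
proof -
  interpret Q: prob_space Q by fact
  interpret pair_prob_space M Q ..
  note [measurable] = measurable_payoff_random_time[OF F]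
  have "(\<integral>\<^sup>+z. ennreal ((sampled F T' z - sampled F T z)\<^sup>2) \<partial>(M \<Otimes>\<^sub>M Q))
      = (\<integral>\<^sup>+x. (\<integral>\<^sup>+\<omega>. ennreal ((payoff F (max 0 (T' x)) \<omega> - payoff F (max 0 (T x)) \<omega>)\<^sup>2) \<partial>M) \<partial>Q)"
    by (subst nn_integral_snd[symmetric]) (auto simp: split_beta')
  also have "\<dots> \<le> (\<integral>\<^sup>+x. ennreal (9 * V (D x)) \<partial>Q)"
    using T
  proof (intro nn_integral_mono_AE, eventually_elim)
    case (elim x)
    then have "(\<integral>\<^sup>+\<omega>. ennreal ((payoff F (max 0 (T' x)) \<omega> - payoff F (max 0 (T x)) \<omega>)\<^sup>2) \<partial>M) \<le>
        ennreal (9 * V (T' x - T x))"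
      using payoff_increment[OF F, of "T x" "T' x"] by (simp add: max_absorb2)
    also have "\<dots> \<le> ennreal (9 * V (D x))"
      using elim by (intro ennreal_leI mult_left_mono V_mono) auto
    finally show ?case .
  qed
  finally show ?thesis .
qed

lemma nn_integral_V_exp:
  assumes "0 < q" "0 \<le> t"
  shows "(\<integral>\<^sup>+y. ennreal (9 * V (t + y)) \<partial>exp_measure q) =
    ennreal (9 * (\<rho> * (t + 1 / q) + \<mu>\<^sup>2 * (t\<^sup>2 + 2 * t / q + 2 / q\<^sup>2)))"
proof -
  have "(\<integral>\<^sup>+y. ennreal (9 * V (t + y)) \<partial>exp_measure q) =
      (\<integral>\<^sup>+y. ennreal (9 * V t) + (ennreal (9 * (\<rho> + 2 * \<mu>\<^sup>2 * t)) * ennreal (y ^ 1) +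
        ennreal (9 * \<mu>\<^sup>2) * ennreal (y ^ 2)) \<partial>exp_measure q)"
    using AE_exp_measure_nonneg
  proof (intro nn_integral_cong_AE, eventually_elim)
    case (elim y)
    have "9 * V (t + y) = 9 * V t + (9 * (\<rho> + 2 * \<mu>\<^sup>2 * t) * y ^ 1 + 9 * \<mu>\<^sup>2 * y ^ 2)"
      by (simp add: V_def power2_eq_square algebra_simps)
    moreover have "0 \<le> 9 * V t" "0 \<le> 9 * (\<rho> + 2 * \<mu>\<^sup>2 * t)" "0 \<le> 9 * \<mu>\<^sup>2"
      using V_nonneg \<rho>_nonneg assms by auto
    ultimately show ?case
      using elim by (simp only: ennreal_plus ennreal_mult' mult_nonneg_nonneg zero_le_power add_nonneg_nonneg)
  qed
  also have "\<dots> = ennreal (9 * V t) + (ennreal (9 * (\<rho> + 2 * \<mu>\<^sup>2 * t)) * ennreal (fact 1 / q ^ 1) +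
        ennreal (9 * \<mu>\<^sup>2) * ennreal (fact 2 / q ^ 2))"
    using exp_measure_moment[OF assms(1), of 1] exp_measure_moment[OF assms(1), of 2]
      prob_space.emeasure_space_1[OF prob_space_exponential_density[OF assms(1)]]
    by (simp add: nn_integral_add nn_integral_cmult del: power_one_right)
  also have "\<dots> = ennreal (9 * V t + (9 * (\<rho> + 2 * \<mu>\<^sup>2 * t) * (fact 1 / q ^ 1) + 9 * \<mu>\<^sup>2 * (fact 2 / q ^ 2)))"
  proof -
    have "0 \<le> 9 * V t" "0 \<le> 9 * (\<rho> + 2 * \<mu>\<^sup>2 * t)" "0 \<le> 9 * \<mu>\<^sup>2"
      "0 \<le> fact 1 / q ^ 1" "0 \<le> fact 2 / q ^ 2"
      using V_nonneg \<rho>_nonneg assms by auto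
    then show ?thesis
      by (simp only: ennreal_plus ennreal_mult' mult_nonneg_nonneg add_nonneg_nonneg)
  qed
  also have "9 * V t + (9 * (\<rho> + 2 * \<mu>\<^sup>2 * t) * (fact 1 / q ^ 1) + 9 * \<mu>\<^sup>2 * (fact 2 / q ^ 2)) =
      9 * (\<rho> * (t + 1 / q) + \<mu>\<^sup>2 * (t\<^sup>2 + 2 * t / q + 2 / q\<^sup>2))"
    by (simp add: V_def power2_eq_square algebra_simps)
  finally show ?thesis .
qed

text \<open>The overshoot has moments t / r and 2 t^2 / r^2, and r \<ge> 1. In the first bound the
  factor is at most 2 / r, giving 9 times 2. In the second the coefficient of the squared drift is
  at most 1 + 2 + 2, giving 9 times 5.\<close>

lemma V_exp_bounds:
  assumes "0 < t" "1 \<le> r" "q = r / t"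
  shows "(\<integral>\<^sup>+y. ennreal (9 * V y) \<partial>exp_measure q) \<le> ennreal (18 * V t / r)"
    and "(\<integral>\<^sup>+y. ennreal (9 * V (t + y)) \<partial>exp_measure q) \<le> ennreal (45 * V t)"
proof -
  have q: "0 < q" using assms by simp
  have r2: "r \<le> r * r" using assms by simp
  have i: "1 / q = t / r" "2 / q\<^sup>2 = 2 * t\<^sup>2 / (r * r)" "2 * t / q = 2 * t\<^sup>2 / r"
    using assms by (simp_all add: power2_eq_square)
  have m: "\<mu>\<^sup>2 * t\<^sup>2 / (r * r) \<le> \<mu>\<^sup>2 * t\<^sup>2 / r"
    using assms r2 by (intro divide_left_mono) auto
  have "x / r \<le> x" if "0 \<le> x" for x
    using mult_left_mono[OF assms(2) that] assms(2) by (simp add: pos_divide_le_eq)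
  then have mr: "\<mu>\<^sup>2 * t\<^sup>2 / r \<le> \<mu>\<^sup>2 * t\<^sup>2" "\<rho> * t / r \<le> \<rho> * t"
    using assms(1) \<rho>_nonneg by auto
  have nn: "0 \<le> \<mu>\<^sup>2 * t\<^sup>2" "0 \<le> \<rho> * t" "0 \<le> \<rho> * t / r" using assms \<rho>_nonneg by auto
  have "\<rho> * (0 + 1 / q) + \<mu>\<^sup>2 * (0\<^sup>2 + 2 * 0 / q + 2 / q\<^sup>2) = \<rho> * t / r + 2 * (\<mu>\<^sup>2 * t\<^sup>2 / (r * r))"
    unfolding i by (simp add: power2_eq_square algebra_simps)
  also have "\<dots> \<le> 2 * (V t / r)"
    using m nn by (simp add: V_def add_divide_distrib)
  finally show "(\<integral>\<^sup>+y. ennreal (9 * V y) \<partial>exp_measure q) \<le> ennreal (18 * V t / r)"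
    using nn_integral_V_exp[OF q, of 0] by (simp add: ennreal_leI)
  have "\<rho> * (t + 1 / q) + \<mu>\<^sup>2 * (t\<^sup>2 + 2 * t / q + 2 / q\<^sup>2) =
      \<rho> * t + \<rho> * t / r + (\<mu>\<^sup>2 * t\<^sup>2 + 2 * (\<mu>\<^sup>2 * t\<^sup>2 / r) + 2 * (\<mu>\<^sup>2 * t\<^sup>2 / (r * r)))"
    unfolding i by (simp add: power2_eq_square algebra_simps)
  also have "\<dots> \<le> 5 * V t"
  proof -
    have "a + b + (c + 2 * d + 2 * e) \<le> 5 * (a + c)"
      if "e \<le> d" "d \<le> c" "b \<le> a" "0 \<le> c" "0 \<le> a" for a b c d e :: real
      using that by simp
    from this[OF m mr nn(1,2)] show ?thesis unfolding V_def .
  qed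
  finally show "(\<integral>\<^sup>+y. ennreal (9 * V (t + y)) \<partial>exp_measure q) \<le> ennreal (45 * V t)"
    using nn_integral_V_exp[OF q, of t] assms(1) by (simp add: ennreal_leI)
qed

text \<open>The mean payoff at t plus an independent exponential time. As a function of the rate
  alone it forgets which clock produced the horizon, so that fine and coarse means on adjacent
  levels are literally the same term.\<close>

definition exp_mean :: "(real \<times> real \<Rightarrow> real) \<Rightarrow> real \<Rightarrow> real \<Rightarrow> real" where
  "exp_mean F t q = (LINT z|(M \<Otimes>\<^sub>M exp_measure q). payoff F (max 0 (t + snd z)) (fst z))"

lemma payoff_random_mean:
  assumes F: "1-lipschitz_on (UNIV \<times> {0..}) F" and "prob_space Q" "0 < q"
    and T[measurable]: "T \<in> borel_measurable Q"
    and law: "distr Q borel (\<lambda>x. T x - t) = exp_measure q"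
  shows "(LINT z|(M \<Otimes>\<^sub>M Q). sampled F T z) = exp_mean F t q"
proof -
  interpret Q: prob_space Q by fact
  interpret E: prob_space "exp_measure q" by (rule prob_space_exponential_density) fact
  have id: "distr M M (\<lambda>\<omega>. \<omega>) = M" by (rule distr_id)
  have "distr (M \<Otimes>\<^sub>M Q) (M \<Otimes>\<^sub>M borel) (\<lambda>(\<omega>, x). (\<omega>, T x - t)) = M \<Otimes>\<^sub>M exp_measure q"
    using pair_measure_distr[of "\<lambda>\<omega>. \<omega>" M M "\<lambda>x. T x - t" Q borel] E.sigma_finite_measure_axioms
    by (simp add: id law)
  then have "exp_mean F t q = (LINT z|distr (M \<Otimes>\<^sub>M Q) (M \<Otimes>\<^sub>M borel) (\<lambda>(\<omega>, x). (\<omega>, T x - t)). payoff F (max 0 (t + snd z)) (fst z))"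
    by (simp add: exp_mean_def)
  also have "\<dots> = (LINT z|(M \<Otimes>\<^sub>M Q). sampled F T z)"
    using measurable_payoff_random_time[OF F, of "\<lambda>x. t + x" borel]
    by (subst integral_distr) (auto simp: split_beta')
  finally show ?thesis by simp
qed

text \<open>The squared mean of a difference is at most its second moment, and the lag between the
  random horizon and t is the exponential overshoot itself.\<close>

lemma exp_mean_bias:
  assumes F: "1-lipschitz_on (UNIV \<times> {0..}) F" and "0 < t" "1 \<le> r" "q = r / t"
  shows "(exp_mean F t q - target M X t F)\<^sup>2 \<le> 18 * V t / r"
proof -
  have q: "0 < q" using assms by simp
  interpret E: prob_space "exp_measure q" by (rule prob_space_exponential_density[OF q])
  interpret P: pair_prob_space M "exp_measure q" ..
  let ?Y = "\<lambda>z. payoff F (max 0 (t + snd z)) (fst z)" and ?Z = "\<lambda>z. payoff F (max 0 t) (fst z)"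
  have Y[measurable]: "?Y \<in> borel_measurable (M \<Otimes>\<^sub>M exp_measure q)"
    by (rule measurable_payoff_random_time[OF F]) simp
  have Z[measurable]: "?Z \<in> borel_measurable (M \<Otimes>\<^sub>M exp_measure q)"
    by (rule measurable_payoff_random_time[OF F, of "\<lambda>_. t"]) simp
  have le: "0 \<le> 18 * V t / r" using V_nonneg assms by simp
  have "(\<integral>\<^sup>+z. ennreal ((?Y z - ?Z z)\<^sup>2) \<partial>(M \<Otimes>\<^sub>M exp_measure q)) \<le> (\<integral>\<^sup>+y. ennreal (9 * V y) \<partial>exp_measure q)"
    using AE_exp_measure_nonneg[of q] assms(2) E.prob_space_axioms
    by (intro payoff_random_increment[OF F]) auto
  also have "\<dots> \<le> ennreal (18 * V t / r)"
    by (rule V_exp_bounds[OF assms(2-4)])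
  finally have YZ: "(\<integral>\<^sup>+z. ennreal ((?Y z - ?Z z - 0)\<^sup>2) \<partial>(M \<Otimes>\<^sub>M exp_measure q)) \<le> ennreal (18 * V t / r)"
    by simp
  have "(\<lambda>z. ?Y z - ?Z z) \<in> borel_measurable (M \<Otimes>\<^sub>M exp_measure q)" by measurable
  note D = P.variance_le_second_moment[OF this YZ le]
  have "(\<integral>\<^sup>+\<omega>. ennreal ((payoff F t \<omega> - payoff F 0 \<omega>)\<^sup>2) \<partial>M) \<le> ennreal (9 * V t)"
    using payoff_increment[OF F, of 0 t] assms(2) by simp
  also have "(\<integral>\<^sup>+\<omega>. ennreal ((payoff F t \<omega> - payoff F 0 \<omega>)\<^sup>2) \<partial>M) = (\<integral>\<^sup>+\<omega>. ennreal ((payoff F t \<omega> - F (0,0))\<^sup>2) \<partial>M)"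
    by (intro nn_integral_cong) (simp add: payoff_0)
  \<comment> \<open>Integrability is needed to write the difference of the two means as the mean of
    the difference; it holds because the payoff at t is square-integrably close to the constant
    payoff at time 0.\<close>
  finally have pt: "integrable M (payoff F t)"
    using V_nonneg[of t] assms(2)
    by (intro variance_le_second_moment(1)[of _ "F (0,0)" "9 * V t"] measurable_at_time[OF measurable_payoff_pair[OF F]]) auto
  have d: "distr (M \<Otimes>\<^sub>M exp_measure q) M fst = M" by (rule E.distr_pair_fst)
  have pm: "payoff F t \<in> borel_measurable M" using pt by auto
  have "integrable (distr (M \<Otimes>\<^sub>M exp_measure q) M fst) (payoff F t)" using pt d by simp
  then have Zi: "integrable (M \<Otimes>\<^sub>M exp_measure q) ?Z"
    using pm assms(2) by (subst (asm) integrable_distr_eq) (auto simp: max_absorb2)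
  have "target M X t F = (LINT \<omega>|distr (M \<Otimes>\<^sub>M exp_measure q) M fst. payoff F t \<omega>)"
    by (simp add: target_eq d)
  also have "\<dots> = (LINT z|(M \<Otimes>\<^sub>M exp_measure q). ?Z z)"
    using pm assms(2) by (subst integral_distr) (auto simp: max_absorb2)
  finally have "exp_mean F t q - target M X t F = (LINT z|(M \<Otimes>\<^sub>M exp_measure q). ?Y z - ?Z z)"
    using Bochner_Integration.integrable_add[OF D(1) Zi] Zi unfolding exp_mean_def
    by (subst Bochner_Integration.integral_diff) auto
  then show ?thesis using D(4) by simp
qed

lemma random_time_law_nonneg:
  assumes [measurable]: "T \<in> borel_measurable Q" and law: "distr Q borel (\<lambda>x. T x - t) = exp_measure q"
  shows "AE x in Q. t \<le> T x"
proof -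
  have "AE y in distr Q borel (\<lambda>x. T x - t). 0 \<le> y" unfolding law by (rule AE_exp_measure_nonneg)
  then have "AE x in Q. 0 \<le> T x - t" by (rule AE_distrD[rotated]) simp
  then show ?thesis by simp
qed

lemma nn_integral_V_random_time:
  assumes [measurable]: "T \<in> borel_measurable Q" and law: "distr Q borel (\<lambda>x. T x - t) = exp_measure q"
  shows "(\<integral>\<^sup>+x. ennreal (9 * V (c + (T x - t))) \<partial>Q) = (\<integral>\<^sup>+y. ennreal (9 * V (c + y)) \<partial>exp_measure q)"
  unfolding law[symmetric] V_def by (subst nn_integral_distr) auto

text \<open>Since the process starts at 0, the constant \<open>F (0, 0)\<close> is the payoff at
  time 0, and the claim is about an increment whose lag is the whole horizon, t plus the
  overshoot.\<close>

lemma payoff_random_variance: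
  assumes F: "1-lipschitz_on (UNIV \<times> {0..}) F" and Q: "prob_space Q" and t: "0 < t" "1 \<le> r" "q = r / t"
    and T[measurable]: "T \<in> borel_measurable Q"
    and law: "distr Q borel (\<lambda>x. T x - t) = exp_measure q"
  shows "(\<integral>\<^sup>+z. ennreal ((sampled F T z - F (0, 0))\<^sup>2) \<partial>(M \<Otimes>\<^sub>M Q)) \<le> ennreal (45 * V t)"
proof -
  have "(\<integral>\<^sup>+z. ennreal ((sampled F T z - F (0, 0))\<^sup>2) \<partial>(M \<Otimes>\<^sub>M Q)) =
      (\<integral>\<^sup>+z. ennreal ((sampled F T z - payoff F (max 0 0) (fst z))\<^sup>2) \<partial>(M \<Otimes>\<^sub>M Q))"
    by (intro nn_integral_cong) (auto simp: space_pair_measure payoff_0)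
  also have "\<dots> \<le> (\<integral>\<^sup>+x. ennreal (9 * V (t + (T x - t))) \<partial>Q)"
  proof (rule payoff_random_increment[OF F Q _ T])
    show "AE x in Q. 0 \<le> (0::real) \<and> 0 \<le> T x \<and> T x - 0 \<le> t + (T x - t)"
      using random_time_law_nonneg[OF T law] by eventually_elim (use t(1) in auto)
  qed simp
  also have "\<dots> = (\<integral>\<^sup>+y. ennreal (9 * V (t + y)) \<partial>exp_measure q)"
    by (rule nn_integral_V_random_time[OF T law])
  also have "\<dots> \<le> ennreal (45 * V t)" by (rule V_exp_bounds[OF t])
  finally show ?thesis .
qed

text \<open>Both times lie beyond t, so their lag is at most the overshoot of the later one. Only
  the law of the coarse time enters, not the joint law.\<close>

lemma payoff_random_difference_variance:
  assumes F: "1-lipschitz_on (UNIV \<times> {0..}) F" and Q: "prob_space Q" and t: "0 < t" "1 \<le> r" "q = r / t"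
    and T: "T \<in> borel_measurable Q" "T' \<in> borel_measurable Q"
    and le: "AE x in Q. t \<le> T x \<and> T x \<le> T' x"
    and law: "distr Q borel (\<lambda>x. T' x - t) = exp_measure q"
  shows "(\<integral>\<^sup>+z. ennreal ((sampled F T z - sampled F T' z)\<^sup>2) \<partial>(M \<Otimes>\<^sub>M Q))
    \<le> ennreal (18 * V t / r)"
proof -
  have "(\<integral>\<^sup>+z. ennreal ((sampled F T' z - sampled F T z)\<^sup>2) \<partial>(M \<Otimes>\<^sub>M Q))
      \<le> (\<integral>\<^sup>+x. ennreal (9 * V (0 + (T' x - t))) \<partial>Q)"
  proof (rule payoff_random_increment[OF F Q T])
    show "AE x in Q. 0 \<le> T x \<and> T x \<le> T' x \<and> T' x - T x \<le> 0 + (T' x - t)"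
      using le by eventually_elim (use t(1) in auto)
  qed
  also have "\<dots> = (\<integral>\<^sup>+y. ennreal (9 * V (0 + y)) \<partial>exp_measure q)"
    by (rule nn_integral_V_random_time[OF T(2) law])
  also have "\<dots> \<le> ennreal (18 * V t / r)" using V_exp_bounds(1)[OF t] by simp
  finally show ?thesis by (simp add: power2_commute)
qed

end

section \<open>Laws of the fine and the coarse horizon\<close>

lemma distr_eq_nn_integralI:
  assumes [measurable]: "Y \<in> borel_measurable Q" and "sets E = sets borel"
    and "\<And>f. f \<in> borel_measurable borel \<Longrightarrow> (\<integral>\<^sup>+x. f (Y x) \<partial>Q) = (\<integral>\<^sup>+y. f y \<partial>E)"
  shows "distr Q borel Y = E"
proof (rule measure_eqI)
  fix A assume "A \<in> sets (distr Q borel Y)"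
  then have A[measurable]: "A \<in> sets borel" by simp
  have "emeasure (distr Q borel Y) A = (\<integral>\<^sup>+x. indicator A x \<partial>distr Q borel Y)"
    by simp
  also have "\<dots> = (\<integral>\<^sup>+y. indicator A y \<partial>E)"
    using assms(3)[of "indicator A"] by (subst nn_integral_distr) auto
  also have "\<dots> = emeasure E A"
    using A assms(2) by (intro nn_integral_indicator) simp
  finally show "emeasure (distr Q borel Y) A = emeasure E A" .
qed (simp add: assms)

context exponential_gaps
begin

definition next_time :: "real \<Rightarrow> (nat \<Rightarrow> real) \<Rightarrow> real" where
  "next_time t g = arrival g (next_arrival g t)"

lemma measurable_next_time[measurable]: "next_time t \<in> borel_measurable S"
  unfolding next_time_def[abs_def]
  by (rule measurable_compose_countable[where f = "\<lambda>k g. arrival g k"]) measurable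

lemma next_time_law:
  assumes "0 \<le> t"
  shows "distr S borel (\<lambda>g. next_time t g - t) = exp_measure q"
  using nn_integral_overshoot[OF _ assms]
  by (intro distr_eq_nn_integralI) (auto simp: next_time_def[symmetric])

end

context thinned_gaps
begin

text \<open>Built on \<open>next_arrival\<close> instead of the arrival count, so that measurability
  is immediate; almost surely equal to \<open>first_accepted\<close>.\<close>

definition accepted_index :: "real \<Rightarrow> (nat \<Rightarrow> real) \<times> (nat \<Rightarrow> bool) \<Rightarrow> nat" where
  "accepted_index t z = (LEAST k. next_arrival (fst z) t \<le> k \<and> snd z k)"

definition accepted_time :: "real \<Rightarrow> (nat \<Rightarrow> real) \<times> (nat \<Rightarrow> bool) \<Rightarrow> real" where
  "accepted_time t z = arrival (fst z) (accepted_index t z)"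

lemma measurable_accepted_index[measurable]: "accepted_index t \<in> measurable (S \<Otimes>\<^sub>M coins) (count_space UNIV)"
  unfolding accepted_index_def[abs_def] by measurable

lemma measurable_accepted_time[measurable]: "accepted_time t \<in> borel_measurable (S \<Otimes>\<^sub>M coins)"
  unfolding accepted_time_def[abs_def]
  by (rule measurable_compose_countable[where f = "\<lambda>k z. arrival (fst z) k"]) measurable

definition regular_sample :: "real \<Rightarrow> (nat \<Rightarrow> real) \<times> (nat \<Rightarrow> bool) \<Rightarrow> bool" where
  "regular_sample t z \<longleftrightarrow> regular_gaps (fst z) t \<and> first_accepted (fst z) (snd z) t = accepted_index t z \<and>
    t \<le> next_time t (fst z) \<and> next_time t (fst z) \<le> accepted_time t z \<and>
    1 \<le> next_arrival (fst z) t \<and> next_arrival (fst z) t \<le> accepted_index t z"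

lemma AE_regular_sample:
  assumes "0 \<le> t"
  shows "AE z in S \<Otimes>\<^sub>M coins. regular_sample t z"
proof -
  have "AE z in S \<Otimes>\<^sub>M coins. regular_gaps (fst z) t"
    by (intro AE_pair_fst P.prob_space_axioms prob_space_coins AE_regular_gaps assms)
  moreover have "AE z in S \<Otimes>\<^sub>M coins. \<forall>m. \<exists>j. snd z \<in> waits m j"
    by (intro AE_pair_snd P.prob_space_axioms prob_space_coins AE_waits)
  ultimately show ?thesis
  proof eventually_elim
    case (elim z)
    note n = num_arrivals_eq[OF elim(1) assms]
    have fa: "first_accepted (fst z) (snd z) t = accepted_index t z"
      unfolding first_accepted_def accepted_index_def using n by (metis Suc_eq_plus1 less_eq_Suc_le)
    obtain j where "snd z \<in> waits (next_arrival (fst z) t) j" using elim(2) by blast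
    then have "next_arrival (fst z) t \<le> next_arrival (fst z) t + j \<and> snd z (next_arrival (fst z) t + j)"
      by (simp add: waits_def)
    then have le: "next_arrival (fst z) t \<le> accepted_index t z"
      unfolding accepted_index_def by (rule LeastI2) simp
    have "t < next_time t (fst z)"
      unfolding next_time_def using less_arrival_iff[OF elim(1) assms] by simp
    moreover have "next_time t (fst z) \<le> accepted_time t z"
      unfolding next_time_def accepted_time_def using elim(1) le
      by (intro arrival_mono) (auto simp: regular_gaps_def)
    ultimately show ?case
      using elim(1) fa le next_arrival_pos[OF elim(1) assms] by (auto simp: regular_sample_def)
  qed
qed

lemma accepted_time_law:
  assumes "0 \<le> t"
  shows "distr (S \<Otimes>\<^sub>M coins) borel (\<lambda>z. accepted_time t z - t) = exp_measure (q / real s)"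
proof (rule distr_eq_nn_integralI)
  fix f :: "real \<Rightarrow> ennreal" assume f: "f \<in> borel_measurable borel"
  have "(\<integral>\<^sup>+z. f (accepted_time t z - t) \<partial>(S \<Otimes>\<^sub>M coins)) =
      (\<integral>\<^sup>+z. f (arrival (fst z) (first_accepted (fst z) (snd z) t) - t) \<partial>(S \<Otimes>\<^sub>M coins))"
    using AE_regular_sample[OF assms]
    by (intro nn_integral_cong_AE) (auto simp: regular_sample_def accepted_time_def)
  then show "(\<integral>\<^sup>+z. f (accepted_time t z - t) \<partial>(S \<Otimes>\<^sub>M coins)) = (\<integral>\<^sup>+y. f y \<partial>exp_measure (q / real s))"
    by (simp add: nn_integral_overshoot_thinned[OF f assms])
qed simp_all

lemma next_time_law_thinned:
  assumes "0 \<le> t"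
  shows "distr (S \<Otimes>\<^sub>M coins) borel (\<lambda>z. next_time t (fst z) - t) = exp_measure q"
proof -
  have "distr (S \<Otimes>\<^sub>M coins) S fst = S"
    by (rule prob_space.distr_pair_fst[OF prob_space_coins])
  then have "distr S borel (\<lambda>g. next_time t g - t) = distr (distr (S \<Otimes>\<^sub>M coins) S fst) borel (\<lambda>g. next_time t g - t)"
    by (simp only:)
  also have "\<dots> = distr (S \<Otimes>\<^sub>M coins) borel (\<lambda>z. next_time t (fst z) - t)"
    by (subst distr_distr) (auto simp: comp_def)
  finally show ?thesis by (simp add: next_time_law[OF assms])
qed

lemma expected_accepted_index:
  assumes "0 \<le> t"
  shows "(\<integral>\<^sup>+z. of_nat (accepted_index t z) \<partial>(S \<Otimes>\<^sub>M coins)) = ennreal (q * t + real s)"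
proof -
  have "(\<integral>\<^sup>+z. of_nat (accepted_index t z) \<partial>(S \<Otimes>\<^sub>M coins)) =
      (\<integral>\<^sup>+z. of_nat (first_accepted (fst z) (snd z) t) \<partial>(S \<Otimes>\<^sub>M coins))"
    using AE_regular_sample[OF assms] by (intro nn_integral_cong_AE) (auto simp: regular_sample_def)
  then show ?thesis by (simp add: expected_first_accepted[OF assms])
qed

lemma prob_space_gaps_coins: "prob_space (S \<Otimes>\<^sub>M coins)"
  by (intro prob_space_pair P.prob_space_axioms prob_space_coins)

end

lemma (in levy_process) prob_space_M: "prob_space M"
  by (rule prob_space_axioms)

lemma (in levy_process) prob_space_thinned_space:
  assumes "0 < q" "1 < s"
  shows "prob_space (thinned_space M q s)"
proof -
  interpret thinned_gaps q s by unfold_locales (use assms in auto)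
  show ?thesis
    unfolding thinned_space_def gap_space_eq coin_space_eq
    by (intro prob_space_pair prob_space_M prob_space_gaps_coins)
qed

lemma (in levy_process) prob_space_path_space:
  assumes "0 < q"
  shows "prob_space (path_space M q)"
proof -
  interpret exponential_gaps q by unfold_locales (use assms in auto)
  show ?thesis
    unfolding path_space_def gap_space_eq
    by (intro prob_space_pair prob_space_M P.prob_space_axioms)
qed

lemma level_rate_pos: "0 < t \<Longrightarrow> 1 \<le> n0 \<Longrightarrow> 1 < s \<Longrightarrow> 0 < level_rate t s n0 l"
  by (simp add: level_rate_def)

section \<open>Measurable versions of single samples, with means and variances\<close>

context l2_levy_process
begin

text \<open>Y is the payoff of the path at the first arrival after t, measurable by construction;
  the simulated walk agrees with it on regular gaps.\<close>

lemma path_sample: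
  assumes F: "1-lipschitz_on (UNIV \<times> {0..}) F" and t: "0 < t" and n: "1 \<le> n"
  obtains Y where
    "AE z in path_space M (real n / t). payoff_at F (\<lambda>u. X u (fst z)) (snd z) (num_arrivals (snd z) t + 1) = Y z"
    "integrable (path_space M (real n / t)) Y" "integrable (path_space M (real n / t)) (\<lambda>z. (Y z)\<^sup>2)"
    "prob_space.variance (path_space M (real n / t)) Y \<le> 45 * V t"
    "integral\<^sup>L (path_space M (real n / t)) Y = exp_mean F t (real n / t)"
proof -
  define q where "q = real n / t"
  have q: "0 < q" "1 \<le> real n" using t n by (auto simp: q_def)
  interpret exponential_gaps q by unfold_locales (rule q)
  have N: "path_space M q = M \<Otimes>\<^sub>M S" by (simp add: path_space_def gap_space_eq)
  interpret N: prob_space "M \<Otimes>\<^sub>M S" unfolding N[symmetric] by (rule prob_space_path_space[OF q(1)])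
  define Y where "Y z = payoff F (max 0 (next_time t (snd z))) (fst z)" for z :: "'a \<times> (nat \<Rightarrow> real)"
  have m: "Y \<in> borel_measurable (M \<Otimes>\<^sub>M S)"
    unfolding Y_def[abs_def] by (rule measurable_payoff_random_time[OF F measurable_next_time])
  note law = next_time_law[OF less_imp_le[OF t]]
  note v = N.variance_le_second_moment[OF m, of "F (0,0)" "45 * V t", unfolded Y_def,
    OF payoff_random_variance[OF F P.prob_space_axioms t q(2) q_def measurable_next_time law]]
  have "AE z in M \<Otimes>\<^sub>M S. regular_gaps (snd z) t"
    using AE_regular_gaps[of t] t by (intro AE_pair_snd prob_space_M P.prob_space_axioms) auto
  then have "AE z in M \<Otimes>\<^sub>M S. payoff_at F (\<lambda>u. X u (fst z)) (snd z) (num_arrivals (snd z) t + 1) = Y z"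
    using AE_space
  proof eventually_elim
    case (elim z)
    have g: "0 \<le> snd z i" for i using elim(1) by (simp add: regular_gaps_def)
    have "fst z \<in> space M" using elim(2) by (auto simp: space_pair_measure)
    then have "payoff_at F (\<lambda>u. X u (fst z)) (snd z) (num_arrivals (snd z) t + 1) =
        payoff F (arrival (snd z) (num_arrivals (snd z) t + 1)) (fst z)"
      by (rule payoff_at_eq) (use g in auto)
    also have n: "num_arrivals (snd z) t + 1 = next_arrival (snd z) t"
      using t by (intro num_arrivals_eq elim(1)) simp
    also have "payoff F (arrival (snd z) (next_arrival (snd z) t)) (fst z) = Y z"
      using arrival_nonneg[of "snd z"] g by (simp add: Y_def next_time_def max_absorb2)
    finally show ?case unfolding n .
  qed
  note AE = this
  have e: "integral\<^sup>L (M \<Otimes>\<^sub>M S) Y = exp_mean F t q"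
    unfolding Y_def[abs_def] by (rule payoff_random_mean[OF F P.prob_space_axioms q(1) measurable_next_time law])
  have "0 \<le> 45 * V t" using V_nonneg t by simp
  note v = v[OF this, folded Y_def]
  show ?thesis
    by (rule that[of Y]; unfold q_def[symmetric] N) (rule AE v(1-3) e)+
qed

text \<open>Packed into one predicate so that the axiom of choice can select a version on every
  level at once. The factor s in the variance bound expresses that a difference is governed by the
  coarser rate, one power of s below its own level.\<close>

definition level_model :: "(real \<times> real \<Rightarrow> real) \<Rightarrow> real \<Rightarrow> nat \<Rightarrow> nat \<Rightarrow> nat \<Rightarrow>
    ('a \<times> (nat \<Rightarrow> real) \<times> (nat \<Rightarrow> bool) \<Rightarrow> real) \<Rightarrow> bool" where
  "level_model F t s n0 l Y \<longleftrightarrow> (let N = thinned_space M (level_rate t s n0 l) s in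
     (AE z in N. level_sample X t F l z = Y z) \<and> integrable N Y \<and> integrable N (\<lambda>z. (Y z)\<^sup>2) \<and>
     prob_space.variance N Y \<le> 45 * real s * V t / real s ^ l \<and>
     integral\<^sup>L N Y = exp_mean F t (level_rate t s n0 l) -
       (if l = 0 then 0 else exp_mean F t (level_rate t s n0 (l - 1))))"

lemma level_model_exists:
  fixes n0 s l :: nat
  assumes F: "1-lipschitz_on (UNIV \<times> {0..}) F" and t: "0 < t" and n: "1 \<le> n0" and s: "1 < s"
  shows "\<exists>Y. level_model F t s n0 l Y"
proof -
  define q where "q = level_rate t s n0 l"
  have q: "0 < q" unfolding q_def by (rule level_rate_pos[OF t n s])
  interpret thinned_gaps q s by unfold_locales (use q s in auto)
  let ?Q = "S \<Otimes>\<^sub>M coins"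
  have N: "thinned_space M q s = M \<Otimes>\<^sub>M ?Q" unfolding thinned_space_def by (simp add: gap_space_eq coin_space_eq)
  have Q: "prob_space ?Q" by (rule prob_space_gaps_coins)
  interpret N: prob_space "M \<Otimes>\<^sub>M ?Q" by (intro prob_space_pair prob_space_M Q)
  define Y1 where "Y1 z = payoff F (max 0 (next_time t (fst (snd z)))) (fst z)" for z :: "'a \<times> (nat \<Rightarrow> real) \<times> (nat \<Rightarrow> bool)"
  define Y2 where "Y2 z = payoff F (max 0 (accepted_time t (snd z))) (fst z)" for z :: "'a \<times> (nat \<Rightarrow> real) \<times> (nat \<Rightarrow> bool)"
  have T1: "(\<lambda>z. next_time t (fst z)) \<in> borel_measurable ?Q" by measurable
  have m1[measurable]: "Y1 \<in> borel_measurable (M \<Otimes>\<^sub>M ?Q)"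
    unfolding Y1_def[abs_def] by (rule measurable_payoff_random_time[OF F T1])
  have m2[measurable]: "Y2 \<in> borel_measurable (M \<Otimes>\<^sub>M ?Q)"
    unfolding Y2_def[abs_def] by (rule measurable_payoff_random_time[OF F measurable_accepted_time])
  have t0: "0 \<le> t" using t by simp
  note law1 = next_time_law_thinned[OF t0]
  note law2 = accepted_time_law[OF t0]
  have "AE z in M \<Otimes>\<^sub>M ?Q. regular_sample t (snd z)"
    by (intro AE_pair_snd prob_space_M Q AE_regular_sample[OF t0])
  then have AE: "AE z in M \<Otimes>\<^sub>M ?Q. level_sample X t F l z = Y1 z - (if l = 0 then 0 else Y2 z)"
    using AE_space
  proof eventually_elim
    case (elim z)
    obtain \<omega> g b where z: "z = (\<omega>, g, b)" by (cases z) auto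
    have g: "0 \<le> g i" for i using elim(1) by (simp add: z regular_sample_def regular_gaps_def)
    have \<omega>: "\<omega> \<in> space M" using elim(2) by (auto simp: z space_pair_measure)
    have n: "num_arrivals g t + 1 = next_arrival g t"
      using t elim(1) by (intro num_arrivals_eq) (auto simp: z regular_sample_def)
    have "payoff_at F (\<lambda>u. X u \<omega>) g (num_arrivals g t + 1) = Y1 z"
      using payoff_at_eq[OF \<omega> g, of "next_arrival g t" F] n arrival_nonneg[of g, OF g]
      by (simp add: Y1_def z next_time_def max_absorb2)
    moreover have "payoff_at F (\<lambda>u. X u \<omega>) g (first_accepted g b t) = Y2 z"
      using payoff_at_eq[OF \<omega> g, of "first_accepted g b t" F] elim(1) arrival_nonneg[of g, OF g]
      by (simp add: Y2_def z accepted_time_def max_absorb2 regular_sample_def)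
    ultimately show ?case by (simp add: z level_sample_def)
  qed
  have rate: "1 \<le> real (n0 * s ^ l)" "q = real (n0 * s ^ l) / t"
    using n s by (simp_all add: q_def level_rate_def Suc_le_eq del: of_nat_mult)
  have V: "0 \<le> 45 * V t" using V_nonneg t by simp
  note w1 = N.variance_le_second_moment[OF m1 _ V, of "F (0,0)", unfolded Y1_def,
    OF payoff_random_variance[OF F Q t rate T1 law1], folded Y1_def]
  have e1: "integral\<^sup>L (M \<Otimes>\<^sub>M ?Q) Y1 = exp_mean F t q"
    unfolding Y1_def[abs_def] by (rule payoff_random_mean[OF F Q q T1 law1])
  show ?thesis
  proof (cases "l = 0")
    case True
    have "45 * V t \<le> 45 * real s * V t"
      using V_nonneg[OF t0] s by (simp add: mult_le_cancel_right1)
    with w1(3)[folded Y1_def[abs_def]] have v: "N.variance Y1 \<le> 45 * real s * V t" by linarith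
    show ?thesis
      by (rule exI[of _ Y1]; unfold level_model_def q_def[symmetric] N Let_def)
        (use True AE w1(1,2)[folded Y1_def[abs_def]] v e1 in simp_all)
  next
    case False
    then obtain k where l: "l = Suc k" by (cases l) auto
    have q2: "q / real s = level_rate t s n0 k" using s by (simp add: q_def level_rate_def l)
    have rate2: "1 \<le> real (n0 * s ^ k)" "q / real s = real (n0 * s ^ k) / t"
      using n s unfolding q2 by (simp_all add: level_rate_def Suc_le_eq del: of_nat_mult)
    have v2: "0 \<le> 45 * real s * V t / real s ^ l" using V_nonneg[OF t0] by simp
    have "(\<integral>\<^sup>+z. ennreal ((Y1 z - Y2 z)\<^sup>2) \<partial>(M \<Otimes>\<^sub>M ?Q)) \<le> ennreal (18 * V t / real (n0 * s ^ k))"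
      unfolding Y1_def Y2_def
    proof (rule payoff_random_difference_variance[OF F Q t rate2 T1 measurable_accepted_time _ law2])
      show "AE x in ?Q. t \<le> next_time t (fst x) \<and> next_time t (fst x) \<le> accepted_time t x"
        using AE_regular_sample[OF t0] by eventually_elim (auto simp: regular_sample_def)
    qed
    \<comment> \<open>The constant is enlarged to 45 so that level 0, a variance and not a
      difference, obeys the same formula; n0 \<ge> 1 is dropped.\<close>
    also have "18 * V t / real (n0 * s ^ k) \<le> 45 * V t / real (s ^ k)"
      using V_nonneg[OF t0] n s by (intro frac_le) auto
    also have "45 * V t / real (s ^ k) = 45 * real s * V t / real s ^ l"
      using s by (simp add: l)
    finally have v: "(\<integral>\<^sup>+z. ennreal ((Y1 z - Y2 z - 0)\<^sup>2) \<partial>(M \<Otimes>\<^sub>M ?Q)) \<le> ennreal (45 * real s * V t / real s ^ l)"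
      by (simp add: ennreal_leI)
    have "(\<lambda>z. Y1 z - Y2 z) \<in> borel_measurable (M \<Otimes>\<^sub>M ?Q)" by measurable
    note w = N.variance_le_second_moment[OF this v v2]
    have e2: "integral\<^sup>L (M \<Otimes>\<^sub>M ?Q) Y2 = exp_mean F t (level_rate t s n0 k)"
      unfolding Y2_def[abs_def] q2[symmetric] using q s
      by (intro payoff_random_mean[OF F Q _ measurable_accepted_time law2]) simp
    \<comment> \<open>The coarse payoff inherits integrability as the fine one minus the difference;
      its variance is never estimated on its own.\<close>
    have "integrable (M \<Otimes>\<^sub>M ?Q) Y2"
      using Bochner_Integration.integrable_diff[OF w1(1)[folded Y1_def[abs_def]] w(1)] by simp
    then have "integral\<^sup>L (M \<Otimes>\<^sub>M ?Q) (\<lambda>z. Y1 z - Y2 z) = exp_mean F t q - exp_mean F t (level_rate t s n0 k)"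
      using w1(1)[folded Y1_def[abs_def]] e1 e2 by simp
    then have e: "integral\<^sup>L (M \<Otimes>\<^sub>M ?Q) (\<lambda>z. Y1 z - Y2 z) =
        exp_mean F t q - (if l = 0 then 0 else exp_mean F t (level_rate t s n0 (l - 1)))"
      by (simp add: l)
    show ?thesis
      by (rule exI[of _ "\<lambda>z. Y1 z - Y2 z"]; unfold level_model_def q_def[symmetric] N Let_def)
        (use False AE w(1-3) e in simp_all)
  qed
qed

end

section \<open>Errors and costs of the estimators\<close>

lemma rmse_le:
  assumes "(\<integral>\<^sup>+\<omega>. ennreal ((Y \<omega> - \<theta>)\<^sup>2) \<partial>P) \<le> ennreal B" "0 \<le> B"
  shows "rmse P Y \<theta> \<le> ennreal (sqrt B)"
proof -
  have "(\<integral>\<^sup>+\<omega>. ennreal ((Y \<omega> - \<theta>)\<^sup>2) \<partial>P) \<noteq> \<top>"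
    using assms by (metis ennreal_neq_top top.extremum_unique)
  moreover have "enn2real (\<integral>\<^sup>+\<omega>. ennreal ((Y \<omega> - \<theta>)\<^sup>2) \<partial>P) \<le> B"
    using assms by (intro enn2real_leI) auto
  ultimately show ?thesis
    by (simp add: rmse_def Let_def ennreal_leI)
qed

lemma (in prob_space) variance_divide:
  "variance (\<lambda>x. Y x / c) = variance Y / (c :: real)\<^sup>2"
  by (simp add: diff_divide_distrib[symmetric] power_divide)

lemma AE_PiM_sum_eq:
  fixes h k :: "'i \<Rightarrow> 'b \<Rightarrow> real"
  assumes "finite I" "\<And>i. prob_space (N i)" "\<And>i. i \<in> I \<Longrightarrow> AE x in N i. k i x = h i x"
  shows "AE z in PiM I N. (\<Sum>i\<in>I. k i (z i)) = (\<Sum>i\<in>I. h i (z i))"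
proof -
  have "AE z in PiM I N. \<forall>i\<in>I. k i (z i) = h i (z i)"
    using assms by (intro AE_finite_allI AE_PiM_component)
  then show ?thesis by eventually_elim (auto intro!: sum.cong)
qed

lemma nn_integral_PiM_sum:
  assumes "finite I" and prob: "\<And>i. prob_space (N i)"
    and eq: "\<And>i. i \<in> I \<Longrightarrow> AE x in N i. k i x = k' i x"
    and k': "\<And>i. i \<in> I \<Longrightarrow> k' i \<in> borel_measurable (N i)" "\<And>i x. i \<in> I \<Longrightarrow> 0 \<le> k' i x"
  shows "(\<integral>\<^sup>+z. ennreal (\<Sum>i\<in>I. k i (z i)) \<partial>PiM I N) = (\<Sum>i\<in>I. \<integral>\<^sup>+x. ennreal (k' i x) \<partial>N i)"
proof -
  have comp: "(\<lambda>z. z i) \<in> measurable (PiM I N) (N i)" if "i \<in> I" for i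
    using that by (rule measurable_component_singleton)
  have "(\<integral>\<^sup>+z. ennreal (\<Sum>i\<in>I. k i (z i)) \<partial>PiM I N) = (\<integral>\<^sup>+z. (\<Sum>i\<in>I. ennreal (k' i (z i))) \<partial>PiM I N)"
  proof (rule nn_integral_cong_AE)
    have "AE z in PiM I N. (\<Sum>i\<in>I. k i (z i)) = (\<Sum>i\<in>I. k' i (z i))"
      by (rule AE_PiM_sum_eq[OF assms(1) prob eq])
    then show "AE z in PiM I N. ennreal (\<Sum>i\<in>I. k i (z i)) = (\<Sum>i\<in>I. ennreal (k' i (z i)))"
      by eventually_elim (simp add: k'(2))
  qed
  also have "\<dots> = (\<Sum>i\<in>I. \<integral>\<^sup>+z. ennreal (k' i (z i)) \<partial>PiM I N)"
    by (intro nn_integral_sum measurable_compose[OF _ measurable_ennreal]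
        measurable_compose[OF comp k'(1)]) auto
  also have "\<dots> = (\<Sum>i\<in>I. \<integral>\<^sup>+x. ennreal (k' i x) \<partial>N i)"
  proof (intro sum.cong refl)
    fix i assume i: "i \<in> I"
    have "distr (PiM I N) (N i) (\<lambda>z. z i) = N i"
      using prob i by (intro distr_PiM_component) auto
    then show "(\<integral>\<^sup>+z. ennreal (k' i (z i)) \<partial>PiM I N) = (\<integral>\<^sup>+x. ennreal (k' i x) \<partial>N i)"
      using nn_integral_distr[OF comp[OF i], of "\<lambda>x. ennreal (k' i x)"] k'(1)[OF i] by simp
  qed
  finally show ?thesis .
qed

lemma second_moment_sum_PiM_AE:
  fixes h k :: "'i \<Rightarrow> 'b \<Rightarrow> real"
  assumes "finite I" and prob: "\<And>i. prob_space (N i)"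
    and eq: "\<And>i. i \<in> I \<Longrightarrow> AE x in N i. k i x = h i x"
    and h: "\<And>i. i \<in> I \<Longrightarrow> integrable (N i) (h i)" "\<And>i. i \<in> I \<Longrightarrow> integrable (N i) (\<lambda>x. (h i x)\<^sup>2)"
  shows "(\<integral>\<^sup>+z. ennreal (((\<Sum>i\<in>I. k i (z i)) - \<theta>)\<^sup>2) \<partial>PiM I N) =
    ennreal ((\<Sum>i\<in>I. prob_space.variance (N i) (h i)) + ((\<Sum>i\<in>I. integral\<^sup>L (N i) (h i)) - \<theta>)\<^sup>2)"
proof -
  have "(\<integral>\<^sup>+z. ennreal (((\<Sum>i\<in>I. k i (z i)) - \<theta>)\<^sup>2) \<partial>PiM I N) =
      (\<integral>\<^sup>+z. ennreal (((\<Sum>i\<in>I. h i (z i)) + (- \<theta>))\<^sup>2) \<partial>PiM I N)"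
  proof (rule nn_integral_cong_AE)
    have "AE z in PiM I N. (\<Sum>i\<in>I. k i (z i)) = (\<Sum>i\<in>I. h i (z i))"
      by (rule AE_PiM_sum_eq[OF assms(1) prob eq])
    then show "AE z in PiM I N. ennreal (((\<Sum>i\<in>I. k i (z i)) - \<theta>)\<^sup>2) = ennreal (((\<Sum>i\<in>I. h i (z i)) + (- \<theta>))\<^sup>2)"
      by eventually_elim simp
  qed
  also have "\<dots> = ennreal ((\<Sum>i\<in>I. prob_space.variance (N i) (h i)) + ((\<Sum>i\<in>I. integral\<^sup>L (N i) (h i)) + (- \<theta>))\<^sup>2)"
    by (rule second_moment_sum_PiM[OF assms(1) prob h])
  finally show ?thesis by simp
qed

lemma ennreal_affine:
  "0 \<le> a \<Longrightarrow> 0 \<le> b \<Longrightarrow> 0 \<le> x \<Longrightarrow> ennreal a * ennreal x + ennreal b = ennreal (a * x + b)"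
  by (subst ennreal_plus) (auto simp: ennreal_mult')

lemma walk_cost_eq: "walk_cost costS costI cstep q k = real k * (costS q + costI q + cstep)"
  by (simp add: walk_cost_def)

context l2_levy_process
begin

lemma mc_error:
  assumes F: "1-lipschitz_on (UNIV \<times> {0..}) F" and t: "0 < t" and n: "1 \<le> n" and m: "1 \<le> m"
  shows "rmse (mc_space M t n m) (mc_estimator X t F m) (target M X t F)
    \<le> ennreal (sqrt (45 * V t / real m + 18 * V t / real n))"
proof -
  let ?N = "path_space M (real n / t)"
  have V: "0 \<le> V t" using V_nonneg t by simp
  interpret N: prob_space ?N using t n by (intro prob_space_path_space) auto
  obtain Y where Y:
    "AE z in ?N. payoff_at F (\<lambda>u. X u (fst z)) (snd z) (num_arrivals (snd z) t + 1) = Y z"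
    "integrable ?N Y" "integrable ?N (\<lambda>z. (Y z)\<^sup>2)"
    "N.variance Y \<le> 45 * V t" "integral\<^sup>L ?N Y = exp_mean F t (real n / t)"
    by (rule path_sample[OF F t n])
  let ?k = "\<lambda>z. payoff_at F (\<lambda>u. X u (fst z)) (snd z) (num_arrivals (snd z) t + 1) / real m"
  have est: "mc_estimator X t F m z = (\<Sum>i<m. ?k (z i))" for z
    by (simp add: mc_estimator_def sum_divide_distrib split_beta)
  have "(\<integral>\<^sup>+z. ennreal ((mc_estimator X t F m z - target M X t F)\<^sup>2) \<partial>mc_space M t n m) =
      ennreal ((\<Sum>i<m. N.variance (\<lambda>z. Y z / real m)) + ((\<Sum>i<m. integral\<^sup>L ?N (\<lambda>z. Y z / real m)) - target M X t F)\<^sup>2)"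
    unfolding est mc_space_def
    using Y(1-3) by (intro second_moment_sum_PiM_AE N.prob_space_axioms) (auto simp: power_divide)
  also have "(\<Sum>i<m. N.variance (\<lambda>z. Y z / real m)) = N.variance Y / real m"
    unfolding N.variance_divide using m by (simp add: power2_eq_square)
  also have "(\<Sum>i<m. integral\<^sup>L ?N (\<lambda>z. Y z / real m)) = exp_mean F t (real n / t)"
    using m Y(5) by simp
  also have "N.variance Y / real m + (exp_mean F t (real n / t) - target M X t F)\<^sup>2 \<le> 45 * V t / real m + 18 * V t / real n"
    using Y(4) exp_mean_bias[OF F t _ refl, of "real n"] n by (intro add_mono divide_right_mono) auto
  finally show ?thesis
    using V by (intro rmse_le) (auto simp: ennreal_leI)
qed

lemma mc_expected_cost:
  assumes t: "0 < t" and n: "1 \<le> n" and cost: "costS (real n / t) = cS" "costI (real n / t) = cI"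
    and c: "0 \<le> cS" "0 \<le> cI" "0 \<le> cstep" "0 \<le> cpay"
  shows "(\<integral>\<^sup>+z. ennreal (mc_cost costS costI cstep cpay t n m z) \<partial>mc_space M t n m)
    = ennreal (real m * ((cS + cI + cstep) * (real n + 1) + cpay))"
proof -
  define q where "q = real n / t"
  have q: "0 < q" using t n by (simp add: q_def)
  interpret exponential_gaps q by unfold_locales (rule q)
  let ?N = "path_space M q"
  define c' where "c' = cS + cI + cstep"
  have c': "0 \<le> c'" using c by (simp add: c'_def)
  have N: "?N = M \<Otimes>\<^sub>M S" by (simp add: path_space_def gap_space_eq)
  have [measurable]: "(\<lambda>z. real (next_arrival (snd z) t)) \<in> borel_measurable (M \<Otimes>\<^sub>M S)"
    by (intro measurable_compose[OF measurable_snd] measurable_compose[OF measurable_next_arrival]) simp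
  let ?k = "\<lambda>z. walk_cost costS costI cstep q (num_arrivals (snd z) t + 1) + cpay"
  have eq: "AE z in ?N. ?k z = c' * real (next_arrival (snd z) t) + cpay"
  proof -
    have "AE z in M \<Otimes>\<^sub>M S. regular_gaps (snd z) t"
      using AE_regular_gaps[of t] t by (intro AE_pair_snd prob_space_M P.prob_space_axioms) auto
    then show ?thesis
      unfolding N
    proof eventually_elim
      case (elim z)
      have "num_arrivals (snd z) t + 1 = next_arrival (snd z) t"
        using elim t by (intro num_arrivals_eq) auto
      then show ?case using cost by (simp only: walk_cost_eq) (simp add: q_def c'_def)
    qed
  qed
  have "(\<integral>\<^sup>+z. ennreal (mc_cost costS costI cstep cpay t n m z) \<partial>mc_space M t n m) =
      (\<integral>\<^sup>+z. ennreal (\<Sum>i<m. ?k (z i)) \<partial>PiM {..<m} (\<lambda>_. ?N))"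
    unfolding mc_cost_def mc_space_def q_def by (simp add: split_beta)
  also have "\<dots> = (\<Sum>i<m. \<integral>\<^sup>+z. ennreal (c' * real (next_arrival (snd z) t) + cpay) \<partial>?N)"
  proof (rule nn_integral_PiM_sum)
    show "(\<lambda>z. c' * real (next_arrival (snd z) t) + cpay) \<in> borel_measurable ?N"
      unfolding N by measurable
  qed (use eq q c c' in \<open>auto intro: prob_space_path_space\<close>)
  also have "(\<integral>\<^sup>+z. ennreal (c' * real (next_arrival (snd z) t) + cpay) \<partial>?N) = ennreal (c' * (real n + 1) + cpay)"
  proof -
    have "(\<integral>\<^sup>+z. ennreal (c' * real (next_arrival (snd z) t) + cpay) \<partial>?N) =
        (\<integral>\<^sup>+\<omega>. (\<integral>\<^sup>+g. ennreal c' * of_nat (next_arrival g t) + ennreal cpay \<partial>S) \<partial>M)"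
      unfolding N using c c'
      by (subst P.nn_integral_fst[symmetric])
        (auto simp: ennreal_mult' ennreal_of_nat_eq_real_of_nat intro!: nn_integral_cong)
    also have "\<dots> = ennreal c' * ennreal (q * t + 1) + ennreal cpay"
      using t by (simp add: nn_integral_add nn_integral_cmult expected_next_arrival P.emeasure_space_1
          prob_space.emeasure_space_1[OF prob_space_M])
    also have "\<dots> = ennreal (c' * (real n + 1) + cpay)"
    proof -
      have "q * t = real n" using t by (simp add: q_def)
      then show ?thesis using c c' by (simp only:) (rule ennreal_affine, auto)
    qed
    finally show ?thesis .
  qed
  finally show ?thesis
    using c c' by (simp add: c'_def ennreal_mult' ennreal_of_nat_eq_real_of_nat)
qed

text \<open>All samples of all levels are coordinates of a single product space indexed by pairs, so
  one bias-variance decomposition covers the whole estimator: variances add over levels, and the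
  telescoped mean leaves only the bias of level L.\<close>

lemma ml_error:
  fixes n0 s :: nat
  assumes F: "1-lipschitz_on (UNIV \<times> {0..}) F" and t: "0 < t" and n: "1 \<le> n0" and s: "1 < s"
    and m: "\<And>l. 1 \<le> m l"
  shows "rmse (ml_space M t s n0 L m) (ml_estimator X t F L m) (target M X t F)
    \<le> ennreal (sqrt ((\<Sum>l\<le>L. 45 * real s * V t / (real s ^ l * real (m l))) + 18 * V t / real s ^ L))"
proof -
  let ?N = "\<lambda>l. thinned_space M (level_rate t s n0 l) s"
  let ?I = "SIGMA l:{..L}. {..<m l}"
  have V: "0 \<le> V t" using V_nonneg t by simp
  have prob: "prob_space (?N l)" for l
    using level_rate_pos[OF t n s] s by (rule prob_space_thinned_space)
  obtain Y where Y': "\<And>l. level_model F t s n0 l (Y l)"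
    using choice[of "level_model F t s n0"] level_model_exists[OF F t n s] by blast
  have Y:
    "AE z in ?N l. level_sample X t F l z = Y l z" "integrable (?N l) (Y l)"
    "integrable (?N l) (\<lambda>z. (Y l z)\<^sup>2)"
    "prob_space.variance (?N l) (Y l) \<le> 45 * real s * V t / real s ^ l"
    "integral\<^sup>L (?N l) (Y l) = exp_mean F t (level_rate t s n0 l) -
        (if l = 0 then 0 else exp_mean F t (level_rate t s n0 (l - 1)))" for l
    using Y'[of l] unfolding level_model_def Let_def by blast+
  have est: "ml_estimator X t F L m z = (\<Sum>p\<in>?I. level_sample X t F (fst p) (z p) / real (m (fst p)))" for z
    unfolding ml_estimator_def by (simp add: sum.Sigma sum_divide_distrib split_beta)
  have "(\<integral>\<^sup>+z. ennreal ((ml_estimator X t F L m z - target M X t F)\<^sup>2) \<partial>ml_space M t s n0 L m) =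
      ennreal ((\<Sum>p\<in>?I. prob_space.variance (?N (fst p)) (\<lambda>z. Y (fst p) z / real (m (fst p)))) +
        ((\<Sum>p\<in>?I. integral\<^sup>L (?N (fst p)) (\<lambda>z. Y (fst p) z / real (m (fst p)))) - target M X t F)\<^sup>2)"
    unfolding est ml_space_def
  proof (rule second_moment_sum_PiM_AE)
    show "prob_space (?N (fst p))" for p :: "nat \<times> nat" by (rule prob)
    fix p :: "nat \<times> nat"
    show "AE x in ?N (fst p). level_sample X t F (fst p) x / real (m (fst p)) = Y (fst p) x / real (m (fst p))"
      using Y(1)[of "fst p"] by eventually_elim simp
    show "integrable (?N (fst p)) (\<lambda>z. Y (fst p) z / real (m (fst p)))"
      using Y(2)[of "fst p"] by simp
    show "integrable (?N (fst p)) (\<lambda>z. (Y (fst p) z / real (m (fst p)))\<^sup>2)"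
      using Y(3)[of "fst p"] by (simp add: power_divide)
  qed auto
  also have "(\<Sum>p\<in>?I. prob_space.variance (?N (fst p)) (\<lambda>z. Y (fst p) z / real (m (fst p)))) =
      (\<Sum>l\<le>L. \<Sum>i<m l. prob_space.variance (?N l) (\<lambda>z. Y l z / real (m l)))"
    by (subst sum.Sigma) (auto simp: split_beta)
  also have "\<dots> = (\<Sum>l\<le>L. prob_space.variance (?N l) (Y l) / real (m l))"
  proof (intro sum.cong refl)
    fix l
    have v: "prob_space.variance (?N l) (\<lambda>z. Y l z / real (m l)) = prob_space.variance (?N l) (Y l) / (real (m l))\<^sup>2"
      by (rule prob_space.variance_divide[OF prob])
    have "0 < real (m l)" using m[of l] by simp
    then show "(\<Sum>i<m l. prob_space.variance (?N l) (\<lambda>z. Y l z / real (m l))) =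
        prob_space.variance (?N l) (Y l) / real (m l)"
      unfolding v by (simp add: power2_eq_square)
  qed
  also have "(\<Sum>p\<in>?I. integral\<^sup>L (?N (fst p)) (\<lambda>z. Y (fst p) z / real (m (fst p)))) =
      (\<Sum>l\<le>L. \<Sum>i<m l. integral\<^sup>L (?N l) (\<lambda>z. Y l z / real (m l)))"
    by (subst sum.Sigma) (auto simp: split_beta)
  also have "\<dots> = (\<Sum>l\<le>L. integral\<^sup>L (?N l) (Y l))"
  proof (intro sum.cong refl)
    fix l
    have "m l \<noteq> 0" using m[of l] by simp
    then show "(\<Sum>i<m l. integral\<^sup>L (?N l) (\<lambda>z. Y l z / real (m l))) = integral\<^sup>L (?N l) (Y l)" by simp
  qed
  \<comment> \<open>Telescoping; the case distinction at level 0 supplies the start of the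
    sum.\<close>
  also have "\<dots> = exp_mean F t (level_rate t s n0 L)"
    unfolding Y(5) by (induction L) auto
  also have "ennreal ((\<Sum>l\<le>L. prob_space.variance (?N l) (Y l) / real (m l)) +
      (exp_mean F t (level_rate t s n0 L) - target M X t F)\<^sup>2)
    \<le> ennreal ((\<Sum>l\<le>L. 45 * real s * V t / (real s ^ l * real (m l))) + 18 * V t / real s ^ L)"
  proof (intro ennreal_leI add_mono sum_mono)
    fix l
    show "prob_space.variance (?N l) (Y l) / real (m l) \<le> 45 * real s * V t / (real s ^ l * real (m l))"
      using divide_right_mono[OF Y(4)[of l], of "real (m l)"] by simp
    have "1 \<le> real (n0 * s ^ L)" using n s by (simp add: Suc_le_eq del: of_nat_mult)
    then have "(exp_mean F t (level_rate t s n0 L) - target M X t F)\<^sup>2 \<le> 18 * V t / real (n0 * s ^ L)"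
      by (intro exp_mean_bias[OF F t]) (simp_all add: level_rate_def)
    also have "\<dots> \<le> 18 * V t / real (s ^ L)"
      using n s V by (intro divide_left_mono) auto
    finally show "(exp_mean F t (level_rate t s n0 L) - target M X t F)\<^sup>2 \<le> 18 * V t / real s ^ L" by simp
  qed
  finally show ?thesis
  proof (rule rmse_le)
    show "0 \<le> (\<Sum>l\<le>L. 45 * real s * V t / (real s ^ l * real (m l))) + 18 * V t / real s ^ L"
      using V by (intro add_nonneg_nonneg sum_nonneg) auto
  qed
qed

text \<open>Level 0 stops no later than the first accepted arrival and pays for one payoff only, so
  the cost of a coupled pair dominates it and one bound serves all levels. The expected number of
  steps is q t + s. The measurable version k is what the integral over the product space
  needs.\<close>

lemma level_expected_cost:
  fixes n0 s l :: nat
  assumes t: "0 < t" and n: "1 \<le> n0" and s: "1 < s"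
    and cost: "\<And>q. 0 < q \<Longrightarrow> costS q = cS" "\<And>q. 0 < q \<Longrightarrow> costI q = cI"
    and c: "0 \<le> cS" "0 \<le> cI" "0 \<le> cstep" "0 \<le> cpay"
  defines "N \<equiv> thinned_space M (level_rate t s n0 l) s"
  obtains k where "k \<in> borel_measurable N" "\<And>z. 0 \<le> k z"
    "AE z in N. level_cost costS costI cstep cpay t s n0 l z = k z"
    "(\<integral>\<^sup>+z. ennreal (k z) \<partial>N) \<le> ennreal ((cS + cI + cstep) * real (n0 * s ^ l + s) + 2 * cpay)"
proof -
  define q where "q = level_rate t s n0 l"
  have q: "0 < q" unfolding q_def by (rule level_rate_pos[OF t n s])
  interpret thinned_gaps q s by unfold_locales (use q s in auto)
  let ?Q = "S \<Otimes>\<^sub>M coins"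
  have N: "N = M \<Otimes>\<^sub>M ?Q" unfolding N_def thinned_space_def by (simp add: gap_space_eq coin_space_eq flip: q_def)
  interpret Q: prob_space ?Q by (rule prob_space_gaps_coins)
  define c' where "c' = cS + cI + cstep"
  have c': "0 \<le> c'" using c by (simp add: c'_def)
  define \<kappa> where "\<kappa> y = (if l = 0 then c' * real (next_arrival (fst y) t) + cpay else c' * real (accepted_index t y) + 2 * cpay)" for y
  have [measurable]: "(\<lambda>y. real (next_arrival (fst y) t)) \<in> borel_measurable ?Q"
    by (intro measurable_compose[OF measurable_fst] measurable_compose[OF measurable_next_arrival]) simp
  have [measurable]: "(\<lambda>y. real (accepted_index t y)) \<in> borel_measurable ?Q"
    by (rule measurable_compose[OF measurable_accepted_index]) simp
  have \<kappa>[measurable]: "\<kappa> \<in> borel_measurable ?Q" unfolding \<kappa>_def[abs_def] by (cases "l = 0") simp_all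
  have t0: "0 \<le> t" using t by simp
  have cost': "costS q + costI q + cstep = c'" using cost[OF q] by (simp add: c'_def)
  have rate: "q * t = real (n0 * s ^ l)" using t by (simp add: q_def level_rate_def)
  have "AE z in M \<Otimes>\<^sub>M ?Q. regular_sample t (snd z)"
    by (intro AE_pair_snd prob_space_M Q.prob_space_axioms AE_regular_sample[OF t0])
  then have AE: "AE z in M \<Otimes>\<^sub>M ?Q. level_cost costS costI cstep cpay t s n0 l z = \<kappa> (snd z)"
  proof eventually_elim
    case (elim z)
    obtain \<omega> g b where z: "z = (\<omega>, g, b)" by (cases z) auto
    have "num_arrivals g t + 1 = next_arrival g t"
      using t elim by (intro num_arrivals_eq) (auto simp: z regular_sample_def)
    moreover have "first_accepted g b t = accepted_index t (g, b)" using elim by (simp add: z regular_sample_def)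
    ultimately show ?case
      unfolding z level_cost_def \<kappa>_def walk_cost_eq q_def[symmetric] cost' Let_def split_conv by simp
  qed
  have "(\<integral>\<^sup>+y. ennreal (\<kappa> y) \<partial>?Q) \<le> (\<integral>\<^sup>+y. ennreal c' * of_nat (accepted_index t y) + ennreal (2 * cpay) \<partial>?Q)"
  proof (rule nn_integral_mono_AE)
    have "AE y in ?Q. next_arrival (fst y) t \<le> accepted_index t y"
      using AE_regular_sample[OF t0] by eventually_elim (simp add: regular_sample_def)
    then show "AE y in ?Q. ennreal (\<kappa> y) \<le> ennreal c' * of_nat (accepted_index t y) + ennreal (2 * cpay)"
    proof eventually_elim
      case (elim y)
      have "c' * real (next_arrival (fst y) t) \<le> c' * real (accepted_index t y)"
        using elim c' by (intro mult_left_mono) auto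
      then have "\<kappa> y \<le> c' * real (accepted_index t y) + 2 * cpay" using c by (simp add: \<kappa>_def)
      then have "ennreal (\<kappa> y) \<le> ennreal (c' * real (accepted_index t y) + 2 * cpay)" by (rule ennreal_leI)
      also have "\<dots> = ennreal c' * of_nat (accepted_index t y) + ennreal (2 * cpay)"
        using c c' by (simp add: ennreal_mult' ennreal_of_nat_eq_real_of_nat)
      finally show ?case .
    qed
  qed
  also have "\<dots> = ennreal c' * ennreal (q * t + real s) + ennreal (2 * cpay)"
    using expected_accepted_index[OF t0]
    by (simp add: nn_integral_add nn_integral_cmult Q.emeasure_space_1)
  also have "\<dots> = ennreal (c' * real (n0 * s ^ l + s) + 2 * cpay)"
    unfolding rate of_nat_add using c c' by (intro ennreal_affine) auto
  finally have le: "(\<integral>\<^sup>+y. ennreal (\<kappa> y) \<partial>?Q) \<le> ennreal (c' * real (n0 * s ^ l + s) + 2 * cpay)" .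
  show ?thesis
  proof (rule that[of "\<lambda>z. \<kappa> (snd z)"]; (unfold N)?)
    show "(\<lambda>z. \<kappa> (snd z)) \<in> borel_measurable (M \<Otimes>\<^sub>M ?Q)" by measurable
    show "0 \<le> \<kappa> (snd z)" for z using c c' by (simp add: \<kappa>_def)
    show "AE z in M \<Otimes>\<^sub>M ?Q. level_cost costS costI cstep cpay t s n0 l z = \<kappa> (snd z)" by (rule AE)
    have "(\<integral>\<^sup>+z. ennreal (\<kappa> (snd z)) \<partial>(M \<Otimes>\<^sub>M ?Q)) = (\<integral>\<^sup>+y. ennreal (\<kappa> y) \<partial>?Q)"
      by (subst Q.nn_integral_fst[symmetric]) (auto simp: prob_space.emeasure_space_1[OF prob_space_M])
    then show "(\<integral>\<^sup>+z. ennreal (\<kappa> (snd z)) \<partial>(M \<Otimes>\<^sub>M ?Q)) \<le> ennreal ((cS + cI + cstep) * real (n0 * s ^ l + s) + 2 * cpay)"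
      using le by (simp add: c'_def)
  qed
qed

lemma ml_expected_cost:
  fixes n0 s :: nat
  assumes t: "0 < t" and n: "1 \<le> n0" and s: "1 < s"
    and cost: "\<And>q. 0 < q \<Longrightarrow> costS q = cS" "\<And>q. 0 < q \<Longrightarrow> costI q = cI"
    and c: "0 \<le> cS" "0 \<le> cI" "0 \<le> cstep" "0 \<le> cpay"
  shows "(\<integral>\<^sup>+z. ennreal (ml_cost costS costI cstep cpay t s n0 L m z) \<partial>ml_space M t s n0 L m)
    \<le> ennreal (\<Sum>l\<le>L. real (m l) * ((cS + cI + cstep) * real (n0 * s ^ l + s) + 2 * cpay))"
proof -
  let ?N = "\<lambda>l. thinned_space M (level_rate t s n0 l) s"
  let ?I = "SIGMA l:{..L}. {..<m l}"
  let ?B = "\<lambda>l. (cS + cI + cstep) * real (n0 * s ^ l + s) + 2 * cpay"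
  have prob: "prob_space (?N l)" for l
    using level_rate_pos[OF t n s] s by (rule prob_space_thinned_space)
  have B: "0 \<le> ?B l" for l using c by simp
  define Pr where "Pr l k \<longleftrightarrow> k \<in> borel_measurable (?N l) \<and> (\<forall>z. 0 \<le> k z) \<and>
      (AE z in ?N l. level_cost costS costI cstep cpay t s n0 l z = k z) \<and>
      (\<integral>\<^sup>+z. ennreal (k z) \<partial>?N l) \<le> ennreal (?B l)" for l and k :: "_ \<Rightarrow> real"
  have "\<exists>k. Pr l k" for l
    unfolding Pr_def by (rule level_expected_cost[OF t n s cost c, where l = l]) blast+
  then obtain k where k': "\<And>l. Pr l (k l)"
    using choice[of Pr] by blast
  have k: "k l \<in> borel_measurable (?N l)" "\<And>z. 0 \<le> k l z"
      "AE z in ?N l. level_cost costS costI cstep cpay t s n0 l z = k l z"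
      "(\<integral>\<^sup>+z. ennreal (k l z) \<partial>?N l) \<le> ennreal (?B l)" for l
    using k'[of l] unfolding Pr_def by blast+
  have eq: "ml_cost costS costI cstep cpay t s n0 L m z = (\<Sum>p\<in>?I. level_cost costS costI cstep cpay t s n0 (fst p) (z p))"
    for z :: "nat \<times> nat \<Rightarrow> 'a \<times> (nat \<Rightarrow> real) \<times> (nat \<Rightarrow> bool)"
    unfolding ml_cost_def by (subst sum.Sigma) (auto simp: split_beta)
  have "(\<integral>\<^sup>+z. ennreal (ml_cost costS costI cstep cpay t s n0 L m z) \<partial>ml_space M t s n0 L m) =
      (\<integral>\<^sup>+z. ennreal (\<Sum>p\<in>?I. level_cost costS costI cstep cpay t s n0 (fst p) (z p)) \<partial>PiM ?I (\<lambda>p. ?N (fst p)))"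
    unfolding eq ml_space_def ..
  also have "\<dots> = (\<Sum>p\<in>?I. \<integral>\<^sup>+z. ennreal (k (fst p) z) \<partial>?N (fst p))"
    using k prob by (intro nn_integral_PiM_sum) auto
  also have "\<dots> \<le> (\<Sum>p\<in>?I. ennreal (?B (fst p)))"
    by (intro sum_mono k(4))
  also have "\<dots> = ennreal (\<Sum>p\<in>?I. ?B (fst p))"
    by (rule sum_ennreal) (rule B)
  also have "(\<Sum>p\<in>?I. ?B (fst p)) = (\<Sum>l\<le>L. real (m l) * ?B l)"
  proof -
    have "(\<Sum>l\<le>L. real (m l) * ?B l) = (\<Sum>l\<le>L. \<Sum>i<m l. ?B l)" by simp
    also have "\<dots> = (\<Sum>p\<in>?I. ?B (fst p))" by (subst sum.Sigma) (auto simp: split_beta)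
    finally show ?thesis ..
  qed
  finally show ?thesis .
qed

end

section \<open>Choice of sample sizes and levels\<close>

lemma sqrt_rate_exists:
  assumes "1 \<le> \<nu>"
  obtains n :: nat where "1 \<le> n" "n * n \<le> \<nu>" "1 / real n \<le> 2 * real \<nu> powr (- 1 / 2)"
proof -
  obtain n where n: "n\<^sup>2 \<le> \<nu>" "\<nu> < (Suc n)\<^sup>2"
    using floor_sqrt_power2_le Suc_floor_sqrt_power2_gt by blast
  have n1: "1 \<le> n" using n(2) assms by (cases n) auto
  \<comment> \<open>With n the integer part of the square root and n \<ge> 1, the successor n + 1 is
    at most 2 n.\<close>
  have "real \<nu> \<le> (2 * real n)\<^sup>2"
  proof -
    have "\<nu> \<le> (2 * n)\<^sup>2"
      using n(2) power_mono[of "Suc n" "2 * n" 2] n1 by linarith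
    then have "real \<nu> \<le> real ((2 * n)\<^sup>2)" by (simp only: of_nat_le_iff)
    then show ?thesis by simp
  qed
  then have "sqrt (real \<nu>) \<le> 2 * real n" by (intro real_le_lsqrt) auto
  moreover have "real \<nu> powr (- 1 / 2) = 1 / sqrt (real \<nu>)"
    using assms by (simp add: powr_minus_divide powr_half_sqrt)
  moreover have "1 / real n \<le> 2 * (1 / sqrt (real \<nu>))"
    using calculation(1) n1 assms by (simp add: field_simps)
  ultimately have "1 / real n \<le> 2 * real \<nu> powr (- 1 / 2)" by (simp only:)
  then show ?thesis using that[of n] n n1 by (simp add: power2_eq_square)
qed

lemma sum_powers_le: "2 \<le> s \<Longrightarrow> (\<Sum>l\<le>L. (s::real) ^ l) \<le> 2 * s ^ L"
proof (induction L)
  case (Suc L)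
  then have "2 * s ^ L \<le> s ^ Suc L" by (simp add: mult_right_mono)
  moreover have "(\<Sum>l\<le>L. s ^ l) \<le> 2 * s ^ L" using Suc by simp
  ultimately show ?case unfolding sum.atMost_Suc by linarith
qed simp

text \<open>Every level is given the same share \<open>\<nu> / (L + 1)\<close> of the computational budget.\<close>

lemma level_sizes:
  fixes s \<nu> :: nat
  assumes s: "1 < s" and \<nu>: "2 \<le> \<nu>"
  obtains L :: nat and m :: "nat \<Rightarrow> nat" where "\<And>l. 1 \<le> m l"
    "(\<Sum>l\<le>L. real (m l) * real s ^ l) \<le> 3 * real \<nu>"
    "(\<Sum>l\<le>L. 1 / (real s ^ l * real (m l))) \<le> (real L + 1)\<^sup>2 / real \<nu>"
    "1 / real s ^ L \<le> real s / real \<nu>" "real L + 1 \<le> 5 * (ln (real \<nu>))\<^sup>2"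
proof -
  \<comment> \<open>The upper inequality keeps the bias small. The lower one pays for rounding the
    sample sizes up: the extra sample per level costs the sum of s^l, at most 2 s^L \<le> 2 \<nu>,
    which together with the budget itself makes 3 \<nu>.\<close>
  obtain L where L: "s ^ L \<le> \<nu>" "\<nu> < s ^ (L + 1)"
    using ex_power_ivl1[of s \<nu>] s \<nu> by auto
  have s0: "0 < real s ^ l" for l using s by simp
  define a where "a l = real \<nu> / (real s ^ l * (real L + 1))" for l
  have a: "0 < a l" for l using s0[of l] \<nu> by (simp add: a_def)
  define m where "m l = nat \<lceil>a l\<rceil>" for l
  have m_ge: "a l \<le> real (m l)" for l unfolding m_def by (rule real_nat_ceiling_ge)
  have m_le: "real (m l) \<le> a l + 1" for l using a[of l] unfolding m_def by linarith
  show ?thesis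
  proof (rule that[of m L])
    show "1 \<le> m l" for l using a[of l] by (simp add: m_def Suc_le_eq)
    have "(\<Sum>l\<le>L. real (m l) * real s ^ l) \<le> (\<Sum>l\<le>L. (a l + 1) * real s ^ l)"
      by (intro sum_mono mult_right_mono m_le) simp
    also have "\<dots> = (\<Sum>l\<le>L. real \<nu> / (real L + 1)) + (\<Sum>l\<le>L. real s ^ l)"
      using s0 by (simp add: a_def distrib_right sum.distrib)
    also have "(\<Sum>l\<le>L. real \<nu> / (real L + 1)) = (real L + 1) * (real \<nu> / (real L + 1))"
      by (simp add: add.commute)
    also have "\<dots> = real \<nu>" using of_nat_0_le_iff[of L] by (intro nonzero_mult_div_cancel_left[THEN trans[OF times_divide_eq_right]]) linarith
    also have "(\<Sum>l\<le>L. real s ^ l) \<le> 2 * real s ^ L" using s by (intro sum_powers_le) simp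
    also have "real s ^ L \<le> real \<nu>" using L(1) by (metis of_nat_le_iff of_nat_power)
    finally show "(\<Sum>l\<le>L. real (m l) * real s ^ l) \<le> 3 * real \<nu>" by simp
    have "(\<Sum>l\<le>L. 1 / (real s ^ l * real (m l))) \<le> (\<Sum>l\<le>L. (real L + 1) / real \<nu>)"
    proof (intro sum_mono)
      fix l
      have "1 / (real s ^ l * real (m l)) \<le> 1 / (real s ^ l * a l)"
        using s0[of l] a[of l] m_ge[of l] by (intro divide_left_mono mult_left_mono mult_pos_pos) auto
      also have "real s ^ l * a l = real \<nu> / (real L + 1)"
      proof -
        have nz: "real s ^ l \<noteq> 0" using s0[of l] by linarith
        show ?thesis by (simp only: a_def times_divide_eq_right mult_divide_mult_cancel_left[OF nz])
      qed
      also have "1 / (real \<nu> / (real L + 1)) = (real L + 1) / real \<nu>" by simp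
      finally show "1 / (real s ^ l * real (m l)) \<le> (real L + 1) / real \<nu>" .
    qed
    then show "(\<Sum>l\<le>L. 1 / (real s ^ l * real (m l))) \<le> (real L + 1)\<^sup>2 / real \<nu>"
      by (simp add: power2_eq_square add.commute)
    have "real \<nu> \<le> real s * real s ^ L"
      using L(2) by (metis Suc_eq_plus1 less_imp_le of_nat_le_iff of_nat_power power_Suc)
    then show "1 / real s ^ L \<le> real s / real \<nu>"
      using s0[of L] \<nu> by (simp add: field_simps)
    define x where "x = ln (real \<nu>)"
    have ln2: "2 / 3 \<le> ln (2::real)" by (rule ln2_ge_two_thirds)
    have x: "2 / 3 \<le> x"
      using ln2 \<nu> unfolding x_def by (intro order_trans[OF ln2]) simp
    have "2 ^ L \<le> real \<nu>"
    proof -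
      have "2 ^ L \<le> s ^ L" using s by (intro power_mono) auto
      with L(1) have "2 ^ L \<le> \<nu>" by linarith
      then have "real (2 ^ L) \<le> real \<nu>" by (simp only: of_nat_le_iff)
      then show ?thesis by simp
    qed
    then have "ln (2 ^ L) \<le> x" using \<nu> unfolding x_def by (subst ln_le_cancel_iff) auto
    then have "real L * ln 2 \<le> x" by (simp add: ln_realpow)
    moreover have "real L * (2 / 3) \<le> real L * ln 2" using ln2 by (intro mult_left_mono) auto
    \<comment> \<open>From ln 2 \<ge> 2/3 one gets L \<le> 3/2 x, and x \<ge> 2/3 gives 1 \<le> 3/2
      x. The lower bound on x, due to \<nu> \<ge> 2, is used once more to pass from x to its
      square.\<close>
    ultimately have "real L + 1 \<le> 3 * x" using x by linarith
    also have "3 * x \<le> 5 * x\<^sup>2"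
      using mult_right_mono[OF x, of x] x by (simp add: power2_eq_square)
    finally show "real L + 1 \<le> 5 * (ln (real \<nu>))\<^sup>2" by (simp add: x_def)
  qed
qed

section \<open>Convergence rates under the cost constraint\<close>

context l2_levy_process
begin

lemma mc_rate:
  assumes F: "1-lipschitz_on (UNIV \<times> {0..}) F" and t: "0 < t" and \<nu>: "1 \<le> \<nu>"
    and cost: "\<And>q. 0 < q \<Longrightarrow> costS q = cS" "\<And>q. 0 < q \<Longrightarrow> costI q = cI"
    and c: "0 \<le> cS" "0 \<le> cI" "0 \<le> cstep" "0 \<le> cpay"
    and D: "2 * (cS + cI + cstep) + cpay \<le> D"
  shows "\<exists>n\<ge>1. \<exists>m\<ge>1.
    (\<integral>\<^sup>+z. ennreal (mc_cost costS costI cstep cpay t n m z) \<partial>mc_space M t n m)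
      \<le> ennreal (D * real \<nu>) \<and>
    rmse (mc_space M t n m) (mc_estimator X t F m) (target M X t F)
      \<le> ennreal (12 * l2_norm M X t * real \<nu> powr (- 1 / 4))"
proof -
  obtain n where n: "1 \<le> n" "n * n \<le> \<nu>" "1 / real n \<le> 2 * real \<nu> powr (- 1 / 2)"
    by (rule sqrt_rate_exists[OF \<nu>])
  define c' where "c' = cS + cI + cstep"
  have c': "0 \<le> c'" using c by (simp add: c'_def)
  have V: "0 \<le> V t" using V_nonneg t by simp
  have q: "0 < real n / t" using n t by simp
  \<comment> \<open>Both n and m are taken to be the integer square root, which balances variance
    against squared bias.\<close>
  have "real n * (c' * (real n + 1) + cpay) \<le> real n * (c' * (2 * real n) + cpay * real n)"
    using n(1) c c' by (intro mult_left_mono add_mono) (auto simp: mult_le_cancel_left1)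
  also have "\<dots> = (2 * c' + cpay) * real (n * n)" by (simp add: algebra_simps)
  also have "\<dots> \<le> (2 * c' + cpay) * real \<nu>"
    using n(2) c c' by (intro mult_left_mono) (auto simp del: of_nat_mult)
  also have "\<dots> \<le> D * real \<nu>"
    using D unfolding c'_def by (intro mult_right_mono) auto
  finally have "(\<integral>\<^sup>+z. ennreal (mc_cost costS costI cstep cpay t n n z) \<partial>mc_space M t n n)
      \<le> ennreal (D * real \<nu>)"
    using mc_expected_cost[of t n costS cS costI cI cstep cpay n, OF t n(1) cost(1)[OF q] cost(2)[OF q] c]
    by (simp add: c'_def ennreal_leI)
  moreover have "sqrt (45 * V t / real n + 18 * V t / real n) \<le> 12 * l2_norm M X t * real \<nu> powr (- 1 / 4)"
  proof (rule real_le_lsqrt)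
    have "45 * V t / real n + 18 * V t / real n = 63 * V t * (1 / real n)" by simp
    also have "\<dots> \<le> 63 * V t * (2 * real \<nu> powr (- 1 / 2))"
      using V n(3) by (intro mult_left_mono) auto
    \<comment> \<open>Here 63 = 45 + 18 collects variance and bias, and doubling gives 126, rounded
      up to the square of 12.\<close>
    also have "\<dots> \<le> 144 * (V t * real \<nu> powr (- 1 / 2))" using V by simp
    also have "\<dots> = (12 * l2_norm M X t * real \<nu> powr (- 1 / 4))\<^sup>2"
      using V t by (simp add: l2_norm_eq power_mult_distrib powr_powr[symmetric] powr_half_sqrt
          flip: powr_realpow) (simp add: power2_eq_square flip: powr_add)
    finally show "45 * V t / real n + 18 * V t / real n \<le> (12 * l2_norm M X t * real \<nu> powr (- 1 / 4))\<^sup>2" .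
    show "0 \<le> 12 * l2_norm M X t * real \<nu> powr (- 1 / 4)" by (simp add: l2_norm_def)
  qed
  then have "rmse (mc_space M t n n) (mc_estimator X t F n) (target M X t F)
      \<le> ennreal (12 * l2_norm M X t * real \<nu> powr (- 1 / 4))"
    by (intro order_trans[OF mc_error[OF F t n(1) n(1)]] ennreal_leI)
  ultimately show ?thesis using n(1) by blast
qed

lemma ml_rate:
  fixes n0 s :: nat
  assumes F: "1-lipschitz_on (UNIV \<times> {0..}) F" and t: "0 < t" and \<nu>: "2 \<le> \<nu>"
    and n0: "1 \<le> n0" and s: "1 < s"
    and cost: "\<And>q. 0 < q \<Longrightarrow> costS q = cS" "\<And>q. 0 < q \<Longrightarrow> costI q = cI"
    and c: "0 \<le> cS" "0 \<le> cI" "0 \<le> cstep" "0 \<le> cpay"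
    and D: "3 * (cS + cI + cstep + 2 * cpay) * real (n0 + s) \<le> D"
  shows "\<exists>L m. (\<forall>l\<le>L. 1 \<le> m l) \<and>
    (\<integral>\<^sup>+z. ennreal (ml_cost costS costI cstep cpay t s n0 L m z) \<partial>ml_space M t s n0 L m)
      \<le> ennreal (D * real \<nu>) \<and>
    rmse (ml_space M t s n0 L m) (ml_estimator X t F L m) (target M X t F)
      \<le> ennreal (5 * sqrt (63 * real s) * l2_norm M X t * real \<nu> powr (- 1 / 2) * (ln (real \<nu>))\<^sup>2)"
proof -
  obtain L :: nat and m :: "nat \<Rightarrow> nat" where m: "\<And>l. 1 \<le> m l"
    "(\<Sum>l\<le>L. real (m l) * real s ^ l) \<le> 3 * real \<nu>"
    "(\<Sum>l\<le>L. 1 / (real s ^ l * real (m l))) \<le> (real L + 1)\<^sup>2 / real \<nu>"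
    "1 / real s ^ L \<le> real s / real \<nu>" "real L + 1 \<le> 5 * (ln (real \<nu>))\<^sup>2"
    by (rule level_sizes[OF s \<nu>]) (rule that; assumption)
  define c' where "c' = cS + cI + cstep"
  have c': "0 \<le> c'" using c by (simp add: c'_def)
  have V: "0 \<le> V t" using V_nonneg t by simp
  have "(\<Sum>l\<le>L. real (m l) * (c' * real (n0 * s ^ l + s) + 2 * cpay)) \<le>
      (\<Sum>l\<le>L. (c' + 2 * cpay) * real (n0 + s) * (real (m l) * real s ^ l))"
  proof (intro sum_mono)
    fix l
    have 1: "1 \<le> real s ^ l" using s by simp
    \<comment> \<open>The steps that wait for an acceptance and, through \<open>one\<close>, the
      payoff evaluations are absorbed into a multiple of s^l, so that the cost becomes proportional
      to the budget sum of \<open>level_sizes\<close>.\<close>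
    have ns: "real (n0 * s ^ l + s) \<le> real (n0 + s) * real s ^ l"
      using mult_left_mono[OF 1, of "real s"] by (simp add: algebra_simps)
    have "1 \<le> real (n0 + s)" using n0 by simp
    then have one: "1 \<le> real (n0 + s) * real s ^ l"
      using 1 mult_mono[of 1 "real (n0 + s)" 1 "real s ^ l"] by simp
    have "c' * real (n0 * s ^ l + s) + 2 * cpay * 1 \<le>
        c' * (real (n0 + s) * real s ^ l) + 2 * cpay * (real (n0 + s) * real s ^ l)"
      using ns one c c' by (intro add_mono mult_left_mono) auto
    then have "real (m l) * (c' * real (n0 * s ^ l + s) + 2 * cpay) \<le>
        real (m l) * ((c' + 2 * cpay) * (real (n0 + s) * real s ^ l))"
      by (intro mult_left_mono) (auto simp: algebra_simps)
    then show "real (m l) * (c' * real (n0 * s ^ l + s) + 2 * cpay) \<le>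
        (c' + 2 * cpay) * real (n0 + s) * (real (m l) * real s ^ l)"
      by (simp add: ac_simps)
  qed
  also have "\<dots> \<le> (c' + 2 * cpay) * real (n0 + s) * (3 * real \<nu>)"
    unfolding sum_distrib_left[symmetric] using m(2) c c' by (intro mult_left_mono) auto
  also have "\<dots> = 3 * (c' + 2 * cpay) * real (n0 + s) * real \<nu>" by simp
  also have "\<dots> \<le> D * real \<nu>"
    using D unfolding c'_def by (intro mult_right_mono) auto
  finally have C: "(\<Sum>l\<le>L. real (m l) * (c' * real (n0 * s ^ l + s) + 2 * cpay)) \<le> D * real \<nu>" .
  have "(\<integral>\<^sup>+z. ennreal (ml_cost costS costI cstep cpay t s n0 L m z) \<partial>ml_space M t s n0 L m)
      \<le> ennreal (D * real \<nu>)"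
    by (rule order_trans[OF ml_expected_cost[OF t n0 s cost c] ennreal_leI[OF C[unfolded c'_def]]])
  moreover have "sqrt ((\<Sum>l\<le>L. 45 * real s * V t / (real s ^ l * real (m l))) + 18 * V t / real s ^ L)
      \<le> 5 * sqrt (63 * real s) * l2_norm M X t * real \<nu> powr (- 1 / 2) * (ln (real \<nu>))\<^sup>2"
  proof (rule real_le_lsqrt)
    have "(\<Sum>l\<le>L. 45 * real s * V t / (real s ^ l * real (m l))) =
        45 * real s * V t * (\<Sum>l\<le>L. 1 / (real s ^ l * real (m l)))"
      by (simp add: sum_distrib_left)
    also have "\<dots> \<le> 45 * real s * V t * ((real L + 1)\<^sup>2 / real \<nu>)"
      using V m(3) by (intro mult_left_mono) auto
    finally have 1: "(\<Sum>l\<le>L. 45 * real s * V t / (real s ^ l * real (m l))) \<le> 45 * real s * V t * ((real L + 1)\<^sup>2 / real \<nu>)" .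
    have "18 * V t / real s ^ L = 18 * V t * (1 / real s ^ L)" by simp
    \<comment> \<open>The squared bias lacks the factor (L + 1)^2 of the variance; inserting it lets
      both terms merge with constant 45 + 18 = 63.\<close>
    also have "\<dots> \<le> 18 * V t * (real s / real \<nu> * (real L + 1)\<^sup>2)"
      using V m(4) order_trans[OF m(4), of "real s / real \<nu> * (real L + 1)\<^sup>2"] mult_left_mono[of 1 "(real L + 1)\<^sup>2" "real s / real \<nu>"]
      by (intro mult_left_mono) auto
    also have "\<dots> = 18 * real s * V t * ((real L + 1)\<^sup>2 / real \<nu>)" by simp
    finally have 2: "18 * V t / real s ^ L \<le> 18 * real s * V t * ((real L + 1)\<^sup>2 / real \<nu>)" .
    have "45 * a * b * r + 18 * a * b * r = 63 * a * b * r" for a b r :: real by simp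
    with add_mono[OF 1 2] have "(\<Sum>l\<le>L. 45 * real s * V t / (real s ^ l * real (m l))) + 18 * V t / real s ^ L
        \<le> 63 * real s * V t * ((real L + 1)\<^sup>2 / real \<nu>)"
      by (simp only:)
    also have "\<dots> \<le> 63 * real s * V t * ((5 * (ln (real \<nu>))\<^sup>2)\<^sup>2 / real \<nu>)"
      using V m(5) by (intro mult_left_mono divide_right_mono power_mono) auto
    also have "\<dots> = (5 * sqrt (63 * real s) * l2_norm M X t * real \<nu> powr (- 1 / 2) * (ln (real \<nu>))\<^sup>2)\<^sup>2"
    proof -
      have "(real \<nu> powr (- 1 / 2))\<^sup>2 = 1 / real \<nu>"
        using \<nu> by (simp add: power2_eq_square powr_minus_divide flip: powr_add)
      moreover have "(l2_norm M X t)\<^sup>2 = V t" using V t by (simp add: l2_norm_eq)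
      moreover have "(sqrt (63 * real s))\<^sup>2 = 63 * real s" by simp
      ultimately show ?thesis by (simp only: power_mult_distrib) simp
    qed
    finally show "(\<Sum>l\<le>L. 45 * real s * V t / (real s ^ l * real (m l))) + 18 * V t / real s ^ L
      \<le> (5 * sqrt (63 * real s) * l2_norm M X t * real \<nu> powr (- 1 / 2) * (ln (real \<nu>))\<^sup>2)\<^sup>2" .
    show "0 \<le> 5 * sqrt (63 * real s) * l2_norm M X t * real \<nu> powr (- 1 / 2) * (ln (real \<nu>))\<^sup>2"
      by (simp add: l2_norm_def)
  qed
  then have "rmse (ml_space M t s n0 L m) (ml_estimator X t F L m) (target M X t F)
      \<le> ennreal (5 * sqrt (63 * real s) * l2_norm M X t * real \<nu> powr (- 1 / 2) * (ln (real \<nu>))\<^sup>2)"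
    by (intro order_trans[OF ml_error[OF F t n0 s m(1)]] ennreal_leI)
  ultimately show ?thesis using m(1) by blast
qed

end

lemma l2_levy_process_exists:
  assumes "levy_process M X" and "has_levy_measure M X \<Lambda>"
    and "(\<integral>\<^sup>+x. ennreal (x\<^sup>2) * indicator {x. 1 \<le> \<bar>x\<bar>} x \<partial>\<Lambda>) < \<infinity>"
  obtains A B where "l2_levy_process M X A B"
proof -
  interpret levy_process M X by fact
  obtain A B where AB: "0 \<le> A" "0 \<le> B"
    "\<And>u \<theta>. 0 \<le> u \<Longrightarrow> \<bar>\<theta>\<bar> \<le> 1 \<Longrightarrow>
      2 * (1 - Re (char (distr M borel (X u)) \<theta>)) \<le> (A * u + B * u\<^sup>2) * \<theta>\<^sup>2"
    by (rule has_levy_measure_char_bound[OF assms(2,3)]) (rule that; assumption)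
  have "l2_levy_process M X A B"
    using AB second_moment_le_char[OF measurable_X AB(3)] by unfold_locales auto
  then show ?thesis by (rule that)
qed



text \<open>The multilevel claim starts at \<nu> = 2: at \<nu> = 1 the logarithm vanishes and the
  bound would demand a zero error. The error constants are 12 and 5 sqrt (63 s); costs and n0 enter
  only the budget constant, which is chosen before the process, the horizon and the payoff.\<close>

theorem theorem5p3:
  shows "\<exists>C\<^sub>1>0. \<forall>s>1. \<exists>C\<^sub>2>0.
    \<forall>(costS :: real \<Rightarrow> real) (costI :: real \<Rightarrow> real) (cstep :: real) (cpay :: real) n\<^sub>0::nat.
      (\<exists>c\<ge>0. \<forall>q>0. costS q = c) \<and> (\<exists>c\<ge>0. \<forall>q>0. costI q = c) \<and>
      0 \<le> cstep \<and> 0 \<le> cpay \<and> 1 \<le> n\<^sub>0 \<longrightarrow>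
      (\<exists>D>0. \<forall>(M :: 'a measure) X \<Lambda> t F.
        levy_process M X \<and> has_levy_measure M X \<Lambda> \<and>
        (\<integral>\<^sup>+x. ennreal (x\<^sup>2) * indicator {x. 1 \<le> \<bar>x\<bar>} x \<partial>\<Lambda>) < \<infinity> \<and>
        1-lipschitz_on (UNIV \<times> {0..}) F \<and> 0 < t \<longrightarrow>
        (\<forall>\<nu>::nat. 1 \<le> \<nu> \<longrightarrow> (\<exists>n\<ge>1. \<exists>m\<ge>1.
          (\<integral>\<^sup>+z. ennreal (mc_cost costS costI cstep cpay t n m z) \<partial>mc_space M t n m)
            \<le> ennreal (D * real \<nu>) \<and>
          rmse (mc_space M t n m) (mc_estimator X t F m) (target M X t F)
            \<le> ennreal (C\<^sub>1 * l2_norm M X t * real \<nu> powr (- 1 / 4)))) \<and>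
        (\<forall>\<nu>::nat. 2 \<le> \<nu> \<longrightarrow> (\<exists>L m. (\<forall>l\<le>L. 1 \<le> m l) \<and>
          (\<integral>\<^sup>+z. ennreal (ml_cost costS costI cstep cpay t s n\<^sub>0 L m z) \<partial>ml_space M t s n\<^sub>0 L m)
            \<le> ennreal (D * real \<nu>) \<and>
          rmse (ml_space M t s n\<^sub>0 L m) (ml_estimator X t F L m) (target M X t F)
            \<le> ennreal (C\<^sub>2 * l2_norm M X t * real \<nu> powr (- 1 / 2) * (ln (real \<nu>))\<^sup>2))))"
proof (rule exI[of _ 12], intro conjI allI impI, goal_cases)
  case 1
  show ?case by simp
next
  case (2 s)
  then have s: "1 < s" .
  show ?case
  proof (rule exI[of _ "5 * sqrt (63 * real s)"], intro conjI allI impI, goal_cases)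
    case 1
    show ?case using s by simp
  next
    case (2 costS costI cstep cpay n0)
    then obtain cS cI where c: "0 \<le> cS" "0 \<le> cI" "0 \<le> cstep" "0 \<le> cpay"
      and cost: "\<And>q. 0 < q \<Longrightarrow> costS q = cS" "\<And>q. 0 < q \<Longrightarrow> costI q = cI" and n0: "1 \<le> n0"
      by blast
    \<comment> \<open>The multilevel budget also dominates the single-level one, as n0 + s \<ge> 1.
      The added 1 keeps D positive when all costs are 0.\<close>
    define D where "D = 3 * (cS + cI + cstep + 2 * cpay) * real (n0 + s) + 1"
    have ns: "1 \<le> real (n0 + s)" using n0 by simp
    have D_ml: "3 * (cS + cI + cstep + 2 * cpay) * real (n0 + s) \<le> D" by (simp add: D_def)
    have "3 * (cS + cI + cstep + 2 * cpay) * 1 \<le> 3 * (cS + cI + cstep + 2 * cpay) * real (n0 + s)"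
      using c ns by (intro mult_left_mono) auto
    then have D_mc: "2 * (cS + cI + cstep) + cpay \<le> D" using c by (simp add: D_def)
    have D_pos: "0 < D" using c by (auto simp: D_def intro!: add_nonneg_pos mult_nonneg_nonneg)
    show ?case
    proof (rule exI[of _ D], intro conjI allI impI D_pos, goal_cases)
      case (1 M X \<Lambda> t F \<nu>)
      then obtain A B where "l2_levy_process M X A B" using l2_levy_process_exists by blast
      then interpret l2_levy_process M X A B .
      show ?case using 1 by (intro mc_rate[OF _ _ _ cost c D_mc]) blast+
    next
      case (2 M X \<Lambda> t F \<nu>)
      then obtain A B where "l2_levy_process M X A B" using l2_levy_process_exists by blast
      then interpret l2_levy_process M X A B .
      show ?case using 2 by (intro ml_rate[OF _ _ _ n0 s cost c D_ml]) blast+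
    qed
  qed
qed

end
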